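(* Let $x\in B_n$ be a rigid braid such that $USS(x)$ is minimal and has only one orbit under cycling, of length $k$. For $j=1,\dots,k$ let $a_j=\iota(\mathbf c^{j-1}(x))$. Then: (i) If $\Delta^{-1}x\Delta\ne x$, then $Z(x)=\langle a_1\cdots a_{k/2}\,\Delta^{-1},\ \Delta^2\rangle$ (in this case $k$ is even). (ii) If $\Delta^{-1}x\Delta=x$, then $Z(x)=\langle PC(x),\ \Delta\rangle$. Here $Z(x)$ is the centralizer of $x$ in $B_n$.
   Context: $B_n$ is the braid group with Artin generators $\sigma_1,\dots,\sigma_{n-1}$; $B_n^+$ is the submonoid of products of positive powers of the $\sigma_i$; $\Delta=(\sigma_1\cdots\sigma_{n-1})(\sigma_1\cdots\sigma_{n-2})\cdots(\sigma_1\sigma_2)\sigma_1$. Write $a\preccurlyeq b$ ("$a$ is a prefix of $b$") if $a^{-1}b\in B_n^+$; this is a lattice order with meet $\wedge$. The simple elements are the $s$ with $1\preccurlyeq s\preccurlyeq\Delta$. Put $\tau(x)=\Delta^{-1}x\Delta$, $x^\alpha=\alpha^{-1}x\alpha$, and $\partial(s)=s^{-1}\Delta$ for $s$ simple. A product $st$ of simple elements is left-weighted if $\partial(s)\wedge t=1$. Every $x\in B_n$ has a unique left normal form $x=\Delta^p x_1\cdots x_l$ with $p\in\mathbb Z$, $l\ge0$, each $x_i$ simple and different from $1,\Delta$, and each $x_ix_{i+1}$ left-weighted. Put $\ell(x)=l$ (canonical length). If $l>0$ let $\iota(x)=\tau^{-p}(x_1)$ and $\varphi(x)=x_l$; also $\iota(\Delta^p)=1$,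 $\varphi(\Delta^p)=\Delta$. One has $\iota(x^{-1})=\partial(\varphi(x))$. A braid $x$ with $\ell(x)>0$ is rigid if $\varphi(x)\iota(x)$ is left-weighted, equivalently $\iota(x)\wedge\iota(x^{-1})=1$. Cycling is $\mathbf c(x)=\iota(x)^{-1}x\,\iota(x)$. $\ell_s(x)$ is the minimal canonical length among conjugates of $x$; $SSS(x)$ is the set of conjugates of $x$ of canonical length $\ell_s(x)$; the ultra summit set is $USS(x)=\{y\in SSS(x):\mathbf c^m(y)=y\text{ for some }m>0\}$, a finite disjoint union of closed orbits under cycling. A rigid braid $x$ belongs to $USS(x)$. For $y\in USS(x)$, a simple element $s\ne1$ is a minimal simple element for $y$ (with respect to $USS(x)$) if $y^s\in USS(x)$ and $y^t\notin USS(x)$ for every $t$ with $1\ne t\preccurlyeq s$, $t\neq s$. The directed graph $\Gamma_x$ has vertex set $USS(x)$ and an arrow labelled $s$ from $y$ to $y^s$ for each minimal simple element $s$ for $y$. An arrow $s$ starting at $y$ is black if $s\preccurlyeq\iota(y)$ and grey if $s\preccurlyeq\iota(y^{-1})$ (a priori it may be both). $USS(x)$ is called minimal if $\ell_s(x)>1$ and, for every $y\in USS(x)$, there is only one black arrow starting at $y$, and it is labelled $\iota(y)$, and only one grey arrow starting at $y$, and it is labelled $\iota(y^{-1})=\partial(\varphi(y))$. The preferred cycling conjugator of $x$ is $PC(x)=\iota(x)\,\iota(\mathbf c(x))\cdots\iota(\mathbf c^{t-1}(x))$, where $t$ is the smallest positive integer such that $\mathbf c^t(x)=\mathbf c^i(x)$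 for some $0\le i<t$; in the situation of the claim $t=k$ and $PC(x)=a_1\cdots a_k$. *)

theory Defs
  imports
    "HOL-Algebra.Generated_Groups"
    "HOL-Algebra.Lattice"
    "HOL-Combinatorics.Orbits"
begin

text \<open>A letter \<open>(i, True)\<close> stands for the Artin generator with index \<open>i\<close>,
  and \<open>(i, False)\<close> for its inverse.\<close>

type_synonym braid_word = "(nat \<times> bool) list"
type_synonym braid = "braid_word set"

definition braid_words :: "nat \<Rightarrow> braid_word set" where
  "braid_words n = lists ({1..<n} \<times> UNIV)"

inductive braid_equiv :: "nat \<Rightarrow> braid_word \<Rightarrow> braid_word \<Rightarrow> bool" for n where
  refl: "u \<in> braid_words n \<Longrightarrow> braid_equiv n u u"
| sym: "braid_equiv n u v \<Longrightarrow> braid_equiv n v u"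
| trans: "braid_equiv n u v \<Longrightarrow> braid_equiv n v w \<Longrightarrow> braid_equiv n u w"
| append: "braid_equiv n u u' \<Longrightarrow> braid_equiv n v v' \<Longrightarrow> braid_equiv n (u @ v) (u' @ v')"
| cancel: "i \<in> {1..<n} \<Longrightarrow> braid_equiv n [(i, b), (i, \<not> b)] []"
| far: "i \<in> {1..<n} \<Longrightarrow> j \<in> {1..<n} \<Longrightarrow> i + 2 \<le> j \<Longrightarrow>
    braid_equiv n [(i, True), (j, True)] [(j, True), (i, True)]"
| braid: "i \<in> {1..<n} \<Longrightarrow> Suc i \<in> {1..<n} \<Longrightarrow>
    braid_equiv n [(i, True), (Suc i, True), (i, True)]
      [(Suc i, True), (i, True), (Suc i, True)]"

definition braid_rel :: "nat \<Rightarrow> braid_word rel" where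
  "braid_rel n = {(u, v). braid_equiv n u v}"

definition braid_group :: "nat \<Rightarrow> braid monoid" ("\<B>") where
  "\<B> n = \<lparr>carrier = braid_words n // braid_rel n,
          monoid.mult = (\<lambda>x y. \<Union>u\<in>x. \<Union>v\<in>y. braid_rel n `` {u @ v}),
          one = braid_rel n `` {[]}\<rparr>"

lemma braid_equiv_words:
  "braid_equiv n u v \<Longrightarrow> u \<in> braid_words n \<and> v \<in> braid_words n"
  by (induction rule: braid_equiv.induct) (auto simp: braid_words_def)

lemma equiv_braid_rel: "equiv (braid_words n) (braid_rel n)"
proof (rule equivI)
  show "braid_rel n \<subseteq> braid_words n \<times> braid_words n"
    using braid_equiv_words by (auto simp: braid_rel_def)
  show "refl_on (braid_words n) (braid_rel n)"
    by (rule refl_onI) (simp add: braid_rel_def braid_equiv.refl)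
  show "sym (braid_rel n)"
    by (rule symI) (simp add: braid_rel_def braid_equiv.sym)
  show "trans (braid_rel n)"
    by (rule transI) (use braid_equiv.trans in \<open>auto simp: braid_rel_def\<close>)
qed

lemma braid_mult_class:
  assumes "u \<in> braid_words n" "v \<in> braid_words n"
  shows "(braid_rel n `` {u}) \<otimes>\<^bsub>\<B> n\<^esub> (braid_rel n `` {v}) = braid_rel n `` {u @ v}"
proof -
  have "(\<lambda>u v. braid_rel n `` {u @ v}) respects2 braid_rel n"
    unfolding congruent2_def
    by (auto intro!: equiv_class_eq[OF equiv_braid_rel])
      (simp add: braid_rel_def braid_equiv.append)
  with assms show ?thesis
    by (simp add: braid_group_def UN_equiv_class2[OF equiv_braid_rel equiv_braid_rel])
qed

lemma braid_inverse_word: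
  assumes "u \<in> braid_words n"
  shows "\<exists>v\<in>braid_words n. braid_equiv n (v @ u) []"
  using assms
proof (induction u)
  case Nil
  then show ?case by (intro bexI[of _ "[]"]) (simp_all add: braid_equiv.refl)
next
  case (Cons a u)
  obtain i b where a: "a = (i, b)" "i \<in> {1..<n}"
    using Cons.prems by (cases a) (auto simp: braid_words_def)
  have u: "u \<in> braid_words n" using Cons.prems by (simp add: braid_words_def)
  obtain v where v: "v \<in> braid_words n" "braid_equiv n (v @ u) []"
    using Cons.IH[OF u] by blast
  have "braid_equiv n ([(i, \<not> b), a] @ u) ([] @ u)"
    using braid_equiv.cancel[OF a(2), of "\<not> b"] a braid_equiv.refl[OF u]
    by (intro braid_equiv.append) auto
  then have "braid_equiv n (v @ ([(i, \<not> b), a] @ u)) (v @ ([] @ u))"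
    by (rule braid_equiv.append[OF braid_equiv.refl[OF v(1)]])
  then have "braid_equiv n ((v @ [(i, \<not> b)]) @ (a # u)) []"
    using braid_equiv.trans[OF _ v(2)] by simp
  moreover have "v @ [(i, \<not> b)] \<in> braid_words n"
    using v(1) a(2) by (auto simp: braid_words_def)
  ultimately show ?case by blast
qed

lemma group_braid_group: "group (\<B> n)"
proof (rule groupI)
  note words = braid_words_def
  have carr: "x \<in> carrier (\<B> n) \<longleftrightarrow> (\<exists>u\<in>braid_words n. x = braid_rel n `` {u})" for x
    by (auto simp: braid_group_def quotient_def)
  have nil: "[] \<in> braid_words n" by (simp add: words)
  have one: "\<one>\<^bsub>\<B> n\<^esub> = braid_rel n `` {[]}" by (simp add: braid_group_def)
  have app: "u @ v \<in> braid_words n" if "u \<in> braid_words n" "v \<in> braid_words n" for u v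
    using that by (simp add: words)
  show "\<one>\<^bsub>\<B> n\<^esub> \<in> carrier (\<B> n)" using carr nil one by blast
  show "x \<otimes>\<^bsub>\<B> n\<^esub> y \<in> carrier (\<B> n)"
    if "x \<in> carrier (\<B> n)" "y \<in> carrier (\<B> n)" for x y
    using that unfolding carr by (metis braid_mult_class app)
  show "x \<otimes>\<^bsub>\<B> n\<^esub> y \<otimes>\<^bsub>\<B> n\<^esub> z = x \<otimes>\<^bsub>\<B> n\<^esub> (y \<otimes>\<^bsub>\<B> n\<^esub> z)"
    if "x \<in> carrier (\<B> n)" "y \<in> carrier (\<B> n)" "z \<in> carrier (\<B> n)" for x y z
    using that unfolding carr by (auto simp: braid_mult_class app)
  show "\<one>\<^bsub>\<B> n\<^esub> \<otimes>\<^bsub>\<B> n\<^esub> x = x" if "x \<in> carrier (\<B> n)" for x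
    using that unfolding carr one by (auto simp: braid_mult_class nil)
  show "\<exists>y\<in>carrier (\<B> n). y \<otimes>\<^bsub>\<B> n\<^esub> x = \<one>\<^bsub>\<B> n\<^esub>" if x: "x \<in> carrier (\<B> n)" for x
  proof -
    obtain u where u: "u \<in> braid_words n" "x = braid_rel n `` {u}"
      using iffD1[OF carr x] by blast
    obtain v where v: "v \<in> braid_words n" "braid_equiv n (v @ u) []"
      using braid_inverse_word[OF u(1)] by blast
    have "braid_rel n `` {v @ u} = braid_rel n `` {[]}"
      by (rule equiv_class_eq[OF equiv_braid_rel]) (simp add: braid_rel_def v(2))
    then have "(braid_rel n `` {v}) \<otimes>\<^bsub>\<B> n\<^esub> x = \<one>\<^bsub>\<B> n\<^esub>"
      by (simp add: u(2) one braid_mult_class[OF v(1) u(1)])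
    moreover have "braid_rel n `` {v} \<in> carrier (\<B> n)"
      by (rule iffD2[OF carr]) (rule bexI[OF HOL.refl v(1)])
    ultimately show ?thesis by (rule bexI)
  qed
qed

definition artin :: "nat \<Rightarrow> nat \<Rightarrow> braid" where
  "artin n i = braid_rel n `` {[(i, True)]}"

definition braid_prod :: "nat \<Rightarrow> braid list \<Rightarrow> braid" where
  "braid_prod n xs = foldr (\<otimes>\<^bsub>\<B> n\<^esub>) xs \<one>\<^bsub>\<B> n\<^esub>"

definition positive_braids :: "nat \<Rightarrow> braid set" where
  "positive_braids n = {braid_prod n (map (artin n) is) | is. set is \<subseteq> {1..<n}}"

text \<open>The index list is \<open>[1, \<dots>, n-1, 1, \<dots>, n-2, \<dots>, 1, 2, 1]\<close>.\<close>

definition garside :: "nat \<Rightarrow> braid" where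
  "garside n =
    braid_prod n (map (artin n) (concat (map (\<lambda>m. [1..<Suc m]) (rev [1..<n]))))"

definition braid_order :: "nat \<Rightarrow> braid gorder" where
  "braid_order n = \<lparr>carrier = carrier (\<B> n), eq = (=),
     le = (\<lambda>a b. inv\<^bsub>\<B> n\<^esub> a \<otimes>\<^bsub>\<B> n\<^esub> b \<in> positive_braids n)\<rparr>"

definition simple_braids :: "nat \<Rightarrow> braid set" where
  "simple_braids n = {s \<in> carrier (\<B> n).
     \<one>\<^bsub>\<B> n\<^esub> \<sqsubseteq>\<^bsub>braid_order n\<^esub> s \<and> s \<sqsubseteq>\<^bsub>braid_order n\<^esub> garside n}"

definition conjug :: "nat \<Rightarrow> braid \<Rightarrow> braid \<Rightarrow> braid" where
  "conjug n x \<alpha> = inv\<^bsub>\<B> n\<^esub> \<alpha> \<otimes>\<^bsub>\<B> n\<^esub> x \<otimes>\<^bsub>\<B> n\<^esub> \<alpha>"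

text \<open>\<open>tau_pow n k\<close> is the \<open>k\<close>-th power (\<open>k\<close> any integer) of the automorphism
  \<open>\<tau>\<close>, conjugation by \<open>\<Delta>\<close>; so it is conjugation by the \<open>k\<close>-th power of \<open>\<Delta>\<close>.\<close>

definition tau_pow :: "nat \<Rightarrow> int \<Rightarrow> braid \<Rightarrow> braid" where
  "tau_pow n k x = conjug n x (garside n [^]\<^bsub>\<B> n\<^esub> k)"

definition complement :: "nat \<Rightarrow> braid \<Rightarrow> braid" where
  "complement n s = inv\<^bsub>\<B> n\<^esub> s \<otimes>\<^bsub>\<B> n\<^esub> garside n"

definition left_weighted :: "nat \<Rightarrow> braid \<Rightarrow> braid \<Rightarrow> bool" where
  "left_weighted n s t \<longleftrightarrow> complement n s \<sqinter>\<^bsub>braid_order n\<^esub> t = \<one>\<^bsub>\<B> n\<^esub>"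

definition is_left_normal_form :: "nat \<Rightarrow> braid \<Rightarrow> int \<Rightarrow> braid list \<Rightarrow> bool" where
  "is_left_normal_form n x p xs \<longleftrightarrow>
     x = garside n [^]\<^bsub>\<B> n\<^esub> p \<otimes>\<^bsub>\<B> n\<^esub> braid_prod n xs \<and>
     set xs \<subseteq> simple_braids n - {\<one>\<^bsub>\<B> n\<^esub>, garside n} \<and>
     (\<forall>i. Suc i < length xs \<longrightarrow> left_weighted n (xs ! i) (xs ! Suc i))"

definition left_normal_form :: "nat \<Rightarrow> braid \<Rightarrow> int \<times> braid list" where
  "left_normal_form n x = (THE d. is_left_normal_form n x (fst d) (snd d))"

definition inf_braid :: "nat \<Rightarrow> braid \<Rightarrow> int" where
  "inf_braid n x = fst (left_normal_form n x)"

definition factors_braid :: "nat \<Rightarrow> braid \<Rightarrow> braid list" where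
  "factors_braid n x = snd (left_normal_form n x)"

definition canonical_length :: "nat \<Rightarrow> braid \<Rightarrow> nat" where
  "canonical_length n x = length (factors_braid n x)"

definition initial_factor :: "nat \<Rightarrow> braid \<Rightarrow> braid" where
  "initial_factor n x =
     (if canonical_length n x = 0 then \<one>\<^bsub>\<B> n\<^esub>
      else tau_pow n (- inf_braid n x) (hd (factors_braid n x)))"

definition final_factor :: "nat \<Rightarrow> braid \<Rightarrow> braid" where
  "final_factor n x =
     (if canonical_length n x = 0 then garside n else last (factors_braid n x))"

definition rigid :: "nat \<Rightarrow> braid \<Rightarrow> bool" where
  "rigid n x \<longleftrightarrow>
     0 < canonical_length n x \<and> left_weighted n (final_factor n x) (initial_factor n x)"

definition cycling :: "nat \<Rightarrow> braid \<Rightarrow> braid" where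
  "cycling n x = conjug n x (initial_factor n x)"

definition conjugates :: "nat \<Rightarrow> braid \<Rightarrow> braid set" where
  "conjugates n x = conjug n x ` carrier (\<B> n)"

definition summit_length :: "nat \<Rightarrow> braid \<Rightarrow> nat" where
  "summit_length n x = (LEAST l. \<exists>y\<in>conjugates n x. canonical_length n y = l)"

definition SSS :: "nat \<Rightarrow> braid \<Rightarrow> braid set" where
  "SSS n x = {y \<in> conjugates n x. canonical_length n y = summit_length n x}"

definition USS :: "nat \<Rightarrow> braid \<Rightarrow> braid set" where
  "USS n x = {y \<in> SSS n x. \<exists>m>0. (cycling n ^^ m) y = y}"

text \<open>The library's \<^const>\<open>orbit\<close> consists of the iterates \<open>f\<^sup>m y\<close> with \<open>m > 0\<close>; on
  elements of \<^const>\<open>USS\<close>, which are periodic, this is the full closed orbit,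
  including \<open>y\<close>.\<close>

definition cycling_orbits :: "nat \<Rightarrow> braid \<Rightarrow> braid set set" where
  "cycling_orbits n x = orbit (cycling n) ` USS n x"

text \<open>The proper prefixes \<open>t\<close> of \<open>s\<close> are required to be simple: the prefix order
  lives on the whole group, and for instance \<open>\<Delta>\<^sup>-\<^sup>2\<close> lies below every simple
  element and conjugates \<open>y\<close> to itself.\<close>

definition minimal_simple :: "nat \<Rightarrow> braid \<Rightarrow> braid \<Rightarrow> braid \<Rightarrow> bool" where
  "minimal_simple n x y s \<longleftrightarrow>
     s \<in> simple_braids n \<and> s \<noteq> \<one>\<^bsub>\<B> n\<^esub> \<and> conjug n y s \<in> USS n x \<and>
     (\<forall>t\<in>simple_braids n. t \<noteq> \<one>\<^bsub>\<B> n\<^esub> \<and> t \<sqsubseteq>\<^bsub>braid_order n\<^esub> s \<and> t \<noteq> s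
        \<longrightarrow> conjug n y t \<notin> USS n x)"

text \<open>The arrows of the graph \<open>\<Gamma>\<^sub>x\<close> on \<^term>\<open>USS n x\<close>, as triples (source, label, target).\<close>

definition arrows :: "nat \<Rightarrow> braid \<Rightarrow> (braid \<times> braid \<times> braid) set" where
  "arrows n x = {(y, s, conjug n y s) | y s. y \<in> USS n x \<and> minimal_simple n x y s}"

definition black_arrows_from :: "nat \<Rightarrow> braid \<Rightarrow> braid \<Rightarrow> (braid \<times> braid \<times> braid) set" where
  "black_arrows_from n x y =
     {(y', s, z) \<in> arrows n x. y' = y \<and> s \<sqsubseteq>\<^bsub>braid_order n\<^esub> initial_factor n y}"

definition grey_arrows_from :: "nat \<Rightarrow> braid \<Rightarrow> braid \<Rightarrow> (braid \<times> braid \<times> braid) set" where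
  "grey_arrows_from n x y =
     {(y', s, z) \<in> arrows n x. y' = y \<and>
        s \<sqsubseteq>\<^bsub>braid_order n\<^esub> initial_factor n (inv\<^bsub>\<B> n\<^esub> y)}"

definition minimal_USS :: "nat \<Rightarrow> braid \<Rightarrow> bool" where
  "minimal_USS n x \<longleftrightarrow> 1 < summit_length n x \<and>
     (\<forall>y\<in>USS n x.
        (\<exists>z. black_arrows_from n x y = {(y, initial_factor n y, z)}) \<and>
        (\<exists>z. grey_arrows_from n x y = {(y, initial_factor n (inv\<^bsub>\<B> n\<^esub> y), z)}))"

definition preferred_cycling_conjugator :: "nat \<Rightarrow> braid \<Rightarrow> braid" where
  "preferred_cycling_conjugator n x =
     (let t = (LEAST t. 0 < t \<and> (\<exists>i<t. (cycling n ^^ t) x = (cycling n ^^ i) x))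
      in braid_prod n (map (\<lambda>i. initial_factor n ((cycling n ^^ i) x)) [0..<t]))"

definition braid_centralizer :: "nat \<Rightarrow> braid \<Rightarrow> braid set" where
  "braid_centralizer n x = {g \<in> carrier (\<B> n). g \<otimes>\<^bsub>\<B> n\<^esub> x = x \<otimes>\<^bsub>\<B> n\<^esub> g}"

end

theory Submission
  imports Defs
begin

text \<open>
  Multiplying by a power of the central braid \<open>\<Delta>\<^sup>2\<close> makes any braid positive, so
  the centralizer of a rigid braid \<open>x\<close> is known once the positive \<open>g\<close> with \<open>x\<^sup>g = x\<close> are known.
  Such a \<open>g\<close> is read as a walk on the ultra summit set: if \<open>y\<close> and \<open>y\<^sup>g\<close> lie in \<open>USS(x)\<close> and
  \<open>g \<noteq> 1\<close>, take a simple prefix \<open>t \<noteq> 1\<close> of \<open>g\<close> of least length with \<open>y\<^sup>t \<in> USS(x)\<close>, move to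
  \<open>y\<^sup>t\<close> and continue with \<open>t\<^sup>-\<^sup>1g\<close>, which is shorter. Then \<open>t\<close> labels an arrow of the graph, and
  under the minimality hypothesis it is \<open>\<iota>(y)\<close> or \<open>\<iota>(y\<^sup>-\<^sup>1)\<close>. The first label leads to \<open>\<^bold>c(y)\<close>, the
  second to \<open>\<tau>(\<^bold>c\<^sup>-\<^sup>1(y))\<close>.

  Put \<open>A\<^sub>i = \<iota>(x) \<iota>(\<^bold>c(x)) \<cdots> \<iota>(\<^bold>c\<^sup>i\<^sup>-\<^sup>1(x))\<close>, a braid that conjugates \<open>x\<close> to \<open>\<^bold>c\<^sup>i(x)\<close>.
  There is a single cycling orbit, so \<open>\<tau>(x) = \<^bold>c\<^sup>m(x)\<close> for some \<open>m\<close>, and \<open>h = A\<^sub>m\<Delta>\<^sup>-\<^sup>1\<close> commutes with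
  \<open>x\<close>. Starting at \<open>y = \<^bold>c\<^sup>i(x)\<close>, a step \<open>t = \<iota>(y)\<close> gives \<open>A\<^sub>it = A\<^sub>i\<^sub>+\<^sub>1\<close>, and a step
  \<open>t = \<iota>(y\<^sup>-\<^sup>1)\<close> gives \<open>A\<^sub>it = A\<^sub>i\<^sub>-\<^sub>1\<Delta> = h\<^sup>-\<^sup>1A\<^sub>m\<^sub>+\<^sub>i\<^sub>-\<^sub>1\<close>. Hence every closed walk at \<open>x\<close> has its
  label product in any subgroup that contains \<open>A\<^sub>k\<close> and \<open>h\<close> (\<open>conjugator_in_subgroup\<close>). If
  \<open>\<tau>(x) = x\<close>, then \<open>m = 0\<close> is possible and \<open>A\<^sub>k = PC(x)\<close>. Otherwise \<open>k = 2m\<close> and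
  \<open>A\<^sub>k = h\<^sup>2\<Delta>\<^sup>2\<close>.

  Two facts about a rigid \<open>y\<close> make the walk possible. If \<open>y\<^sup>u\<close> and \<open>y\<^sup>v\<close>
  are rigid, so is the conjugate by the meet of \<open>u\<close> and \<open>v\<close> (\<open>rigid_conj_meet\<close>), because rigidity
  of \<open>y\<^sup>u\<close> says that \<open>u\<close> is a fixed point of a map that preserves meets. This yields the prefix
  \<open>t\<close> above and shows that \<open>t\<close> lies below \<open>\<iota>(y)\<close> or \<open>\<iota>(y\<^sup>-\<^sup>1)\<close> as soon as its meet with one of
  them is nontrivial. If its meet with \<open>\<iota>(y\<^sup>-\<^sup>1)\<close> is trivial, then \<open>yt\<close> is left-weighted as
  written, which forces \<open>t\<close> to be a prefix of \<open>\<iota>(y)\<close>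
  (\<open>simple_conjugator_below_initial\<close>). Comparing powers shows that rigid braids have minimal
  canonical length in their conjugacy class, so that here \<open>USS(x)\<close> is exactly the set of rigid
  conjugates of \<open>x\<close>.

  The braid group is given by generators and relations, and the existence of
  meets has to be derived from the presentation. Garside's lemma in the monoid with the same
  generators and relations (\<open>gen_eq_gen\<close>) describes all common multiples of two generators.
  This monoid embeds in the group because \<open>\<Delta>\<close> is a common multiple of the generators and
  commutes with them up to a permutation (\<open>braid_equiv_positive\<close>). Least common multiples of
  positive braids with a common multiple follow by induction (\<open>P_join\<close>), then meets
  (\<open>glb\<close>), and then the left normal form, its uniqueness and the normal form of the inverse.
\<close>

section \<open>The positive braid monoid and the lemma of Garside\<close>

definition far :: "nat \<Rightarrow> nat \<Rightarrow> bool" where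
  "far i j \<longleftrightarrow> i + 2 \<le> j \<or> j + 2 \<le> i"

definition adjacent :: "nat \<Rightarrow> nat \<Rightarrow> bool" where
  "adjacent i j \<longleftrightarrow> j = Suc i \<or> i = Suc j"

lemma far_sym: "far i j \<Longrightarrow> far j i" by (auto simp: far_def)
lemma adjacent_sym: "adjacent i j \<Longrightarrow> adjacent j i" by (auto simp: adjacent_def)

lemma letter_cases:
  obtains "i = j" | "far i j" | "adjacent i j"
  unfolding far_def adjacent_def by linarith

text \<open>
  The indices are unbounded: both relations keep the set of letters, so this single monoid
  contains the positive monoids of all numbers of strands.
\<close>

inductive braid_step :: "nat list \<Rightarrow> nat list \<Rightarrow> bool" where
  far: "far i j \<Longrightarrow> braid_step (u @ [i, j] @ v) (u @ [j, i] @ v)"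
| adjacent: "adjacent i j \<Longrightarrow> braid_step (u @ [i, j, i] @ v) (u @ [j, i, j] @ v)"

abbreviation pos_equiv :: "nat list \<Rightarrow> nat list \<Rightarrow> bool" where
  "pos_equiv \<equiv> braid_step\<^sup>*\<^sup>*"

lemma braid_step_sym: "braid_step u v \<Longrightarrow> braid_step v u"
  by (induction rule: braid_step.induct)
     (metis far_sym adjacent_sym braid_step.intros)+

lemma pos_equiv_sym: "pos_equiv u v \<Longrightarrow> pos_equiv v u"
  by (metis braid_step_sym sympI symp_rtranclp sympD)

lemma braid_step_context: "braid_step u v \<Longrightarrow> braid_step (a @ u @ b) (a @ v @ b)"
proof (induction rule: braid_step.induct)
  case (far i j u v)
  then show ?case using braid_step.far[of i j "a @ u" "v @ b"] by simp
next
  case (adjacent i j u v)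
  then show ?case using braid_step.adjacent[of i j "a @ u" "v @ b"] by simp
qed

lemma pos_equiv_context: "pos_equiv u v \<Longrightarrow> pos_equiv (a @ u @ b) (a @ v @ b)"
  by (induction rule: rtranclp_induct) (auto intro: rtranclp.rtrancl_into_rtrancl braid_step_context)

lemma pos_equiv_append:
  assumes "pos_equiv u u'" "pos_equiv v v'" shows "pos_equiv (u @ v) (u' @ v')"
  using pos_equiv_context[OF assms(1), of "[]" v] pos_equiv_context[OF assms(2), of u' "[]"]
  by simp

lemma braid_step_length: "braid_step u v \<Longrightarrow> length u = length v"
  by (induction rule: braid_step.induct) auto
lemma braid_step_set: "braid_step u v \<Longrightarrow> set u = set v"
  by (induction rule: braid_step.induct) auto
lemma braid_step_rev: "braid_step u v \<Longrightarrow> braid_step (rev u) (rev v)"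
proof (induction rule: braid_step.induct)
  case (far i j u v)
  then show ?case using braid_step.far[OF far_sym, of i j "rev v" "rev u"] by simp
next
  case (adjacent i j u v)
  then show ?case using braid_step.adjacent[of i j "rev v" "rev u"] by simp
qed

lemma pos_equiv_length: "pos_equiv u v \<Longrightarrow> length u = length v"
  by (induction rule: rtranclp_induct) (auto dest: braid_step_length)
lemma pos_equiv_set: "pos_equiv u v \<Longrightarrow> set u = set v"
  by (induction rule: rtranclp_induct) (auto dest: braid_step_set)
lemma pos_equiv_rev: "pos_equiv u v \<Longrightarrow> pos_equiv (rev u) (rev v)"
  by (induction rule: rtranclp_induct) (auto intro: rtranclp.rtrancl_into_rtrancl braid_step_rev)

quotient_type pbraid = "nat list" / pos_equiv
  by (rule equivpI) (auto simp: reflp_def symp_def transp_def intro: pos_equiv_sym)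

instantiation pbraid :: monoid_mult
begin
lift_definition one_pbraid :: pbraid is "[]" .
lift_definition times_pbraid :: "pbraid \<Rightarrow> pbraid \<Rightarrow> pbraid" is "(@)"
  by (rule pos_equiv_append)
instance by standard (transfer, simp)+
end

lift_definition word :: "nat list \<Rightarrow> pbraid" is "\<lambda>u. u" .
lift_definition len :: "pbraid \<Rightarrow> nat" is length by (rule pos_equiv_length)
lift_definition reversal :: "pbraid \<Rightarrow> pbraid" is rev by (rule pos_equiv_rev)

abbreviation gen :: "nat \<Rightarrow> pbraid" where "gen i \<equiv> word [i]"

lemma word_append: "word (u @ v) = word u * word v" by transfer simp
lemma word_Nil [simp]: "word [] = 1" by transfer simp
lemma word_Cons: "word (i # u) = gen i * word u" by transfer simp
lemma word_eq_iff: "word u = word v \<longleftrightarrow> pos_equiv u v" by transfer simp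
lemma word_surj: obtains u where "a = word u"
proof -
  have "\<exists>u. a = word u" by transfer blast
  then show ?thesis using that by blast
qed
lemma len_mult [simp]: "len (a * b) = len a + len b" by transfer simp
lemma len_gen [simp]: "len (gen i) = 1" by transfer simp
lemma len_word: "len (word u) = length u" by transfer simp
lemma reversal_mult: "reversal (a * b) = reversal b * reversal a" by transfer simp
lemma reversal_reversal [simp]: "reversal (reversal a) = a" by transfer simp

lemma gen_far: "far i j \<Longrightarrow> gen i * gen j = gen j * gen i"
  using braid_step.far[of i j "[]" "[]"] by (auto simp flip: word_append simp: word_eq_iff)
lemma gen_adjacent: "adjacent i j \<Longrightarrow> gen i * gen j * gen i = gen j * gen i * gen j"
  using braid_step.adjacent[of i j "[]" "[]"] by (auto simp flip: word_append simp: word_eq_iff)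
lemma gen_far': "far i j \<Longrightarrow> gen i * (gen j * x) = gen j * (gen i * x)"
  using arg_cong[OF gen_far, of i j "\<lambda>y. y * x"] by (simp add: mult.assoc)
lemma gen_adjacent':
  "adjacent i j \<Longrightarrow> gen i * (gen j * (gen i * x)) = gen j * (gen i * (gen j * x))"
  using arg_cong[OF gen_adjacent, of i j "\<lambda>y. y * x"] by (simp add: mult.assoc)

text \<open>
  The factor by which the generator with index \<open>i\<close> has to be multiplied on the right to give the
  least common multiple of the generators with indices \<open>i\<close> and \<open>j\<close>.
\<close>

definition lcm_quot :: "nat \<Rightarrow> nat \<Rightarrow> pbraid" where
  "lcm_quot i j = (if i = j then 1 else if adjacent i j then gen j * gen i else gen j)"

lemma lcm_quot_simps [simp]:
  "lcm_quot i i = 1"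
  "far i j \<Longrightarrow> lcm_quot i j = gen j"
  "adjacent i j \<Longrightarrow> lcm_quot i j = gen j * gen i"
  by (auto simp: lcm_quot_def far_def adjacent_def)

text \<open>
  Garside's lemma for multiples of length \<open>m + 1\<close>, in the form needed by an induction on \<open>m\<close>.
\<close>

definition has_lcm :: "nat \<Rightarrow> bool" where
  "has_lcm m \<longleftrightarrow> (\<forall>a b i j. len a = m \<longrightarrow> gen i * a = gen j * b \<longrightarrow>
     (\<exists>c. a = lcm_quot i j * c \<and> b = lcm_quot j i * c))"

lemma has_lcmD:
  assumes "has_lcm (len a)" "gen i * a = gen j * b"
  obtains c where "a = lcm_quot i j * c" "b = lcm_quot j i * c"
  using assms unfolding has_lcm_def by blast

lemma has_lcm_cancel: "has_lcm (len a) \<Longrightarrow> gen i * a = gen i * b \<Longrightarrow> a = b"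
  by (metis has_lcmD lcm_quot_simps(1))

text \<open>
  The inductive step of Garside's lemma. In a chain of relations leading from a word starting
  with \<open>i\<close> to a word starting with \<open>j\<close>, let \<open>k\<close> be the first letter of some word in between. The
  tail after \<open>k\<close> is divisible by the quotients for \<open>(k, i)\<close> and for \<open>(k, j)\<close>. These two facts about
  a shorter element are analysed with Garside's lemma for smaller lengths, and the result is
  reassembled with the braid relations. The cases are the possible positions of three letters on
  the line; \<open>two_far\<close> and \<open>chain\<close> each cover a pair of cases that differ by exchanging \<open>i\<close> and \<open>j\<close>.
\<close>

lemma cube:
  assumes lcm: "\<And>m. m < N \<Longrightarrow> has_lcm m"
    and eq: "lcm_quot k i * e = lcm_quot k j * f"
    and N: "len (lcm_quot k i * e) = N"
  shows "\<exists>c. lcm_quot i k * e = lcm_quot i j * c \<and> lcm_quot j k * f = lcm_quot j i * c"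
proof -
  have step: thesis if "gen i * a = gen j * b" "len a < N"
      "\<And>c. a = lcm_quot i j * c \<Longrightarrow> b = lcm_quot j i * c \<Longrightarrow> thesis" for i j a b thesis
    using has_lcmD[OF lcm[OF that(2)] that(1)] that(3) by blast
  have cancel: "a = b" if "gen i * a = gen i * b" "len a < N" for i a b
    by (rule step[OF that]) simp
  have two_far: "\<exists>c. lcm_quot i k * e = lcm_quot i j * c \<and> lcm_quot j k * f = lcm_quot j i * c"
    if A: "adjacent i k" "far k j" "far i j" "lcm_quot k i * e = lcm_quot k j * f"
      "len (lcm_quot k i * e) = N" for i j k e f
  proof -
    note S = A(1-3) adjacent_sym[OF A(1)] far_sym[OF A(2)] far_sym[OF A(3)]
    from A S have 1: "gen i * (gen k * e) = gen j * f" by (simp add: mult.assoc)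
    have L: "len e + 2 = N" using A(5) S by simp
    obtain g where g: "gen k * e = gen j * g" "f = gen i * g"
      using 1 by (rule step) (use S L in auto)
    obtain h where h: "e = gen j * h" "g = gen k * h"
      using g(1) by (rule step) (use S L in auto)
    show ?thesis
    proof (intro exI conjI)
      show "lcm_quot i k * e = lcm_quot i j * (gen k * (gen i * h))"
        using S h by (simp add: mult.assoc) (metis gen_far')
      show "lcm_quot j k * f = lcm_quot j i * (gen k * (gen i * h))"
        using S g h by (simp add: mult.assoc) (metis gen_adjacent')
    qed
  qed
  have chain: "\<exists>c. lcm_quot i k * e = lcm_quot i j * c \<and> lcm_quot j k * f = lcm_quot j i * c"
    if A: "adjacent i k" "adjacent i j" "far k j" "lcm_quot k i * e = lcm_quot k j * f"
      "len (lcm_quot k i * e) = N" for i j k e f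
  proof -
    note S = A(1-3) adjacent_sym[OF A(1)] adjacent_sym[OF A(2)] far_sym[OF A(3)]
    from A S have 1: "gen i * (gen k * e) = gen j * f" by (simp add: mult.assoc)
    have L: "len e + 2 = N" using A(5) S by simp
    obtain g where g: "gen k * e = gen j * (gen i * g)" "f = gen i * (gen j * g)"
      using 1 by (rule step) (use S L in \<open>auto simp: mult.assoc\<close>)
    obtain h where h: "e = gen j * h" "gen i * g = gen k * h"
      using g(1) by (rule step) (use S L in auto)
    have "len f = len e + 1" using arg_cong[OF 1, of len] by simp
    then have L': "len g < N" using g(2) L by simp
    obtain m where m: "g = gen k * (gen i * m)" "h = gen i * (gen k * m)"
      using h(2) by (rule step) (use S L' in \<open>auto simp: mult.assoc\<close>)
    show ?thesis
    proof (intro exI conjI)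
      have "gen k * (gen i * (gen j * (gen i * (gen k * m)))) = gen k * (gen j * (gen i * (gen j * (gen k * m))))"
        by (metis S gen_adjacent')
      also have "\<dots> = gen j * (gen k * (gen i * (gen k * (gen j * m))))"
        by (metis S gen_far')
      also have "\<dots> = gen j * (gen i * (gen k * (gen i * (gen j * m))))"
        by (metis S gen_adjacent')
      finally show "lcm_quot i k * e = lcm_quot i j * (gen k * (gen i * (gen j * m)))"
        using S h m by (simp add: mult.assoc)
      have "gen k * (gen i * (gen j * (gen k * (gen i * m)))) = gen k * (gen i * (gen k * (gen j * (gen i * m))))"
        by (metis S gen_far')
      also have "\<dots> = gen i * (gen k * (gen i * (gen j * (gen i * m))))"
        by (metis S gen_adjacent')
      also have "\<dots> = gen i * (gen k * (gen j * (gen i * (gen j * m))))"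
        by (metis S gen_adjacent')
      also have "\<dots> = gen i * (gen j * (gen k * (gen i * (gen j * m))))"
        by (metis S gen_far')
      finally show "lcm_quot j k * f = lcm_quot j i * (gen k * (gen i * (gen j * m)))"
        using S g h m by (simp add: mult.assoc)
    qed
  qed
  have N': "len (lcm_quot k j * f) = N" using eq N by simp
  consider "i = k" | "k = j" | "i = j" "k \<noteq> i" | "far i k" "far k j" "far i j" | "adjacent i k" "far k j" "far i j"
    | "far i k" "adjacent k j" "far i j" | "far i k" "far k j" "adjacent i j"
    | "adjacent i k" "adjacent k j" "far i j" | "adjacent i k" "far k j" "adjacent i j"
    | "far i k" "adjacent k j" "adjacent i j"
    | "adjacent i k" "adjacent k j" "adjacent i j"
    by (metis letter_cases)
  then show ?thesis
  proof cases
    case 1 then show ?thesis using eq by auto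
  next
    case 2 then show ?thesis using eq by auto
  next
    case 3
    have "e = f"
    proof (cases rule: letter_cases[of k i])
      case 1 with \<open>k \<noteq> i\<close> show ?thesis by simp
    next
      case 2
      have "N = len e + 1" using N 2 by simp
      moreover have "gen i * e = gen i * f" using eq 3(1) 2 by simp
      ultimately show ?thesis by - (rule cancel, auto)
    next
      case A: 3
      have L: "N = len e + 2" using N A by simp
      have "gen i * (gen k * e) = gen i * (gen k * f)" using eq 3(1) A by (simp add: mult.assoc)
      then have "gen k * e = gen k * f" using L by - (rule cancel, auto)
      then show ?thesis using L by - (rule cancel, auto)
    qed
    then show ?thesis using 3 by auto
  next
    case 4
    note S = 4 far_sym[OF 4(1)] far_sym[OF 4(2)] far_sym[OF 4(3)]
    have "N = len e + 1" using N S by simp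
    have "gen i * e = gen j * f" using eq S by simp
    then obtain g where "e = gen j * g" "f = gen i * g"
      by (rule step) (use S \<open>N = _\<close> in auto)
    then show ?thesis using S by (intro exI[of _ "gen k * g"]) (simp; metis gen_far')
  next
    case 5 then show ?thesis using two_far eq N by blast
  next
    case 6 then show ?thesis using two_far[of j k i f e] eq N' by (metis far_sym adjacent_sym)
  next
    case 7
    note S = 7 far_sym[OF 7(1)] far_sym[OF 7(2)] adjacent_sym[OF 7(3)]
    have "N = len e + 1" using N S by simp
    have "gen i * e = gen j * f" using eq S by simp
    then obtain g where "e = gen j * (gen i * g)" "f = gen i * (gen j * g)"
      by (rule step) (use S \<open>N = _\<close> in \<open>auto simp: mult.assoc\<close>)
    then show ?thesis using S
      by (intro exI[of _ "gen k * g"]) (simp add: mult.assoc; metis gen_far')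
  next
    case 8
    note S = 8 adjacent_sym[OF 8(1)] adjacent_sym[OF 8(2)] far_sym[OF 8(3)]
    have 1: "gen i * (gen k * e) = gen j * (gen k * f)"
      using eq S by (simp add: mult.assoc)
    have L: "len e + 2 = N" "len f + 2 = N" using N N' S by auto
    obtain g where g: "gen k * e = gen j * g" "gen k * f = gen i * g"
      using 1 by (rule step) (use S L in auto)
    obtain h where h: "e = gen j * (gen k * h)" "g = gen k * (gen j * h)"
      using g(1) by (rule step) (use S L in \<open>auto simp: mult.assoc\<close>)
    obtain h' where h': "f = gen i * (gen k * h')" "g = gen k * (gen i * h')"
      using g(2) by (rule step) (use S L in \<open>auto simp: mult.assoc\<close>)
    have "gen j * h = gen i * h'" using h h' L by - (rule cancel[of k], auto)
    then obtain p where p: "h = gen i * p" "h' = gen j * p"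
      by (rule step) (use S L h in auto)
    show ?thesis
    proof (intro exI conjI)
      have "gen k * (gen i * (gen j * (gen k * (gen i * p)))) = gen k * (gen j * (gen i * (gen k * (gen i * p))))"
        by (metis S gen_far')
      also have "\<dots> = gen k * (gen j * (gen k * (gen i * (gen k * p))))"
        by (metis S gen_adjacent')
      also have "\<dots> = gen j * (gen k * (gen j * (gen i * (gen k * p))))"
        by (metis S gen_adjacent')
      finally show "lcm_quot i k * e = lcm_quot i j * (gen k * (gen j * (gen i * (gen k * p))))"
        using S h p by (simp add: mult.assoc)
      have "gen k * (gen j * (gen i * (gen k * (gen j * p)))) = gen k * (gen i * (gen j * (gen k * (gen j * p))))"
        by (metis S gen_far')
      also have "\<dots> = gen k * (gen i * (gen k * (gen j * (gen k * p))))"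
        by (metis S gen_adjacent')
      also have "\<dots> = gen i * (gen k * (gen i * (gen j * (gen k * p))))"
        by (metis S gen_adjacent')
      also have "\<dots> = gen i * (gen k * (gen j * (gen i * (gen k * p))))"
        by (metis S gen_far')
      finally show "lcm_quot j k * f = lcm_quot j i * (gen k * (gen j * (gen i * (gen k * p))))"
        using S h' p by (simp add: mult.assoc)
    qed
  next
    case 9 then show ?thesis using chain eq N by blast
  next
    case 10 then show ?thesis using chain[of j k i f e] eq N' by (metis far_sym adjacent_sym)
  next
    case 11 then show ?thesis by (auto simp: adjacent_def)
  qed
qed

lemma braid_step_Cons:
  assumes "braid_step (k # d) (j # b)"
  shows "(k = j \<and> braid_step d b) \<or> (\<exists>f. word d = lcm_quot k j * f \<and> word b = lcm_quot j k * f)"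
  using assms
proof (cases rule: braid_step.cases)
  case (far i l u v)
  show ?thesis
  proof (cases u)
    case Nil
    with far have "word d = lcm_quot k j * word v \<and> word b = lcm_quot j k * word v"
      using far_sym[of i l] by (auto simp: word_Cons[of _ v])
    then show ?thesis by blast
  next
    case (Cons a u')
    with far show ?thesis using braid_step.far[of i l u' v] by auto
  qed
next
  case (adjacent i l u v)
  show ?thesis
  proof (cases u)
    case Nil
    with adjacent have "word d = lcm_quot k j * word v \<and> word b = lcm_quot j k * word v"
      using adjacent_sym[of i l] by (auto simp: word_Cons[of _ "_ # v"] word_Cons[of _ v] mult.assoc)
    then show ?thesis by blast
  next
    case (Cons a u')
    with adjacent show ?thesis using braid_step.adjacent[of i l u' v] by auto
  qed
qed

lemma has_lcm: "has_lcm m"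
proof (induction m rule: less_induct)
  case (less N)
  have *: "\<exists>c. word u = lcm_quot i j * c \<and> word b = lcm_quot j i * c"
    if "pos_equiv (i # u) w" "w = j # b" "length u = N" for i j u b w
    using that(1,2)
  proof (induction arbitrary: j b rule: rtranclp_induct)
    case base then show ?case by auto
  next
    case (step w0 w)
    have "w0 \<noteq> []" using step.hyps(1) pos_equiv_length by fastforce
    then obtain k d where w0: "w0 = k # d" by (cases w0) auto
    from step.IH[OF this] obtain e where e: "word u = lcm_quot i k * e" "word d = lcm_quot k i * e" by blast
    have "length d = N" using pos_equiv_length[OF step.hyps(1)] w0 that(3) by simp
    then have N: "len (lcm_quot k i * e) = N" using e(2)[symmetric] by (simp add: len_word)
    from braid_step_Cons[OF step.hyps(2)[unfolded w0 step.prems]] show ?case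
    proof
      assume "k = j \<and> braid_step d b"
      then have "word d = word b" "k = j" by (auto simp: word_eq_iff)
      with e show ?thesis by metis
    next
      assume "\<exists>f. word d = lcm_quot k j * f \<and> word b = lcm_quot j k * f"
      then obtain f where f: "word d = lcm_quot k j * f" "word b = lcm_quot j k * f" by blast
      from cube[OF less.IH _ N, of j f] e f show ?thesis by metis
    qed
  qed
  show ?case unfolding has_lcm_def
  proof (intro allI impI)
    fix a b i j assume A: "len a = N" "gen i * a = gen j * b"
    obtain u v where uv: "a = word u" "b = word v" by (metis word_surj)
    have "pos_equiv (i # u) (j # v)" using A(2) unfolding uv by (simp flip: word_Cons add: word_eq_iff)
    moreover have "length u = N" using A(1) uv by (simp add: len_word)
    ultimately show "\<exists>c. a = lcm_quot i j * c \<and> b = lcm_quot j i * c" using * uv by blast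
  qed
qed

text \<open>
  Garside's lemma: the common right multiples of two generators are the multiples of their
  least common multiple. For \<open>i = j\<close> it is left cancellation of a generator.
\<close>

theorem gen_eq_gen:
  assumes "gen i * a = gen j * b"
  obtains c where "a = lcm_quot i j * c" "b = lcm_quot j i * c"
  using has_lcmD[OF has_lcm assms] .

lemma pbraid_left_cancel: "a * b = a * c \<Longrightarrow> b = (c :: pbraid)"
proof -
  obtain u where u: "a = word u" by (rule word_surj)
  show "a * b = a * c \<Longrightarrow> b = c" unfolding u
  proof (induction u)
    case (Cons i u)
    have "gen i * (word u * b) = gen i * (word u * c)"
      using Cons.prems word_Cons[of i u] by (metis mult.assoc)
    then show ?case using Cons.IH has_lcm_cancel[OF has_lcm] by blast
  qed simp
qed

text \<open>
  Reading words backwards respects the relations, and turns left into right cancellation.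
\<close>

lemma pbraid_right_cancel: "b * a = c * a \<Longrightarrow> b = (c :: pbraid)"
  by (metis pbraid_left_cancel reversal_mult reversal_reversal)

section \<open>The element \<open>\<Delta>\<close> and the embedding of the positive monoid\<close>

fun delta_word :: "nat \<Rightarrow> nat list" where
  "delta_word 0 = []"
| "delta_word (Suc m) = [1..<Suc (Suc m)] @ delta_word m"

lemma garside_delta_word: "garside n = braid_prod n (map (artin n) (delta_word (n - 1)))"
proof -
  have "concat (map (\<lambda>m. [1..<Suc m]) (rev [1..<Suc m])) = delta_word m" for m
    by (induction m) auto
  from this[of "n - 1"] show ?thesis unfolding garside_def by (cases n) auto
qed

lemma set_delta_word: "set (delta_word m) \<subseteq> {1..m}"
  by (induction m) auto

abbreviation delta :: "nat \<Rightarrow> pbraid" where "delta m \<equiv> word (delta_word m)"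

lemma word_commute_far: "(\<And>j. j \<in> set u \<Longrightarrow> far i j) \<Longrightarrow> word u * gen i = gen i * word u"
proof (induction u)
  case (Cons j u)
  have "word (j # u) * gen i = gen j * (gen i * word u)"
    using Cons by (simp add: word_Cons[of j u] mult.assoc)
  also have "\<dots> = gen i * word (j # u)"
    using Cons.prems[of j] by (simp add: word_Cons[of j u] gen_far'[of i j])
  finally show ?case .
qed simp

text \<open>
  In \<open>1 2 \<cdots> m\<close> the letter \<open>i\<close> moves left until it meets \<open>i\<close> \<open>i + 1\<close>, where the braid relation
  turns it into \<open>i + 1\<close>, which moves freely to the front.
\<close>

lemma ascending_gen:
  assumes "1 \<le> i" "i < m"
  shows "word [1..<Suc m] * gen i = gen (Suc i) * word [1..<Suc m]"
proof -
  let ?a = "word [1..<i]" and ?b = "word [Suc (Suc i)..<Suc m]"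
  have "[1..<Suc m] = [1..<i] @ [i..<Suc m]"
    using upt_add_eq_append[of 1 i "Suc m - i"] assms by simp
  also have "[i..<Suc m] = [i] @ [Suc i] @ [Suc (Suc i)..<Suc m]"
    using assms by (simp add: upt_conv_Cons del: upt_Suc)
  finally have "[1..<Suc m] = [1..<i] @ [i] @ [Suc i] @ [Suc (Suc i)..<Suc m]" .
  then have dec: "word [1..<Suc m] = ?a * (gen i * (gen (Suc i) * ?b))"
    by (simp only: word_append)
  have "word [1..<Suc m] * gen i = ?a * (gen i * (gen (Suc i) * (?b * gen i)))"
    unfolding dec by (simp only: mult.assoc)
  also have "?b * gen i = gen i * ?b" by (rule word_commute_far) (auto simp: far_def)
  also have "gen i * (gen (Suc i) * (gen i * ?b)) = gen (Suc i) * (gen i * (gen (Suc i) * ?b))"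
    by (rule gen_adjacent') (simp add: adjacent_def)
  also have "?a * \<dots> = (?a * gen (Suc i)) * (gen i * (gen (Suc i) * ?b))"
    by (simp only: mult.assoc)
  also have "?a * gen (Suc i) = gen (Suc i) * ?a" by (rule word_commute_far) (auto simp: far_def)
  finally show ?thesis unfolding dec by (simp only: mult.assoc)
qed

lemma ascending_word:
  assumes "set u \<subseteq> {1..<m}"
  shows "word [1..<Suc m] * word u = word (map Suc u) * word [1..<Suc m]"
  using assms
proof (induction u)
  case (Cons i u)
  have "word [1..<Suc m] * word (i # u) = (word [1..<Suc m] * gen i) * word u"
    by (simp only: word_Cons[of i u] mult.assoc)
  also have "\<dots> = gen (Suc i) * (word [1..<Suc m] * word u)"
    using Cons.prems by (subst ascending_gen) (auto simp: mult.assoc)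
  finally show ?case using Cons word_Cons[of "Suc i" "map Suc u"] by (simp add: mult.assoc)
qed simp

lemma delta_Suc: "delta (Suc m) = word [1..<Suc (Suc m)] * delta m"
  by (simp only: delta_word.simps word_append)

text \<open>
  Write \<open>\<Delta>\<^sub>m = (1 2 \<cdots> m) \<Delta>\<^sub>m\<^sub>-\<^sub>1\<close>. For \<open>i < m\<close> the claim is the induction hypothesis followed by the
  shift of letters along \<open>1 2 \<cdots> m\<close>. For \<open>i = m\<close>, both sides equal
  \<open>(1 2 \<cdots> m)\<^sup>2 \<Delta>\<^sub>m\<^sub>-\<^sub>2\<close>, since \<open>m\<close> commutes with the letters of \<open>\<Delta>\<^sub>m\<^sub>-\<^sub>2\<close>.
\<close>

lemma delta_gen: "1 \<le> i \<Longrightarrow> i \<le> m \<Longrightarrow> delta m * gen i = gen (Suc m - i) * delta m"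
proof (induction m arbitrary: i rule: less_induct)
  case (less m)
  obtain k where m: "m = Suc k" using less.prems by (cases m) auto
  let ?A = "\<lambda>j. word [1..<Suc j]"
  show ?case
  proof (cases "i \<le> k")
    case True
    have "delta m * gen i = ?A m * (delta k * gen i)" unfolding m delta_Suc by (simp only: mult.assoc)
    also have "\<dots> = ?A m * gen (Suc k - i) * delta k"
      using less.IH[of k i] True less.prems m by (simp add: mult.assoc)
    also have "?A m * gen (Suc k - i) = gen (Suc m - i) * ?A m"
      using ascending_gen[of "Suc k - i" m] True less.prems m by (simp add: Suc_diff_le)
    finally show ?thesis unfolding m delta_Suc by (simp only: mult.assoc)
  next
    case False
    then have i: "i = m" using less.prems m by simp
    show ?thesis
    proof (cases k)
      case 0
      then show ?thesis using m i by simp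
    next
      case (Suc l)
      have l: "m = Suc (Suc l)" using m Suc by simp
      have dl: "delta m = ?A m * (?A (Suc l) * delta l)" unfolding l delta_Suc ..
      have Am: "?A m = ?A (Suc l) * gen m" unfolding l by (simp only: upt_Suc_append[of 1] word_append)
      have "map Suc [1..<Suc (Suc l)] = [2..<Suc m]" unfolding l by (simp add: map_Suc_upt numeral_2_eq_2 del: upt_Suc)
      moreover have "set [1..<Suc (Suc l)] \<subseteq> {1..<m}" using l by (simp del: upt_Suc)
      ultimately have sh: "?A m * ?A (Suc l) = word [2..<Suc m] * ?A m"
        using ascending_word by metis
      have "[1..<Suc m] = [1] @ [2..<Suc m]" using l by (simp add: upt_conv_Cons numeral_2_eq_2 del: upt_Suc)
      then have A1: "?A m = gen 1 * word [2..<Suc m]" by (simp only: word_append)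
      have "delta l * gen m = gen m * delta l"
        by (rule word_commute_far) (use set_delta_word[of l] l in \<open>force simp: far_def\<close>)
      then have "delta m * gen m = ?A m * (?A (Suc l) * gen m) * delta l"
        unfolding dl by (simp only: mult.assoc)
      also have "\<dots> = gen 1 * (word [2..<Suc m] * ?A m) * delta l"
        unfolding Am[symmetric] by (subst A1) (simp only: mult.assoc)
      also have "\<dots> = gen 1 * delta m" unfolding sh[symmetric] dl by (simp only: mult.assoc)
      finally show ?thesis using i by simp
    qed
  qed
qed

text \<open>
  The generator \<open>1\<close> is visibly a prefix; the generator \<open>i - 1\<close> is a prefix of \<open>\<Delta>\<^sub>m\<^sub>-\<^sub>1\<close> by induction,
  and moving it to the front across \<open>1 2 \<cdots> m\<close> turns it into \<open>i\<close>.
\<close>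

lemma gen_divides_delta:
  "1 \<le> i \<Longrightarrow> i \<le> m \<Longrightarrow> \<exists>w. set w \<subseteq> {1..m} \<and> gen i * word w = delta m"
proof (induction m arbitrary: i)
  case (Suc m)
  show ?case
  proof (cases "i = 1")
    case True
    have "[1..<Suc (Suc m)] = [1] @ [2..<Suc (Suc m)]" by (simp add: upt_conv_Cons numeral_2_eq_2)
    then have "gen 1 * word ([2..<Suc (Suc m)] @ delta_word m) = delta (Suc m)"
      by (simp only: delta_Suc word_append mult.assoc)
    then show ?thesis using True set_delta_word[of m] by (intro exI[of _ "[2..<Suc (Suc m)] @ delta_word m"]) force
  next
    case False
    with Suc.prems have "1 \<le> i - 1" "i - 1 \<le> m" by auto
    from Suc.IH[OF this] obtain w where w: "set w \<subseteq> {1..m}" "gen (i - 1) * word w = delta m"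
      by blast
    have "gen i * word ([1..<Suc (Suc m)] @ w) = gen i * word [1..<Suc (Suc m)] * word w"
      by (simp only: word_append mult.assoc)
    also have "gen i * word [1..<Suc (Suc m)] = word [1..<Suc (Suc m)] * gen (i - 1)"
      using ascending_gen[of "i - 1" "Suc m"] False Suc.prems by (auto simp: Suc_diff_le)
    also have "\<dots> * word w = delta (Suc m)" unfolding delta_Suc w(2)[symmetric] by (simp only: mult.assoc)
    finally show ?thesis using w(1) by (intro exI[of _ "[1..<Suc (Suc m)] @ w"]) force
  qed
qed simp

definition positive_word :: "nat list \<Rightarrow> braid_word" where
  "positive_word u = map (\<lambda>i. (i, True)) u"

definition cofactor :: "nat \<Rightarrow> nat \<Rightarrow> nat list" where
  "cofactor n i = (SOME w. set w \<subseteq> {1..<n} \<and> gen i * word w = delta (n - 1))"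

lemma cofactor:
  assumes "i \<in> {1..<n}"
  shows "set (cofactor n i) \<subseteq> {1..<n}" "gen i * word (cofactor n i) = delta (n - 1)"
proof -
  have "{1..n - 1} = {1..<n}" using assms by auto
  then have "\<exists>w. set w \<subseteq> {1..<n} \<and> gen i * word w = delta (n - 1)"
    using gen_divides_delta[of i "n - 1"] assms by auto
  from someI_ex[OF this] show "set (cofactor n i) \<subseteq> {1..<n}" "gen i * word (cofactor n i) = delta (n - 1)"
    by (simp_all add: cofactor_def)
qed

text \<open>
  Conjugation of a positive word by the \<open>k\<close>-th power of \<open>\<Delta>\<close>; only the parity of \<open>k\<close> matters.
\<close>

definition flip :: "nat \<Rightarrow> nat \<Rightarrow> nat list \<Rightarrow> nat list" where
  "flip n k u = (if even k then u else map (\<lambda>i. n - i) u)"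

text \<open>
  A braid word with \<open>d\<close> inverse letters represents \<open>N \<Delta>\<^sup>-\<^sup>d\<close> for a positive word \<open>N\<close>: each inverse
  letter is its cofactor times \<open>\<Delta>\<^sup>-\<^sup>1\<close>, and the powers of \<open>\<Delta>\<close> are moved to the right.
\<close>

fun numerator :: "nat \<Rightarrow> braid_word \<Rightarrow> nat list" where
  "numerator n [] = []"
| "numerator n ((i, b) # w) =
     (if b then i # numerator n w else cofactor n i @ flip n 1 (numerator n w))"

definition denominator :: "braid_word \<Rightarrow> nat" where
  "denominator w = length (filter (\<lambda>l. \<not> snd l) w)"

lemma set_flip: "set u \<subseteq> {1..<n} \<Longrightarrow> set (flip n k u) \<subseteq> {1..<n}"
proof -
  assume u: "set u \<subseteq> {1..<n}"
  then have "n - i \<in> {1..<n}" if "i \<in> set u" for i using subsetD[OF u that] by auto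
  with u show ?thesis by (auto simp: flip_def simp del: atLeastLessThan_iff)
qed

lemma flip_flip: "set u \<subseteq> {1..<n} \<Longrightarrow> flip n j (flip n k u) = flip n (j + k) u"
proof -
  assume "set u \<subseteq> {1..<n}"
  then have "map (\<lambda>i. n - (n - i)) u = u" by (intro map_idI) auto
  then show ?thesis by (auto simp: flip_def o_def)
qed

lemma flip_append [simp]: "flip n k (u @ v) = flip n k u @ flip n k v"
  by (simp add: flip_def)

lemma delta_word_flip:
  assumes "set u \<subseteq> {1..<n}"
  shows "delta (n - 1) * word u = word (flip n 1 u) * delta (n - 1)"
  using assms
proof (induction u)
  case Nil then show ?case by (simp add: flip_def)
next
  case (Cons i u)
  have i: "delta (n - 1) * gen i = gen (n - i) * delta (n - 1)"
    using delta_gen[of i "n - 1"] Cons.prems by auto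
  have "delta (n - 1) * word (i # u) = (delta (n - 1) * gen i) * word u"
    by (simp only: word_Cons[of i u] mult.assoc)
  also have "\<dots> = gen (n - i) * (delta (n - 1) * word u)" unfolding i by (simp only: mult.assoc)
  also have "\<dots> = gen (n - i) * word (flip n 1 u) * delta (n - 1)"
    using Cons by (simp add: mult.assoc)
  finally show ?case using word_Cons[of "n - i" "flip n 1 u"] by (simp add: flip_def)
qed

lemma delta_power_flip:
  assumes "set u \<subseteq> {1..<n}"
  shows "delta (n - 1) ^ k * word u = word (flip n k u) * delta (n - 1) ^ k"
proof (induction k)
  case 0 then show ?case by (simp add: flip_def)
next
  case (Suc k)
  have "delta (n - 1) ^ Suc k * word u = delta (n - 1) * (delta (n - 1) ^ k * word u)"
    by (simp add: mult.assoc)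
  also have "\<dots> = (delta (n - 1) * word (flip n k u)) * delta (n - 1) ^ k"
    unfolding Suc.IH by (simp only: mult.assoc)
  also have "delta (n - 1) * word (flip n k u) = word (flip n (Suc k) u) * delta (n - 1)"
    using delta_word_flip[OF set_flip[OF assms]] flip_flip[OF assms, of 1 k] by simp
  finally show ?case by (simp add: mult.assoc)
qed

lemma flip_delta_power:
  assumes "set u \<subseteq> {1..<n}"
  shows "word (flip n k u) * delta (n - 1) ^ j = delta (n - 1) ^ j * word (flip n (k + j) u)"
  using delta_power_flip[OF set_flip[OF assms], of j "k + j"] flip_flip[OF assms, of j "k + j"]
  by (simp add: flip_def)

lemma set_numerator: "w \<in> braid_words n \<Longrightarrow> set (numerator n w) \<subseteq> {1..<n}"
proof (induction w)
  case (Cons l w)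
  obtain i b where l: "l = (i, b)" by (cases l)
  have "i \<in> {1..<n}" "w \<in> braid_words n" using Cons.prems l by (auto simp: braid_words_def)
  then show ?case using Cons.IH cofactor(1)[of i n] set_flip[of "numerator n w" n 1] l by auto
qed simp

lemma denominator_append: "denominator (u @ v) = denominator u + denominator v"
  by (simp add: denominator_def)

lemma numerator_append:
  assumes "u \<in> braid_words n" "v \<in> braid_words n"
  shows "numerator n (u @ v) = numerator n u @ flip n (denominator u) (numerator n v)"
  using assms(1)
proof (induction u)
  case Nil then show ?case by (simp add: flip_def denominator_def)
next
  case (Cons l u)
  obtain i b where l: "l = (i, b)" by (cases l)
  have "u \<in> braid_words n" using Cons.prems by (simp add: braid_words_def)
  with Cons.IH l flip_flip[OF set_numerator[OF assms(2)], of 1 "denominator u"]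
  show ?case by (simp add: denominator_def)
qed

text \<open>
  Equality of the fractions \<open>N \<Delta>\<^sup>-\<^sup>d\<close> after multiplication by a common denominator. It is respected
  by all rules generating the equivalence of words; transitivity uses that powers of \<open>\<Delta>\<close> can be
  cancelled on the right in the positive monoid, and the rule for inverse letters is the defining
  property of the cofactor.
\<close>

lemma fraction_invariant:
  assumes "braid_equiv n u v"
  shows "word (numerator n u) * delta (n - 1) ^ denominator v =
    word (numerator n v) * delta (n - 1) ^ denominator u"
  using assms
proof (induction rule: braid_equiv.induct)
  case (trans u v w)
  let ?D = "delta (n - 1)"
  have "word (numerator n u) * ?D ^ denominator w * ?D ^ denominator v =
      (word (numerator n u) * ?D ^ denominator v) * ?D ^ denominator w"
    by (simp add: mult.assoc flip: power_add) (simp add: add.commute)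
  also have "\<dots> = (word (numerator n v) * ?D ^ denominator w) * ?D ^ denominator u"
    unfolding trans.IH(1) by (simp add: mult.assoc flip: power_add) (simp add: add.commute)
  also have "\<dots> = word (numerator n w) * ?D ^ denominator u * ?D ^ denominator v"
    unfolding trans.IH(2) by (simp add: mult.assoc flip: power_add) (simp add: add.commute)
  finally show ?case by (rule pbraid_right_cancel)
next
  case (append u u' v v')
  let ?D = "delta (n - 1)" and ?U = "word (numerator n u)" and ?U' = "word (numerator n u')"
  let ?d = denominator
  define V where "V k = word (flip n k (numerator n v))" for k
  define V' where "V' k = word (flip n k (numerator n v'))" for k
  have W: "u \<in> braid_words n" "u' \<in> braid_words n" "v \<in> braid_words n" "v' \<in> braid_words n"
    using append.hyps by (auto dest: braid_equiv_words)
  note sv = set_numerator[OF W(3)] and sv' = set_numerator[OF W(4)]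
  let ?K = "?d u + ?d u'"
  have "V ?K * ?D ^ ?d v' * ?D ^ ?K = V ?K * ?D ^ ?K * ?D ^ ?d v'"
    by (simp add: mult.assoc flip: power_add) (simp add: add.commute)
  also have "\<dots> = ?D ^ ?K * (word (numerator n v) * ?D ^ ?d v')"
    unfolding V_def delta_power_flip[OF sv, symmetric] by (simp only: mult.assoc)
  also have "\<dots> = V' ?K * ?D ^ ?K * ?D ^ ?d v"
    unfolding append.IH(2) V'_def delta_power_flip[OF sv', symmetric] by (simp only: mult.assoc)
  also have "\<dots> = V' ?K * ?D ^ ?d v * ?D ^ ?K"
    by (simp add: mult.assoc flip: power_add) (simp add: add.commute)
  finally have VV': "V ?K * ?D ^ ?d v' = V' ?K * ?D ^ ?d v" by (rule pbraid_right_cancel)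
  have "word (numerator n (u @ v)) * ?D ^ ?d (u' @ v') = ?U * (V (?d u) * ?D ^ ?d u') * ?D ^ ?d v'"
    by (simp add: numerator_append W denominator_append word_append V_def power_add mult.assoc)
  also have "\<dots> = ?U * ?D ^ ?d u' * (V ?K * ?D ^ ?d v')"
    unfolding V_def flip_delta_power[OF sv, of "?d u" "?d u'"] by (simp only: mult.assoc)
  also have "\<dots> = ?U' * (?D ^ ?d u * V' ?K) * ?D ^ ?d v"
    unfolding append.IH(1) VV' by (simp only: mult.assoc)
  also have "?D ^ ?d u * V' ?K = V' (?d u') * ?D ^ ?d u"
    unfolding V'_def flip_delta_power[OF sv', of "?d u'"] by (simp add: add.commute)
  also have "?U' * (V' (?d u') * ?D ^ ?d u) * ?D ^ ?d v =
      word (numerator n (u' @ v')) * ?D ^ ?d (u @ v)"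
    by (simp add: numerator_append W denominator_append word_append V'_def power_add mult.assoc)
  finally show ?case .
next
  case (cancel i b)
  have "gen i * (word (cofactor n i) * gen (n - i)) = delta (n - 1) * gen (n - i)"
    unfolding cofactor(2)[OF cancel, symmetric] by (simp only: mult.assoc)
  also have "\<dots> = gen i * delta (n - 1)" using delta_gen[of "n - i" "n - 1"] cancel by auto
  finally have "word (cofactor n i) * gen (n - i) = delta (n - 1)" by (rule pbraid_left_cancel)
  then show ?case using cofactor(2)[OF cancel]
    by (cases b) (auto simp: denominator_def flip_def word_append word_Cons[of i "cofactor n i"])
next
  case (far i j)
  then show ?case using gen_far[of i j]
    by (simp add: denominator_def far_def word_Cons[of i "[j]"] word_Cons[of j "[i]"])
next
  case (braid i)
  then show ?case using gen_adjacent[of i "Suc i"]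
    by (simp add: denominator_def adjacent_def word_Cons[of _ "[_,_]"] word_Cons[of _ "[i]"] word_Cons[of _ "[Suc i]"] mult.assoc)
qed (simp_all)

lemma positive_word_in: "set u \<subseteq> {1..<n} \<Longrightarrow> positive_word u \<in> braid_words n"
  by (auto simp: positive_word_def braid_words_def)

text \<open>
  The positive monoid embeds in the braid group: for positive words the fraction is the word
  itself, with denominator \<open>1\<close>.
\<close>

theorem braid_equiv_positive:
  assumes "braid_equiv n (positive_word u) (positive_word v)"
  shows "word u = word v"
proof -
  have "numerator n (positive_word u) = u \<and> denominator (positive_word u) = 0" for u
    by (induction u) (auto simp: positive_word_def denominator_def)
  with fraction_invariant[OF assms] show ?thesis by simp
qed

section \<open>Positive braids in the braid group\<close>

text \<open>
  \<open>lcm_quot i j\<close> as a word, so that it can be evaluated in the group.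
\<close>

fun lcm_word :: "nat \<Rightarrow> nat \<Rightarrow> nat list" where
  "lcm_word i j = (if i = j then [] else if adjacent i j then [j, i] else [j])"

lemma word_lcm_word: "word (lcm_word i j) = lcm_quot i j"
  by (simp add: lcm_quot_def word_Cons[of j "[i]"])

lemma lcm_word_lcm: "word (i # lcm_word i j) = word (j # lcm_word j i)"
proof (cases rule: letter_cases[of i j])
  case 2
  then show ?thesis using gen_far[of i j]
    by (auto simp: word_Cons[of _ "[_]"] far_def adjacent_def)
next
  case 3
  then show ?thesis using gen_adjacent[of i j]
    by (auto simp: word_Cons[of _ "[_, _]"] word_Cons[of i "[j]"] word_Cons[of j "[i]"] mult.assoc adjacent_def)
qed simp

fun exponent_sum :: "braid_word \<Rightarrow> int" where
  "exponent_sum [] = 0"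
| "exponent_sum ((i, b) # w) = (if b then 1 else - 1) + exponent_sum w"

lemma exponent_sum_append: "exponent_sum (u @ v) = exponent_sum u + exponent_sum v"
  by (induction u rule: exponent_sum.induct) auto

lemma exponent_sum_invariant: "braid_equiv n u v \<Longrightarrow> exponent_sum u = exponent_sum v"
  by (induction rule: braid_equiv.induct) (auto simp: exponent_sum_append)

locale braid_strands = fixes n :: nat

sublocale braid_strands \<subseteq> group "\<B> n"
  by (rule group_braid_group)

context braid_strands
begin

abbreviation G :: "braid set" where "G \<equiv> carrier (\<B> n)"
abbreviation e :: braid where "e \<equiv> \<one>\<^bsub>\<B> n\<^esub>"
abbreviation mul :: "braid \<Rightarrow> braid \<Rightarrow> braid" (infixl "\<cdot>" 70)
  where "x \<cdot> y \<equiv> x \<otimes>\<^bsub>\<B> n\<^esub> y"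
abbreviation iv :: "braid \<Rightarrow> braid" where "iv x \<equiv> inv\<^bsub>\<B> n\<^esub> x"
abbreviation P :: "braid set" where "P \<equiv> positive_braids n"
abbreviation \<Delta> :: braid where "\<Delta> \<equiv> garside n"
abbreviation \<Delta>pow :: "int \<Rightarrow> braid" where "\<Delta>pow k \<equiv> garside n [^]\<^bsub>\<B> n\<^esub> k"
abbreviation le :: "braid \<Rightarrow> braid \<Rightarrow> bool" (infix "\<preceq>" 50)
  where "a \<preceq> b \<equiv> a \<sqsubseteq>\<^bsub>braid_order n\<^esub> b"
abbreviation mt :: "braid \<Rightarrow> braid \<Rightarrow> braid" (infixl "\<sqinter>\<^sub>B" 75)
  where "a \<sqinter>\<^sub>B b \<equiv> a \<sqinter>\<^bsub>braid_order n\<^esub> b"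

abbreviation cls :: "braid_word \<Rightarrow> braid" where "cls w \<equiv> braid_rel n `` {w}"
definition pos :: "nat list \<Rightarrow> braid" where "pos u = braid_prod n (map (artin n) u)"

lemma inv_cancel_left [simp]: "x \<in> G \<Longrightarrow> y \<in> G \<Longrightarrow> iv x \<cdot> (x \<cdot> y) = y"
  by (simp flip: m_assoc)
lemma cancel_inv_left [simp]: "x \<in> G \<Longrightarrow> y \<in> G \<Longrightarrow> x \<cdot> (iv x \<cdot> y) = y"
  by (simp flip: m_assoc)

lemma in_G_iff: "x \<in> G \<longleftrightarrow> (\<exists>u\<in>braid_words n. x = cls u)"
  by (auto simp: braid_group_def quotient_def)

lemma cls_in_G: "u \<in> braid_words n \<Longrightarrow> cls u \<in> G" using in_G_iff by blast

lemma e_cls: "e = cls []" by (simp add: braid_group_def)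

lemma cls_eqI: "braid_equiv n u v \<Longrightarrow> cls u = cls v"
  by (rule equiv_class_eq[OF equiv_braid_rel]) (simp add: braid_rel_def)

lemma cls_eqD: "cls u = cls v \<Longrightarrow> v \<in> braid_words n \<Longrightarrow> braid_equiv n u v"
proof -
  assume "cls u = cls v" "v \<in> braid_words n"
  then have "(u, v) \<in> braid_rel n" by (rule eq_equiv_class[OF _ equiv_braid_rel])
  then show ?thesis by (simp add: braid_rel_def)
qed

lemma artin_in_G: "i \<in> {1..<n} \<Longrightarrow> artin n i \<in> G"
  unfolding artin_def by (rule cls_in_G) (auto simp: braid_words_def)

lemma braid_prod_closed: "set xs \<subseteq> G \<Longrightarrow> braid_prod n xs \<in> G"
  by (induction xs) (auto simp: braid_prod_def)

lemma braid_prod_simps: "braid_prod n [] = e" "braid_prod n (x # xs) = x \<cdot> braid_prod n xs"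
  by (auto simp: braid_prod_def)

lemma braid_prod_append:
  "set xs \<subseteq> G \<Longrightarrow> set ys \<subseteq> G \<Longrightarrow> braid_prod n (xs @ ys) = braid_prod n xs \<cdot> braid_prod n ys"
  by (induction xs) (auto simp: braid_prod_simps m_assoc braid_prod_closed)

lemma pos_simps: "pos [] = e" "pos (i # u) = artin n i \<cdot> pos u"
  by (auto simp: pos_def braid_prod_simps)

lemma pos_in_G: "set u \<subseteq> {1..<n} \<Longrightarrow> pos u \<in> G"
  unfolding pos_def by (rule braid_prod_closed) (auto simp: artin_in_G)

lemma pos_append: "set u \<subseteq> {1..<n} \<Longrightarrow> set v \<subseteq> {1..<n} \<Longrightarrow> pos (u @ v) = pos u \<cdot> pos v"
  unfolding pos_def map_append by (rule braid_prod_append) (auto simp: artin_in_G)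

lemma pos_cls: "set u \<subseteq> {1..<n} \<Longrightarrow> pos u = cls (positive_word u)"
proof (induction u)
  case Nil then show ?case by (simp add: pos_simps e_cls positive_word_def)
next
  case (Cons i u)
  have "positive_word (i # u) = [(i, True)] @ positive_word u" by (simp add: positive_word_def)
  moreover have "[(i, True)] \<in> braid_words n" using Cons.prems by (auto simp: braid_words_def)
  ultimately show ?case using Cons positive_word_in[of u n]
    by (simp only: pos_simps artin_def) (subst braid_mult_class[symmetric], auto)
qed

lemma P_iff: "x \<in> P \<longleftrightarrow> (\<exists>u. set u \<subseteq> {1..<n} \<and> x = pos u)"
  by (auto simp: positive_braids_def pos_def)

lemma P_obtain: assumes "x \<in> P" obtains u where "set u \<subseteq> {1..<n}" "x = pos u"
  using assms P_iff by blast

lemma P_in_G [simp]: "x \<in> P \<Longrightarrow> x \<in> G" by (auto simp: P_iff pos_in_G)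

lemma pos_in_P: "set u \<subseteq> {1..<n} \<Longrightarrow> pos u \<in> P"
  by (auto simp: P_iff)

lemma P_mult [simp]: "x \<in> P \<Longrightarrow> y \<in> P \<Longrightarrow> x \<cdot> y \<in> P"
  unfolding P_iff by (metis pos_append Un_least set_append)

lemma e_in_P [simp]: "e \<in> P" unfolding P_iff by (rule exI[of _ "[]"]) (simp add: pos_simps)

lemma pos_eqD: "set u \<subseteq> {1..<n} \<Longrightarrow> set v \<subseteq> {1..<n} \<Longrightarrow> pos u = pos v \<Longrightarrow> word u = word v"
  using braid_equiv_positive[OF cls_eqD[OF _ positive_word_in]] pos_cls by metis

lemma braid_step_pos: "braid_step u v \<Longrightarrow> set u \<subseteq> {1..<n} \<Longrightarrow> pos u = pos v"
proof (induction rule: braid_step.induct)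
  case (far i j u v)
  have "cls (positive_word [i, j]) = cls (positive_word [j, i])"
    using far braid_equiv.far[of i n j] braid_equiv.far[of j n i]
    by (auto simp: positive_word_def far_def intro!: cls_eqI dest: braid_equiv.sym)
  then have *: "pos [i, j] = pos [j, i]" using far by (simp add: pos_cls)
  from far.prems have "set u \<subseteq> {1..<n}" "set v \<subseteq> {1..<n}" "set [i,j] \<subseteq> {1..<n}" "set [j,i] \<subseteq> {1..<n}"
    by auto
  with * show ?case by (simp only: pos_append set_append Un_subset_iff)
next
  case (adjacent i j u v)
  have "cls (positive_word [i, j, i]) = cls (positive_word [j, i, j])"
    using adjacent braid_equiv.braid[of i n] braid_equiv.braid[of j n]
    by (auto simp: positive_word_def adjacent_def intro!: cls_eqI dest: braid_equiv.sym)
  then have *: "pos [i, j, i] = pos [j, i, j]" using adjacent by (simp add: pos_cls)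
  from adjacent.prems have "set u \<subseteq> {1..<n}" "set v \<subseteq> {1..<n}" "set [i,j,i] \<subseteq> {1..<n}" "set [j,i,j] \<subseteq> {1..<n}"
    by auto
  with * show ?case by (simp only: pos_append set_append Un_subset_iff)
qed

lemma pos_eqI:
  assumes "word u = word v" "set u \<subseteq> {1..<n}" shows "pos u = pos v"
proof -
  have "pos_equiv u v" using assms(1) by (simp add: word_eq_iff)
  then show ?thesis
  proof (induction rule: rtranclp_induct)
    case (step v w)
    have "set v \<subseteq> {1..<n}" using pos_equiv_set[OF step.hyps(1)] assms(2) by simp
    from braid_step_pos[OF step.hyps(2) this] step.IH show ?case by simp
  qed simp
qed

text \<open>
  The exponent sum of a braid. The choice of a representative does not matter, by
  \<open>exponent_sum_invariant\<close>; on positive braids this is the word length, which is the measure of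
  all inductions below.
\<close>

definition deg :: "braid \<Rightarrow> int" where "deg x = exponent_sum (SOME w. w \<in> x)"

lemma deg_cls: "w \<in> braid_words n \<Longrightarrow> deg (cls w) = exponent_sum w"
proof -
  assume w: "w \<in> braid_words n"
  then have "w \<in> cls w" by (simp add: braid_rel_def braid_equiv.refl)
  then have "(SOME u. u \<in> cls w) \<in> cls w" by (rule someI)
  then have "braid_equiv n w (SOME u. u \<in> cls w)" by (simp add: braid_rel_def)
  then show ?thesis using exponent_sum_invariant by (simp add: deg_def)
qed

lemma deg_mult [simp]: "x \<in> G \<Longrightarrow> y \<in> G \<Longrightarrow> deg (x \<cdot> y) = deg x + deg y"
proof -
  assume "x \<in> G" "y \<in> G"
  then obtain u v where uv: "u \<in> braid_words n" "v \<in> braid_words n" "x = cls u" "y = cls v"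
    by (auto simp: in_G_iff)
  then have "u @ v \<in> braid_words n" by (simp add: braid_words_def)
  with uv show ?thesis by (simp add: braid_mult_class deg_cls exponent_sum_append)
qed

lemma deg_e [simp]: "deg e = 0" using deg_mult[of e e] by simp
lemma deg_inv [simp]: "x \<in> G \<Longrightarrow> deg (iv x) = - deg x"
  using deg_mult[of x "iv x"] by simp

lemma deg_pos: "set u \<subseteq> {1..<n} \<Longrightarrow> deg (pos u) = int (length u)"
proof -
  assume u: "set u \<subseteq> {1..<n}"
  have "exponent_sum (positive_word u) = int (length u)" by (induction u) (auto simp: positive_word_def)
  then show ?thesis using u by (simp add: pos_cls deg_cls positive_word_in)
qed

lemma deg_P: "x \<in> P \<Longrightarrow> 0 \<le> deg x" by (auto simp: P_iff deg_pos)
lemma deg_P_0: "x \<in> P \<Longrightarrow> deg x = 0 \<Longrightarrow> x = e" by (auto simp: P_iff deg_pos pos_simps)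

lemma artin_in_P: "i \<in> {1..<n} \<Longrightarrow> artin n i \<in> P"
  unfolding P_iff by (rule exI[of _ "[i]"]) (auto simp: pos_simps artin_in_G)

lemma deg_artin [simp]: "i \<in> {1..<n} \<Longrightarrow> deg (artin n i) = 1"
  using deg_pos[of "[i]"] by (simp add: pos_simps artin_in_G)

lemma P_first: assumes "x \<in> P" "x \<noteq> e"
  obtains i y where "i \<in> {1..<n}" "y \<in> P" "x = artin n i \<cdot> y"
proof -
  obtain u where u: "set u \<subseteq> {1..<n}" "x = pos u" using assms(1) by (rule P_obtain)
  then obtain i v where "u = i # v" using assms(2) by (cases u) (auto simp: pos_simps)
  with u show ?thesis using that[of i "pos v"] by (auto simp: pos_simps P_iff)
qed

lemma delta_word_range: "set (delta_word (n - 1)) \<subseteq> {1..<n}"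
  using set_delta_word[of "n - 1"] by force

lemma garside_pos: "\<Delta> = pos (delta_word (n - 1))"
  by (simp add: garside_delta_word pos_def)

lemma garside_in_P [simp]: "\<Delta> \<in> P" using garside_pos pos_in_P[OF delta_word_range] by simp

lemma garside_in_G [simp]: "\<Delta> \<in> G" by simp
lemma \<Delta>pow_in_G [simp]: "\<Delta>pow k \<in> G" by simp

lemma garside_mult_pos: "set u \<subseteq> {1..<n} \<Longrightarrow> \<Delta> \<cdot> pos u = pos (flip n 1 u) \<cdot> \<Delta>"
proof -
  assume u: "set u \<subseteq> {1..<n}"
  have "word (delta_word (n - 1) @ u) = word (flip n 1 u @ delta_word (n - 1))"
    using delta_word_flip[OF u] by (simp only: word_append)
  then have "pos (delta_word (n - 1) @ u) = pos (flip n 1 u @ delta_word (n - 1))"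
    by (rule pos_eqI) (use u delta_word_range in auto)
  then show ?thesis using u set_flip[OF u] delta_word_range
    by (simp only: garside_pos pos_append)
qed

lemma garside_artin_inv: "i \<in> {1..<n} \<Longrightarrow> iv (artin n i) \<cdot> \<Delta> \<in> P"
proof -
  assume i: "i \<in> {1..<n}"
  note c = cofactor[OF i]
  have "word (i # cofactor n i) = word (delta_word (n - 1))"
    using c(2) by (simp only: word_Cons[of i "cofactor n i"])
  then have "artin n i \<cdot> pos (cofactor n i) = \<Delta>"
    using pos_eqI[of "i # cofactor n i"] i c(1) by (auto simp: pos_simps garside_pos)
  then have "iv (artin n i) \<cdot> \<Delta> = pos (cofactor n i)"
    using i c(1) by (metis artin_in_G inv_cancel_left pos_in_G)
  then show ?thesis using c(1) pos_in_P by simp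
qed

lemma cls_Cons:
  assumes "(i, b) # w \<in> braid_words n"
  shows "cls ((i, b) # w) = (if b then artin n i else iv (artin n i)) \<cdot> cls w"
proof -
  have W: "[(i, True)] \<in> braid_words n" "[(i, False)] \<in> braid_words n" "w \<in> braid_words n" and i: "i \<in> {1..<n}"
    using assms by (auto simp: braid_words_def)
  have "cls [(i, False)] \<cdot> cls [(i, True)] = e"
    using cls_eqI[OF braid_equiv.cancel[OF i, of False]] W by (simp add: braid_mult_class e_cls)
  then have "iv (artin n i) = cls [(i, False)]"
    using W by (intro inv_equality) (auto simp: artin_def cls_in_G)
  then show ?thesis
    using braid_mult_class[OF W(1,3)] braid_mult_class[OF W(2,3)] by (simp add: artin_def)
qed

lemma G_induct [consumes 1, case_names one artin inv_artin]:
  assumes "x \<in> G" "Q e"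
    "\<And>i y. i \<in> {1..<n} \<Longrightarrow> y \<in> G \<Longrightarrow> Q y \<Longrightarrow> Q (artin n i \<cdot> y)"
    "\<And>i y. i \<in> {1..<n} \<Longrightarrow> y \<in> G \<Longrightarrow> Q y \<Longrightarrow> Q (iv (artin n i) \<cdot> y)"
  shows "Q x"
proof -
  obtain w where w: "w \<in> braid_words n" "x = cls w" using assms(1) by (auto simp: in_G_iff)
  have "Q (cls w)" using w(1)
  proof (induction w)
    case Nil then show ?case using assms(2) e_cls by simp
  next
    case (Cons l w)
    obtain i b where l: "l = (i, b)" by (cases l)
    have "i \<in> {1..<n}" "w \<in> braid_words n" using Cons.prems l by (auto simp: braid_words_def)
    then show ?case using cls_Cons[of i b w] Cons l assms(3,4) cls_in_G by auto
  qed
  then show ?thesis using w by simp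
qed

lemma garside_conj_P: "x \<in> P \<Longrightarrow> \<Delta> \<cdot> x \<cdot> iv \<Delta> \<in> P" "x \<in> P \<Longrightarrow> iv \<Delta> \<cdot> x \<cdot> \<Delta> \<in> P"
proof -
  assume "x \<in> P"
  then obtain u where u: "set u \<subseteq> {1..<n}" "x = pos u" by (rule P_obtain)
  have "\<Delta> \<cdot> x \<cdot> iv \<Delta> = pos (flip n 1 u)"
    using garside_mult_pos[OF u(1)] u pos_in_G[OF set_flip[OF u(1)]] pos_in_G[OF u(1)] by (simp add: m_assoc)
  then show "\<Delta> \<cdot> x \<cdot> iv \<Delta> \<in> P" using set_flip[OF u(1)] pos_in_P by simp
  have "flip n 1 (flip n 1 u) = u" using flip_flip[OF u(1), of 1 1] by (simp add: flip_def)
  then have "\<Delta> \<cdot> pos (flip n 1 u) = x \<cdot> \<Delta>"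
    using garside_mult_pos[OF set_flip[OF u(1)], of 1] u by simp
  then have "iv \<Delta> \<cdot> x \<cdot> \<Delta> = pos (flip n 1 u)"
    using pos_in_G[OF set_flip[OF u(1)], of 1] u pos_in_G[OF u(1)] by (metis garside_in_G inv_cancel_left inv_closed m_assoc)
  then show "iv \<Delta> \<cdot> x \<cdot> \<Delta> \<in> P" using set_flip[OF u(1)] pos_in_P by simp
qed

lemma garside_square_central: "x \<in> G \<Longrightarrow> \<Delta> \<cdot> \<Delta> \<cdot> x = x \<cdot> (\<Delta> \<cdot> \<Delta>)"
proof -
  have A: "\<Delta> \<cdot> \<Delta> \<cdot> artin n i = artin n i \<cdot> (\<Delta> \<cdot> \<Delta>)" if i: "i \<in> {1..<n}" for i
  proof -
    have "\<Delta> \<cdot> pos [i] = pos [n - i] \<cdot> \<Delta>" "\<Delta> \<cdot> pos [n - i] = pos [i] \<cdot> \<Delta>"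
      using garside_mult_pos[of "[i]"] garside_mult_pos[of "[n - i]"] i by (auto simp: flip_def)
    moreover have "pos [n - i] \<in> G" "pos [i] \<in> G" using i by (auto intro: pos_in_G)
    ultimately have "\<Delta> \<cdot> \<Delta> \<cdot> pos [i] = pos [i] \<cdot> (\<Delta> \<cdot> \<Delta>)"
      by (metis garside_in_G m_assoc)
    then show ?thesis using i by (simp add: pos_simps artin_in_G)
  qed
  show "x \<in> G \<Longrightarrow> \<Delta> \<cdot> \<Delta> \<cdot> x = x \<cdot> (\<Delta> \<cdot> \<Delta>)"
  proof (induction rule: G_induct)
    case (artin i y)
    have g: "artin n i \<in> G" using artin artin_in_G by blast
    have "\<Delta> \<cdot> \<Delta> \<cdot> (artin n i \<cdot> y) = \<Delta> \<cdot> \<Delta> \<cdot> artin n i \<cdot> y" using g artin by (simp add: m_assoc)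
    also have "\<dots> = artin n i \<cdot> (\<Delta> \<cdot> \<Delta> \<cdot> y)" using A[OF artin(1)] g artin by (simp add: m_assoc)
    finally show ?case using g artin by (simp add: m_assoc)
  next
    case (inv_artin i y)
    have g: "artin n i \<in> G" using inv_artin artin_in_G by blast
    have "artin n i \<cdot> (\<Delta> \<cdot> \<Delta> \<cdot> (iv (artin n i) \<cdot> y)) = \<Delta> \<cdot> \<Delta> \<cdot> artin n i \<cdot> (iv (artin n i) \<cdot> y)"
      using A[OF inv_artin(1)] g inv_artin by (simp add: m_assoc)
    also have "\<dots> = \<Delta> \<cdot> \<Delta> \<cdot> y" using g inv_artin by (simp add: m_assoc)
    also have "\<dots> = artin n i \<cdot> (iv (artin n i) \<cdot> y \<cdot> (\<Delta> \<cdot> \<Delta>))"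
      using g inv_artin by (simp add: m_assoc)
    finally show ?case using g inv_artin by simp
  qed simp
qed

lemma garside_power_positive:
  assumes "x \<in> G" obtains m :: nat where "(\<Delta> \<cdot> \<Delta>) [^]\<^bsub>\<B> n\<^esub> m \<cdot> x \<in> P"
proof -
  let ?D = "\<Delta> \<cdot> \<Delta>"
  have "\<exists>m::nat. ?D [^]\<^bsub>\<B> n\<^esub> m \<cdot> x \<in> P" using assms
  proof (induction rule: G_induct)
    case one
    then show ?case by (intro exI[of _ 0]) simp
  next
    case (artin i y)
    then obtain m :: nat where m: "?D [^]\<^bsub>\<B> n\<^esub> m \<cdot> y \<in> P" by blast
    have g: "artin n i \<in> G" using artin artin_in_G by blast
    have "?D [^]\<^bsub>\<B> n\<^esub> m \<cdot> artin n i = artin n i \<cdot> ?D [^]\<^bsub>\<B> n\<^esub> m"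
      by (rule group_commutes_pow) (use g garside_square_central in auto)
    then have "?D [^]\<^bsub>\<B> n\<^esub> m \<cdot> (artin n i \<cdot> y) = artin n i \<cdot> (?D [^]\<^bsub>\<B> n\<^esub> m \<cdot> y)"
      using g artin by (metis garside_in_G m_assoc m_closed nat_pow_closed)
    then show ?case using m artin artin_in_P by (metis P_mult)
  next
    case (inv_artin i y)
    then obtain m :: nat where m: "?D [^]\<^bsub>\<B> n\<^esub> m \<cdot> y \<in> P" by blast
    have g: "iv (artin n i) \<in> G" using inv_artin artin_in_G by blast
    have "?D [^]\<^bsub>\<B> n\<^esub> Suc m \<cdot> iv (artin n i) = iv (artin n i) \<cdot> ?D [^]\<^bsub>\<B> n\<^esub> Suc m"
      by (rule group_commutes_pow) (use g garside_square_central in auto)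
    also have "\<dots> = iv (artin n i) \<cdot> (?D \<cdot> ?D [^]\<^bsub>\<B> n\<^esub> m)"
      by (metis garside_in_G m_closed nat_pow_Suc2)
    finally have "?D [^]\<^bsub>\<B> n\<^esub> Suc m \<cdot> (iv (artin n i) \<cdot> y) = (iv (artin n i) \<cdot> \<Delta>) \<cdot> (\<Delta> \<cdot> (?D [^]\<^bsub>\<B> n\<^esub> m \<cdot> y))"
      using g inv_artin(2) by (simp flip: m_assoc)
    then show ?case using m garside_artin_inv[OF inv_artin(1)] by (metis P_mult garside_in_P)
  qed
  then show ?thesis using that by blast
qed

text \<open>
  Garside's lemma, transported to the group along the embedding of the positive monoid.
\<close>

lemma P_lcm:
  assumes "i \<in> {1..<n}" "j \<in> {1..<n}" "a \<in> P" "b \<in> P" "artin n i \<cdot> a = artin n j \<cdot> b"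
  obtains c where "c \<in> P" "a = pos (lcm_word i j) \<cdot> c" "b = pos (lcm_word j i) \<cdot> c"
proof -
  obtain u v where u: "set u \<subseteq> {1..<n}" "a = pos u" and v: "set v \<subseteq> {1..<n}" "b = pos v"
    using assms by (auto simp: P_iff)
  have "word (i # u) = word (j # v)"
    using assms u v by (intro pos_eqD) (auto simp: pos_simps)
  then have "gen i * word u = gen j * word v" by (simp only: word_Cons[of i u] word_Cons[of j v])
  then obtain c where c: "word u = lcm_quot i j * c" "word v = lcm_quot j i * c"
    by (rule gen_eq_gen)
  obtain w where w: "c = word w" by (rule word_surj)
  have uv: "word u = word (lcm_word i j @ w)" "word v = word (lcm_word j i @ w)"
    using c w by (simp_all only: word_append word_lcm_word)
  then have "set u = set (lcm_word i j @ w)" using pos_equiv_set by (simp only: word_eq_iff)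
  then have sw: "set w \<subseteq> {1..<n}" using u by (metis Un_subset_iff set_append)
  have sl: "set (lcm_word i j) \<subseteq> {1..<n}" "set (lcm_word j i) \<subseteq> {1..<n}" using assms(1,2) by auto
  have "a = pos (lcm_word i j) \<cdot> pos w" "b = pos (lcm_word j i) \<cdot> pos w"
    using pos_eqI[OF uv(1) u(1)] pos_eqI[OF uv(2) v(1)] u v sl sw by (simp_all only: pos_append)
  then show ?thesis using that[of "pos w"] sw pos_in_P by blast
qed

end

section \<open>The prefix order and its meets\<close>

context braid_strands
begin

lemma le_iff: "a \<preceq> b \<longleftrightarrow> iv a \<cdot> b \<in> P"
  by (simp add: braid_order_def)

lemma le_obtain:
  assumes "a \<preceq> b" "a \<in> G" "b \<in> G" obtains c where "c \<in> P" "b = a \<cdot> c"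
  using assms that[of "iv a \<cdot> b"] by (simp add: le_iff)

lemma le_mult [simp]: "a \<in> G \<Longrightarrow> c \<in> P \<Longrightarrow> a \<preceq> a \<cdot> c"
  by (simp add: le_iff)

lemma le_refl [simp]: "a \<in> G \<Longrightarrow> a \<preceq> a"
  by (simp add: le_iff)

lemma le_trans: assumes "a \<preceq> b" "b \<preceq> c" "a \<in> G" "b \<in> G" "c \<in> G" shows "a \<preceq> c"
  using P_mult[of "iv a \<cdot> b" "iv b \<cdot> c"] assms by (simp add: le_iff m_assoc)

lemma le_deg: assumes "a \<preceq> b" "a \<in> G" "b \<in> G" shows "deg a \<le> deg b"
  using deg_P[of "iv a \<cdot> b"] assms by (simp add: le_iff)

lemma le_deg_eq: assumes "a \<preceq> b" "deg b \<le> deg a" "a \<in> G" "b \<in> G" shows "a = b"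
proof -
  have "iv a \<cdot> b = e" using assms deg_P[of "iv a \<cdot> b"] by (intro deg_P_0) (auto simp: le_iff)
  then show ?thesis using assms by (metis inv_equality inv_inv inv_closed)
qed

lemma le_antisym: assumes "a \<preceq> b" "b \<preceq> a" "a \<in> G" "b \<in> G" shows "a = b"
  using le_deg_eq le_deg assms by blast

lemma le_left [simp]: "a \<in> G \<Longrightarrow> b \<in> G \<Longrightarrow> c \<in> G \<Longrightarrow> c \<cdot> a \<preceq> c \<cdot> b \<longleftrightarrow> a \<preceq> b"
  by (simp add: le_iff inv_mult_group m_assoc)

lemma one_le: "a \<in> G \<Longrightarrow> e \<preceq> a \<longleftrightarrow> a \<in> P"
  by (simp add: le_iff)

abbreviation T :: "int \<Rightarrow> braid \<Rightarrow> braid" where "T \<equiv> tau_pow n"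

lemma \<Delta>pow_add: "\<Delta>pow (j + k) = \<Delta>pow j \<cdot> \<Delta>pow k" by (simp add: int_pow_mult)
lemma \<Delta>pow_minus: "\<Delta>pow (- k) = iv (\<Delta>pow k)" by (simp add: int_pow_neg)

lemma T_eq: "T k x = iv (\<Delta>pow k) \<cdot> x \<cdot> \<Delta>pow k"
  by (simp add: tau_pow_def conjug_def)

lemma T_in_G [simp]: "x \<in> G \<Longrightarrow> T k x \<in> G" by (simp add: T_eq)
lemma T_e [simp]: "T k e = e" by (simp add: T_eq)
lemma T_mult: "x \<in> G \<Longrightarrow> y \<in> G \<Longrightarrow> T k (x \<cdot> y) = T k x \<cdot> T k y"
  by (simp add: T_eq m_assoc)
lemma T_inv: "x \<in> G \<Longrightarrow> T k (iv x) = iv (T k x)"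
  by (simp add: T_eq m_assoc inv_mult_group)
lemma T_0 [simp]: "x \<in> G \<Longrightarrow> T 0 x = x" by (simp add: T_eq)
lemma T_T [simp]: "x \<in> G \<Longrightarrow> T j (T k x) = T (k + j) x"
  by (simp add: T_eq \<Delta>pow_add inv_mult_group m_assoc)
lemma \<Delta>pow_1 [simp]: "\<Delta>pow 1 = \<Delta>" using int_pow_1[of \<Delta>] by simp
lemma T_\<Delta>pow [simp]: "T k (\<Delta>pow j) = \<Delta>pow j"
  unfolding T_eq \<Delta>pow_minus[symmetric] \<Delta>pow_add[symmetric] by simp
lemma T_\<Delta> [simp]: "T k \<Delta> = \<Delta>"
  using T_\<Delta>pow[of k 1] by simp
lemma mult_\<Delta>pow: "x \<in> G \<Longrightarrow> x \<cdot> \<Delta>pow k = \<Delta>pow k \<cdot> T k x"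
  by (simp add: T_eq m_assoc)
lemma \<Delta>pow_mult: "x \<in> G \<Longrightarrow> \<Delta>pow k \<cdot> x = T (- k) x \<cdot> \<Delta>pow k"
  by (simp add: T_eq m_assoc \<Delta>pow_minus)

lemma T_P [simp]: "x \<in> P \<Longrightarrow> T k x \<in> P"
proof -
  have 1: "T 1 x \<in> P" if "x \<in> P" for x
    using garside_conj_P(2)[OF that] that by (simp add: T_eq)
  have 2: "T (- 1) x \<in> P" if "x \<in> P" for x
    using garside_conj_P(1)[OF that] that by (simp add: T_eq \<Delta>pow_minus)
  assume x: "x \<in> P"
  show ?thesis
  proof (induction k rule: int_induct[where k = 0])
    case base then show ?case using x by simp
  next
    case (step1 i) then show ?case using 1[of "T i x"] x by (simp add: add.commute)
  next
    case (step2 i) then show ?case using 2[of "T i x"] x by simp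
  qed
qed

lemma T_P_iff [simp]: "x \<in> G \<Longrightarrow> T k x \<in> P \<longleftrightarrow> x \<in> P"
  using T_P[of "T k x" "- k"] by auto

text \<open>
  \<open>\<Delta>\<^sup>2\<close> is central.
\<close>

lemma T_2: "x \<in> G \<Longrightarrow> T (2 * k) x = x"
proof -
  have 1: "T 2 x = x" if "x \<in> G" for x
  proof -
    have "\<Delta>pow 2 = \<Delta> \<cdot> \<Delta>" using \<Delta>pow_add[of 1 1] by simp
    then show ?thesis using garside_square_central[OF that] that
      by (simp add: T_eq m_assoc) (metis garside_in_G inv_cancel_left m_assoc m_closed)
  qed
  assume x: "x \<in> G"
  show ?thesis
  proof (induction k rule: int_induct[where k = 0])
    case base then show ?case using x by simp
  next
    case (step1 i)
    have "T (2 * (i + 1)) x = T 2 (T (2 * i) x)" using x by (simp add: algebra_simps)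
    then show ?case using step1 1 x by simp
  next
    case (step2 i)
    have "T 2 (T (2 * (i - 1)) x) = x" using step2 x by (simp add: algebra_simps)
    then show ?case using 1[of "T (2 * (i - 1)) x"] x by simp
  qed
qed

lemma le_T [simp]: "a \<in> G \<Longrightarrow> b \<in> G \<Longrightarrow> T k a \<preceq> T k b \<longleftrightarrow> a \<preceq> b"
  by (simp add: le_iff flip: T_inv T_mult)

lemma le_right [simp]: "a \<in> G \<Longrightarrow> b \<in> G \<Longrightarrow> a \<cdot> \<Delta>pow k \<preceq> b \<cdot> \<Delta>pow k \<longleftrightarrow> a \<preceq> b"
  by (simp add: mult_\<Delta>pow)

text \<open>
  Two positive braids with a common multiple have a least one. By induction on the length of the
  common multiple \<open>a\<close>: let \<open>m\<close> be the least common multiple of the first letters \<open>i\<close> of \<open>c\<close> and \<open>j\<close> of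
  \<open>d\<close>, which is a prefix of \<open>a\<close> by Garside's lemma. After cancelling \<open>i\<close> there is a join of \<open>c\<close> and \<open>m\<close>,
  after cancelling \<open>j\<close> a join of \<open>d\<close> and \<open>m\<close>, and after cancelling \<open>m\<close> these two have a join.
\<close>

lemma P_join:
  assumes "a \<in> P" "c \<in> P" "d \<in> P" "c \<preceq> a" "d \<preceq> a"
  shows "\<exists>j\<in>P. c \<preceq> j \<and> d \<preceq> j \<and> (\<forall>f\<in>P. c \<preceq> f \<longrightarrow> d \<preceq> f \<longrightarrow> j \<preceq> f)"
  using assms
proof (induction "nat (deg a)" arbitrary: a c d rule: less_induct)
  case less
  show ?case
  proof (cases "c = e \<or> d = e")
    case True
    then show ?thesis using less.prems by (intro bexI[of _ "if c = e then d else c"]) (auto simp: one_le)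
  next
    case False
    obtain i c' where i: "i \<in> {1..<n}" "c' \<in> P" "c = artin n i \<cdot> c'"
      using P_first less.prems(2) False by metis
    obtain j d' where j: "j \<in> {1..<n}" "d' \<in> P" "d = artin n j \<cdot> d'"
      using P_first less.prems(3) False by metis
    note g = artin_in_G[OF i(1)] artin_in_G[OF j(1)]
    define u v where "u = pos (lcm_word i j)" and "v = pos (lcm_word j i)"
    have sl: "set (lcm_word i j) \<subseteq> {1..<n}" "set (lcm_word j i) \<subseteq> {1..<n}" using i j by auto
    have uv: "u \<in> P" "v \<in> P" using pos_in_P sl by (auto simp: u_def v_def)
    have m: "artin n i \<cdot> u = artin n j \<cdot> v"
      using pos_eqI[OF lcm_word_lcm[of i j]] sl i j by (simp add: pos_simps u_def v_def)
    have lcm: "\<exists>f'\<in>P. f = artin n i \<cdot> u \<cdot> f'"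
      if f: "f \<in> P" "artin n i \<preceq> f" "artin n j \<preceq> f" for f
    proof -
      obtain x where x: "x \<in> P" "f = artin n i \<cdot> x" using le_obtain[OF f(2)] g f by auto
      obtain y where y: "y \<in> P" "f = artin n j \<cdot> y" using le_obtain[OF f(3)] g f by auto
      obtain z where "z \<in> P" "x = u \<cdot> z"
        using P_lcm[OF i(1) j(1) x(1) y(1)] x y unfolding u_def by metis
      then show ?thesis using x uv g by (auto simp: m_assoc)
    qed
    have first: "artin n i \<preceq> f" if "c \<preceq> f" "f \<in> P" for f
      using that le_trans[of "artin n i" c f] i g by simp
    have first': "artin n j \<preceq> f" if "d \<preceq> f" "f \<in> P" for f
      using that le_trans[of "artin n j" d f] j g by simp
    have la: "artin n i \<preceq> a" "artin n j \<preceq> a" using first first' less.prems by auto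
    obtain a1 where a1: "a1 \<in> P" "a = artin n i \<cdot> a1" using le_obtain[OF la(1)] g less.prems by auto
    obtain a2 where a2: "a2 \<in> P" "a = artin n j \<cdot> a2" using le_obtain[OF la(2)] g less.prems by auto
    obtain a3 where a3: "a3 \<in> P" "a = artin n i \<cdot> u \<cdot> a3" using lcm[OF less.prems(1) la] by blast
    have "deg a = 1 + deg a1" using a1 deg_mult[of "artin n i" a1] g i by simp
    moreover have "deg a = 1 + deg a2" using a2 deg_mult[of "artin n j" a2] g j by simp
    moreover have "deg a = 1 + deg u + deg a3"
      using a3 deg_mult[of "artin n i \<cdot> u" a3] g i uv by simp
    ultimately have da: "nat (deg a1) < nat (deg a)" "nat (deg a2) < nat (deg a)" "nat (deg a3) < nat (deg a)"
      using deg_P[OF a1(1)] deg_P[OF a2(1)] deg_P[OF a3(1)] deg_P[OF uv(1)] by auto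
    have "c' \<preceq> a1" using less.prems(4) a1 i g by simp
    moreover have "a1 = u \<cdot> a3" using a1 a3 g uv by (simp add: m_assoc)
    ultimately obtain e1 where e1: "e1 \<in> P" "c' \<preceq> e1" "u \<preceq> e1" "\<forall>f\<in>P. c' \<preceq> f \<longrightarrow> u \<preceq> f \<longrightarrow> e1 \<preceq> f"
      using less.hyps[OF da(1) a1(1) i(2) uv(1)] uv a3 by auto
    have "d' \<preceq> a2" using less.prems(5) a2 j g by simp
    moreover have "artin n j \<cdot> a2 = artin n j \<cdot> (v \<cdot> a3)"
      using a2(2)[symmetric] a3 g uv unfolding m by (simp add: m_assoc)
    then have "a2 = v \<cdot> a3" using a2(1) a3(1) uv g by simp
    ultimately obtain e2 where e2: "e2 \<in> P" "d' \<preceq> e2" "v \<preceq> e2" "\<forall>f\<in>P. d' \<preceq> f \<longrightarrow> v \<preceq> f \<longrightarrow> e2 \<preceq> f"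
      using less.hyps[OF da(2) a2(1) j(2) uv(2)] uv a3 by auto
    obtain f1 where f1: "f1 \<in> P" "e1 = u \<cdot> f1" using le_obtain[OF e1(3)] uv e1 by auto
    obtain f2 where f2: "f2 \<in> P" "e2 = v \<cdot> f2" using le_obtain[OF e2(3)] uv e2 by auto
    let ?m = "artin n i \<cdot> u"
    have mG: "?m \<in> G" "?m \<in> P" using g uv i artin_in_P by auto
    \<comment> \<open>\<open>f1\<close> and \<open>f2\<close> are what the two joins with \<open>m\<close> leave after cancelling \<open>m\<close>\<close>
    have upper: "f1 \<preceq> f' \<and> f2 \<preceq> f'" if f: "f' \<in> P" "c \<preceq> ?m \<cdot> f'" "d \<preceq> ?m \<cdot> f'" for f'
    proof -
      have "c' \<preceq> u \<cdot> f'" using f i g uv by (simp add: m_assoc)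
      then have "e1 \<preceq> u \<cdot> f'" using e1(4) f uv by simp
      moreover have "d' \<preceq> v \<cdot> f'" using f j g uv unfolding m by (simp add: m_assoc)
      then have "e2 \<preceq> v \<cdot> f'" using e2(4) f uv by simp
      ultimately show ?thesis using f uv f1 f2 by simp
    qed
    have "f1 \<preceq> a3" "f2 \<preceq> a3" using upper[OF a3(1)] less.prems a3 by auto
    then obtain f3 where f3: "f3 \<in> P" "f1 \<preceq> f3" "f2 \<preceq> f3" "\<forall>f\<in>P. f1 \<preceq> f \<longrightarrow> f2 \<preceq> f \<longrightarrow> f3 \<preceq> f"
      using less.hyps[OF da(3) a3(1) f1(1) f2(1)] by auto
    show ?thesis
    proof (intro bexI conjI ballI impI)
      show "?m \<cdot> f3 \<in> P" using mG f3 by simp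
      have "c' \<preceq> u \<cdot> f3" using le_trans[OF e1(2), of "u \<cdot> f3"] f1 f3 uv i by simp
      then show "c \<preceq> ?m \<cdot> f3" using i g uv f3 by (simp add: m_assoc)
      have "d' \<preceq> v \<cdot> f3" using le_trans[OF e2(2), of "v \<cdot> f3"] f2 f3 uv j by simp
      then show "d \<preceq> ?m \<cdot> f3" unfolding m using j g uv f3 by (simp add: m_assoc)
      fix f assume f: "f \<in> P" "c \<preceq> f" "d \<preceq> f"
      obtain f' where f': "f' \<in> P" "f = ?m \<cdot> f'"
        using lcm[OF f(1) first first'] f by auto
      then have "f3 \<preceq> f'" using upper f3(4) f by auto
      then show "?m \<cdot> f3 \<preceq> f" using f' mG f3 by simp
    qed
  qed
qed

text \<open>
  A common prefix of greatest length is the greatest one: its join with another common prefix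
  is again a common prefix.
\<close>

lemma P_glb:
  assumes "a \<in> P" "b \<in> P"
  obtains d where "d \<in> P" "d \<preceq> a" "d \<preceq> b" "\<And>c. c \<in> P \<Longrightarrow> c \<preceq> a \<Longrightarrow> c \<preceq> b \<Longrightarrow> c \<preceq> d"
proof -
  let ?Q = "\<lambda>d. d \<in> P \<and> d \<preceq> a \<and> d \<preceq> b"
  have 1: "?Q e" using assms by (simp add: one_le)
  have 2: "\<forall>d. ?Q d \<longrightarrow> nat (deg d) < Suc (nat (deg a))"
  proof (intro allI impI)
    fix d assume "?Q d"
    then show "nat (deg d) < Suc (nat (deg a))" using le_deg[of d a] assms by auto
  qed
  from ex_has_greatest_nat[of ?Q e "\<lambda>d. nat (deg d)", OF 1 2]
  obtain d where d: "?Q d" "\<And>c. ?Q c \<Longrightarrow> nat (deg c) \<le> nat (deg d)" by metis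
  have "c \<preceq> d" if c: "c \<in> P" "c \<preceq> a" "c \<preceq> b" for c
  proof -
    obtain j where j: "j \<in> P" "c \<preceq> j" "d \<preceq> j" "\<forall>f\<in>P. c \<preceq> f \<longrightarrow> d \<preceq> f \<longrightarrow> j \<preceq> f"
      using P_join[OF assms(1) c(1) _ c(2)] d(1) by blast
    then have "?Q j" using assms c d by auto
    then have "deg j \<le> deg d" using d(2) deg_P[OF j(1)] deg_P[of d] d(1) by fastforce
    then have "d = j" using le_deg_eq j d by auto
    then show ?thesis using j by simp
  qed
  then show ?thesis using that d(1) by blast
qed

text \<open>
  A power of \<open>\<Delta>\<^sup>2\<close> makes \<open>a\<close> and \<open>b\<close> positive, and their meet is taken there. A common lower bound
  \<open>c\<close> need not become positive by the same power, so it is compared with the meet after a higher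
  power has been applied.
\<close>

lemma glb:
  assumes "a \<in> G" "b \<in> G"
  obtains d where "d \<in> G" "d \<preceq> a" "d \<preceq> b" "\<And>c. c \<in> G \<Longrightarrow> c \<preceq> a \<Longrightarrow> c \<preceq> b \<Longrightarrow> c \<preceq> d"
proof -
  define D where "D m = (\<Delta> \<cdot> \<Delta>) [^]\<^bsub>\<B> n\<^esub> (m :: nat)" for m
  have DP: "D m \<in> P" for m unfolding D_def by (induction m) auto
  have up: "D (m + k) \<cdot> x \<in> P" if "D m \<cdot> x \<in> P" "x \<in> G" for m k x
  proof -
    have "D (m + k) = D k \<cdot> D m" by (simp add: D_def nat_pow_mult add.commute)
    then show ?thesis using that P_mult[OF DP[of k] that(1)] DP by (simp add: m_assoc)
  qed
  obtain m1 where m1: "D m1 \<cdot> a \<in> P" using garside_power_positive[OF assms(1)] D_def by metis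
  obtain m2 where m2: "D m2 \<cdot> b \<in> P" using garside_power_positive[OF assms(2)] D_def by metis
  let ?M = "D (m1 + m2)"
  have ab: "?M \<cdot> a \<in> P" "?M \<cdot> b \<in> P" using up[OF m1 assms(1), of m2] up[OF m2 assms(2), of m1] by (auto simp: add.commute)
  obtain d where d: "d \<in> P" "d \<preceq> ?M \<cdot> a" "d \<preceq> ?M \<cdot> b"
    "\<And>c. c \<in> P \<Longrightarrow> c \<preceq> ?M \<cdot> a \<Longrightarrow> c \<preceq> ?M \<cdot> b \<Longrightarrow> c \<preceq> d" using P_glb[OF ab] by blast
  have MG: "?M \<in> G" using DP by simp
  show ?thesis
  proof (rule that[of "iv ?M \<cdot> d"])
    show "iv ?M \<cdot> d \<in> G" using MG d by simp
    show "iv ?M \<cdot> d \<preceq> a" "iv ?M \<cdot> d \<preceq> b"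
      using d(1-3) MG assms le_left[of "iv ?M \<cdot> d" _ ?M] by auto
    fix c assume c: "c \<in> G" "c \<preceq> a" "c \<preceq> b"
    obtain k where k: "D k \<cdot> c \<in> P" using garside_power_positive[OF c(1)] D_def by metis
    let ?N = "D (m1 + m2 + k)"
    have N: "?N = D k \<cdot> ?M" "D k \<cdot> ?M = ?M \<cdot> D k" by (simp_all add: D_def nat_pow_mult add.commute)
    have cN: "?N \<cdot> c \<in> P" using up[OF k c(1), of "m1 + m2"] by (simp add: add.commute)
    have kG: "D k \<in> G" using DP by simp
    have abN: "?N \<cdot> a \<in> P" "?N \<cdot> b \<in> P" using up[OF ab(1) assms(1), of k] up[OF ab(2) assms(2), of k] by auto
    obtain f where f: "f \<in> P" "f \<preceq> ?N \<cdot> a" "f \<preceq> ?N \<cdot> b"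
      "\<And>c. c \<in> P \<Longrightarrow> c \<preceq> ?N \<cdot> a \<Longrightarrow> c \<preceq> ?N \<cdot> b \<Longrightarrow> c \<preceq> f" using P_glb[OF abN] by blast
    have "D k \<preceq> ?N \<cdot> a" "D k \<preceq> ?N \<cdot> b"
      unfolding N(1) using ab kG MG assms by (simp_all add: m_assoc)
    then have "D k \<preceq> f" using f(4) DP by blast
    then obtain f' where f': "f' \<in> P" "f = D k \<cdot> f'" using le_obtain kG f by (metis P_in_G)
    have "f' \<preceq> ?M \<cdot> a" "f' \<preceq> ?M \<cdot> b"
      using f(2,3) f' kG MG assms unfolding N(1) by (simp_all add: m_assoc)
    then have "f' \<preceq> d" using d(4) f' by blast
    then have 1: "f \<preceq> D k \<cdot> d" using f' kG d by simp
    have "?N \<cdot> c \<preceq> f" using f(4)[OF cN] c assms kG MG DP by simp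
    then have "?N \<cdot> c \<preceq> D k \<cdot> d" using le_trans[OF _ 1] cN f kG d by simp
    then have "?M \<cdot> c \<preceq> d" unfolding N(1) using kG MG c d by (simp add: m_assoc)
    then show "c \<preceq> iv ?M \<cdot> d" using le_left[of c "iv ?M \<cdot> d" ?M] MG c d by simp
  qed
qed

end

sublocale braid_strands \<subseteq> prefix: lower_semilattice "braid_order n"
proof (unfold_locales, goal_cases)
  case (5 x y)
  then show ?case using le_antisym[of x y] by (simp add: braid_order_def)
next
  case (6 x y z)
  then show ?case using le_trans[of x y z] by (simp add: braid_order_def)
next
  case (9 x y)
  have C: "carrier (braid_order n) = carrier (\<B> n)" by (simp add: braid_order_def)
  obtain d where d: "d \<in> G" "d \<preceq> x" "d \<preceq> y" "\<And>c. c \<in> G \<Longrightarrow> c \<preceq> x \<Longrightarrow> c \<preceq> y \<Longrightarrow> c \<preceq> d"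
    using glb[of x y] 9 unfolding C by blast
  then show ?case unfolding greatest_def Lower_def C by (intro exI[of _ d]) (use 9 C in auto)
qed (auto simp: braid_order_def)

context braid_strands
begin

lemma carrier_order [simp]: "carrier (braid_order n) = carrier (\<B> n)"
  by (simp add: braid_order_def)

lemma meet_in_G [simp]: "a \<in> G \<Longrightarrow> b \<in> G \<Longrightarrow> a \<sqinter>\<^sub>B b \<in> G"
  using prefix.meet_closed[of a b] by simp

lemma le_meet_iff: "c \<in> G \<Longrightarrow> a \<in> G \<Longrightarrow> b \<in> G \<Longrightarrow> c \<preceq> a \<sqinter>\<^sub>B b \<longleftrightarrow> c \<preceq> a \<and> c \<preceq> b"
  using prefix.meet_left[of a b] prefix.meet_right[of a b] prefix.meet_le[of c a b]
    le_trans[of c "a \<sqinter>\<^sub>B b" a] le_trans[of c "a \<sqinter>\<^sub>B b" b] by auto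

lemma meet_le [simp]: "a \<in> G \<Longrightarrow> b \<in> G \<Longrightarrow> a \<sqinter>\<^sub>B b \<preceq> a" "a \<in> G \<Longrightarrow> b \<in> G \<Longrightarrow> a \<sqinter>\<^sub>B b \<preceq> b"
  using prefix.meet_left[of a b] prefix.meet_right[of a b] by auto

lemma le_eqI:
  assumes "x \<in> G" "y \<in> G" "\<And>c. c \<in> G \<Longrightarrow> c \<preceq> x \<longleftrightarrow> c \<preceq> y" shows "x = y"
  using assms(3)[of x] assms(3)[of y] assms(1,2) by (intro le_antisym) simp_all

lemma meet_comm: "a \<in> G \<Longrightarrow> b \<in> G \<Longrightarrow> a \<sqinter>\<^sub>B b = b \<sqinter>\<^sub>B a"
  by (rule le_eqI) (auto simp: le_meet_iff)

lemma meet_absorb: "a \<in> G \<Longrightarrow> b \<in> G \<Longrightarrow> a \<preceq> b \<Longrightarrow> a \<sqinter>\<^sub>B b = a"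
  by (rule le_antisym) (auto simp: le_meet_iff)

lemma le_left_shift: "c \<in> G \<Longrightarrow> x \<in> G \<Longrightarrow> d \<in> G \<Longrightarrow> d \<preceq> c \<cdot> x \<longleftrightarrow> iv c \<cdot> d \<preceq> x"
  using le_left[of "iv c \<cdot> d" x c] by simp

lemma le_right_shift: "x \<in> G \<Longrightarrow> d \<in> G \<Longrightarrow> d \<preceq> x \<cdot> \<Delta>pow k \<longleftrightarrow> d \<cdot> \<Delta>pow (- k) \<preceq> x"
  using le_right[of "d \<cdot> \<Delta>pow (- k)" x k] by (simp add: m_assoc \<Delta>pow_minus)

lemma le_T_shift: "x \<in> G \<Longrightarrow> d \<in> G \<Longrightarrow> d \<preceq> T k x \<longleftrightarrow> T (- k) d \<preceq> x"
  using le_T[of "T (- k) d" x k] by simp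

lemma meet_left: "a \<in> G \<Longrightarrow> b \<in> G \<Longrightarrow> c \<in> G \<Longrightarrow> c \<cdot> (a \<sqinter>\<^sub>B b) = (c \<cdot> a) \<sqinter>\<^sub>B (c \<cdot> b)"
  by (rule le_eqI) (auto simp: le_meet_iff le_left_shift)

lemma meet_right: "a \<in> G \<Longrightarrow> b \<in> G \<Longrightarrow> (a \<sqinter>\<^sub>B b) \<cdot> \<Delta>pow k = (a \<cdot> \<Delta>pow k) \<sqinter>\<^sub>B (b \<cdot> \<Delta>pow k)"
  by (rule le_eqI) (auto simp: le_meet_iff le_right_shift)

lemma meet_T: "a \<in> G \<Longrightarrow> b \<in> G \<Longrightarrow> T k (a \<sqinter>\<^sub>B b) = T k a \<sqinter>\<^sub>B T k b"
  by (rule le_eqI) (auto simp: le_meet_iff le_T_shift)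

lemma meet_P: "a \<in> P \<Longrightarrow> b \<in> P \<Longrightarrow> a \<sqinter>\<^sub>B b \<in> P"
  using le_meet_iff[of e a b] by (simp add: one_le)

section \<open>Simple braids and left normal forms\<close>

abbreviation S :: "braid set" where "S \<equiv> simple_braids n"
abbreviation comp :: "braid \<Rightarrow> braid" ("\<partial>") where "\<partial> \<equiv> complement n"
abbreviation lw :: "braid \<Rightarrow> braid \<Rightarrow> bool" where "lw \<equiv> left_weighted n"
abbreviation pr :: "braid list \<Rightarrow> braid" where "pr \<equiv> braid_prod n"

lemma S_iff: "s \<in> S \<longleftrightarrow> s \<in> P \<and> s \<preceq> \<Delta>"
  by (auto simp: simple_braids_def one_le)

lemma S_in_P [simp]: "s \<in> S \<Longrightarrow> s \<in> P" and S_in_G [simp]: "s \<in> S \<Longrightarrow> s \<in> G"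
  and S_le [simp]: "s \<in> S \<Longrightarrow> s \<preceq> \<Delta>"
  by (auto simp: S_iff)

lemma T_S_iff [simp]: "s \<in> G \<Longrightarrow> T k s \<in> S \<longleftrightarrow> s \<in> S"
  using le_T[of s \<Delta> k] by (auto simp: S_iff simp del: S_in_P S_in_G S_le)

lemma meet_S: "a \<in> P \<Longrightarrow> s \<in> S \<Longrightarrow> a \<sqinter>\<^sub>B s \<in> S"
  using le_trans[of "a \<sqinter>\<^sub>B s" s \<Delta>] by (auto simp: S_iff meet_P simp del: S_in_P S_in_G S_le)

lemma comp_in_G [simp]: "s \<in> G \<Longrightarrow> \<partial> s \<in> G" by (simp add: complement_def)
lemma mult_comp [simp]: "s \<in> G \<Longrightarrow> s \<cdot> \<partial> s = \<Delta>" by (simp add: complement_def)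
lemma comp_T: "s \<in> G \<Longrightarrow> \<partial> (T k s) = T k (\<partial> s)" by (simp add: complement_def T_mult T_inv)
lemma comp_comp: "s \<in> G \<Longrightarrow> \<partial> (\<partial> s) = T 1 s"
  by (simp add: complement_def T_eq inv_mult_group m_assoc)
lemma comp_in_S [simp]: "s \<in> S \<Longrightarrow> \<partial> s \<in> S"
proof -
  assume s: "s \<in> S"
  have P: "\<partial> s \<in> P" using S_le[OF s] by (simp add: le_iff complement_def)
  moreover have "\<partial> (\<partial> s) \<in> P" using s by (simp add: comp_comp)
  then have "\<partial> s \<preceq> \<Delta>" by (simp add: le_iff complement_def)
  ultimately show ?thesis by (simp add: S_iff del: S_in_P S_in_G S_le)
qed
lemma comp_eq_e: "s \<in> G \<Longrightarrow> \<partial> s = e \<longleftrightarrow> s = \<Delta>"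
  by (metis comp_in_G complement_def garside_in_G inv_closed inv_equality inv_inv l_inv m_closed mult_comp r_one)
lemma comp_eq_\<Delta>: "s \<in> G \<Longrightarrow> \<partial> s = \<Delta> \<longleftrightarrow> s = e"
  using mult_comp[of s] r_cancel_one'[of \<Delta> s] by (auto simp: complement_def)

lemma T_eq_e: "s \<in> G \<Longrightarrow> T k s = e \<longleftrightarrow> s = e" by (metis T_0 T_T T_e add.right_inverse)
lemma T_eq_\<Delta>: "s \<in> G \<Longrightarrow> T k s = \<Delta> \<longleftrightarrow> s = \<Delta>" by (metis T_0 T_T T_\<Delta> add.right_inverse garside_in_G)

lemma lw_T [simp]: "s \<in> G \<Longrightarrow> t \<in> G \<Longrightarrow> lw (T k s) (T k t) \<longleftrightarrow> lw s t"
  by (simp add: left_weighted_def comp_T T_eq_e flip: meet_T)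

lemma lw_comp: "s \<in> G \<Longrightarrow> t \<in> G \<Longrightarrow> lw s t \<Longrightarrow> lw (\<partial> t) (T 1 (\<partial> s))"
  by (simp add: left_weighted_def comp_comp meet_comm[of t] flip: meet_T)

lemma pr_in_G [simp]: "set xs \<subseteq> G \<Longrightarrow> pr xs \<in> G" by (rule braid_prod_closed)
lemma S_subset_G [simp]: "S \<subseteq> G" by auto
lemma pr_S_in_P: "set xs \<subseteq> S \<Longrightarrow> pr xs \<in> P"
  by (induction xs) (auto simp: braid_prod_simps)
lemma T_pr: "set xs \<subseteq> G \<Longrightarrow> T k (pr xs) = pr (map (T k) xs)"
  by (induction xs) (auto simp: braid_prod_simps T_mult)

text \<open>
  Since \<open>\<Delta> = s \<partial>s\<close>, the meet of \<open>sb\<close> with \<open>\<Delta>\<close> is \<open>s\<close> times the meet of \<open>b\<close> with \<open>\<partial>s\<close>, and the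
  latter does not change if \<open>b\<close> is replaced by its meet with \<open>\<Delta>\<close>.
\<close>

lemma left_weighted_head:
  assumes "s \<in> S" "b \<in> P" "lw s (b \<sqinter>\<^sub>B \<Delta>)" shows "(s \<cdot> b) \<sqinter>\<^sub>B \<Delta> = s"
proof -
  have "b \<sqinter>\<^sub>B \<partial> s \<preceq> \<partial> s \<sqinter>\<^sub>B (b \<sqinter>\<^sub>B \<Delta>)"
    using assms le_trans[of "b \<sqinter>\<^sub>B \<partial> s" "\<partial> s" \<Delta>] by (simp add: le_meet_iff)
  then have "b \<sqinter>\<^sub>B \<partial> s \<preceq> e" using assms(3) by (simp add: left_weighted_def)
  moreover have "e \<preceq> b \<sqinter>\<^sub>B \<partial> s" using assms by (simp add: one_le meet_P)
  ultimately have "b \<sqinter>\<^sub>B \<partial> s = e" using le_antisym assms by simp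
  then show ?thesis using meet_left[of b "\<partial> s" s] assms by simp
qed

text \<open>
  A left-weighted product of simple braids displays its greatest simple prefix as its first
  factor. The factors \<open>1\<close> and \<open>\<Delta>\<close> are allowed here; this is used for products with one more,
  arbitrary simple factor.
\<close>

lemma weighted_head:
  assumes "xs \<noteq> []" "set xs \<subseteq> S" "successively lw xs" shows "pr xs \<sqinter>\<^sub>B \<Delta> = hd xs"
  using assms
proof (induction xs)
  case (Cons s xs)
  show ?case
  proof (cases "xs = []")
    case True
    then show ?thesis using Cons.prems meet_absorb[of s \<Delta>] by (simp add: braid_prod_simps)
  next
    case False
    then have "pr xs \<sqinter>\<^sub>B \<Delta> = hd xs" "lw s (hd xs)" using Cons by (auto simp: successively_Cons)
    then show ?thesis using left_weighted_head[of s "pr xs"] Cons.prems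
      by (simp add: braid_prod_simps pr_S_in_P)
  qed
qed simp

definition normal_factors :: "braid list \<Rightarrow> bool" where
  "normal_factors xs \<longleftrightarrow> set xs \<subseteq> S - {e, \<Delta>} \<and> successively lw xs"

lemma normal_factors_S: "normal_factors xs \<Longrightarrow> set xs \<subseteq> S" by (auto simp: normal_factors_def)
lemma normal_factors_G: "normal_factors xs \<Longrightarrow> set xs \<subseteq> G" using normal_factors_S S_subset_G by blast

lemma normal_factors_head:
  assumes "normal_factors xs" "xs \<noteq> []" shows "pr xs \<sqinter>\<^sub>B \<Delta> = hd xs" "hd xs \<in> S" "hd xs \<noteq> e" "hd xs \<noteq> \<Delta>"
proof -
  show "pr xs \<sqinter>\<^sub>B \<Delta> = hd xs"
    using weighted_head[OF assms(2) normal_factors_S] assms(1) by (simp add: normal_factors_def)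
  have "hd xs \<in> S - {e, \<Delta>}" using assms(1) hd_in_set[OF assms(2)] unfolding normal_factors_def by blast
  then show "hd xs \<in> S" "hd xs \<noteq> e" "hd xs \<noteq> \<Delta>" by auto
qed

lemma normal_form_iff:
  "is_left_normal_form n x p xs \<longleftrightarrow> x = \<Delta>pow p \<cdot> pr xs \<and> normal_factors xs"
  by (auto simp: is_left_normal_form_def normal_factors_def successively_conv_nth)

lemma \<Delta>pow_in_P: "0 \<le> k \<Longrightarrow> \<Delta>pow k \<in> P"
proof (induction k rule: int_ge_induct)
  case (step i)
  then show ?case by (simp add: \<Delta>pow_add)
qed simp

lemma \<Delta>pow_le: "j \<le> k \<Longrightarrow> \<Delta>pow j \<preceq> \<Delta>pow k"
  using \<Delta>pow_in_P[of "k - j"] by (simp add: le_iff \<Delta>pow_minus[symmetric] \<Delta>pow_add[symmetric])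

lemma le_\<Delta>pow_mult:
  "x \<in> G \<Longrightarrow> y \<in> G \<Longrightarrow> \<Delta>pow i \<preceq> x \<Longrightarrow> \<Delta>pow j \<preceq> y \<Longrightarrow> \<Delta>pow (i + j) \<preceq> x \<cdot> y"
  "x \<in> G \<Longrightarrow> y \<in> G \<Longrightarrow> x \<preceq> \<Delta>pow i \<Longrightarrow> y \<preceq> \<Delta>pow j \<Longrightarrow> x \<cdot> y \<preceq> \<Delta>pow (i + j)"
proof -
  assume A: "x \<in> G" "y \<in> G"
  have 1: "x \<cdot> \<Delta>pow j \<preceq> x \<cdot> y \<longleftrightarrow> \<Delta>pow j \<preceq> y" "x \<cdot> y \<preceq> x \<cdot> \<Delta>pow j \<longleftrightarrow> y \<preceq> \<Delta>pow j"
    using A by auto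
  show "\<Delta>pow (i + j) \<preceq> x \<cdot> y" if "\<Delta>pow i \<preceq> x" "\<Delta>pow j \<preceq> y"
    using that A 1 le_right[of "\<Delta>pow i" x j] le_trans[of "\<Delta>pow (i + j)" "x \<cdot> \<Delta>pow j" "x \<cdot> y"]
    by (simp add: \<Delta>pow_add)
  show "x \<cdot> y \<preceq> \<Delta>pow (i + j)" if "x \<preceq> \<Delta>pow i" "y \<preceq> \<Delta>pow j"
    using that A 1 le_right[of x "\<Delta>pow i" j] le_trans[of "x \<cdot> y" "x \<cdot> \<Delta>pow j" "\<Delta>pow (i + j)"]
    by (simp add: \<Delta>pow_add)
qed

text \<open>
  The first letter of \<open>a\<close> is a simple prefix.
\<close>

lemma P_simple_factor:
  assumes "a \<in> P" "a \<noteq> e" shows "a \<sqinter>\<^sub>B \<Delta> \<noteq> e"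
proof
  assume eq: "a \<sqinter>\<^sub>B \<Delta> = e"
  obtain i y where i: "i \<in> {1..<n}" "y \<in> P" "a = artin n i \<cdot> y" using P_first assms by blast
  have g: "artin n i \<in> G" using i artin_in_G by simp
  have "artin n i \<preceq> a" using i g by simp
  moreover have "artin n i \<preceq> \<Delta>" using garside_artin_inv[OF i(1)] by (simp add: le_iff)
  ultimately have "artin n i \<preceq> e" using eq le_meet_iff[of "artin n i" a \<Delta>] g assms by simp
  then show False using le_deg[of "artin n i" e] i g by simp
qed

text \<open>
  Split off the greatest simple prefix repeatedly. The remaining factor is still not divisible by
  \<open>\<Delta>\<close>, because \<open>s\<Delta> = \<Delta>\<tau>(s)\<close>.
\<close>

lemma P_normal_form:
  assumes "a \<in> P" "\<not> \<Delta> \<preceq> a" shows "\<exists>xs. normal_factors xs \<and> a = pr xs"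
  using assms
proof (induction "nat (deg a)" arbitrary: a rule: less_induct)
  case less
  show ?case
  proof (cases "a = e")
    case True
    then show ?thesis by (intro exI[of _ "[]"]) (simp add: normal_factors_def braid_prod_simps)
  next
    case False
    define s where "s = a \<sqinter>\<^sub>B \<Delta>"
    have s: "s \<in> P" "s \<preceq> a" "s \<preceq> \<Delta>" using less.prems by (auto simp: s_def meet_P)
    then have sS: "s \<in> S" by (simp add: S_iff del: S_in_P S_in_G S_le)
    have "s \<noteq> e" using P_simple_factor[OF less.prems(1) False] by (simp add: s_def)
    moreover have "s \<noteq> \<Delta>" using s less.prems by auto
    ultimately have proper: "s \<in> S - {e, \<Delta>}" using sS by simp
    obtain b where b: "b \<in> P" "a = s \<cdot> b" using le_obtain[OF s(2)] s less.prems by auto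
    have "0 < deg s" using deg_P[OF s(1)] deg_P_0[OF s(1)] \<open>s \<noteq> e\<close> by force
    then have "nat (deg b) < nat (deg a)" using b s deg_P[OF b(1)] by simp
    moreover have "\<not> \<Delta> \<preceq> b"
    proof
      assume "\<Delta> \<preceq> b"
      then have "s \<cdot> \<Delta> \<preceq> a" using b s by simp
      moreover have "s \<cdot> \<Delta> = \<Delta> \<cdot> T 1 s" using mult_\<Delta>pow[of s 1] s by simp
      then have "\<Delta> \<preceq> s \<cdot> \<Delta>" using s by simp
      ultimately show False using le_trans[of \<Delta> "s \<cdot> \<Delta>" a] s less.prems by simp
    qed
    ultimately obtain xs where xs: "normal_factors xs" "b = pr xs" using less.hyps b by blast
    have "s \<cdot> (b \<sqinter>\<^sub>B \<partial> s) = s" using meet_left[of b "\<partial> s" s] b(1) s(1)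
      by (simp add: s_def[symmetric] b(2)[symmetric])
    then have bs: "b \<sqinter>\<^sub>B \<partial> s = e" using b s by (metis P_in_G comp_in_G meet_in_G l_cancel_one)
    have "xs = [] \<or> lw s (hd xs)"
    proof (cases "xs = []")
      case False
      define t where "t = hd xs"
      have t: "t = b \<sqinter>\<^sub>B \<Delta>" "t \<in> S" using normal_factors_head[OF xs(1) False] xs(2) by (simp_all add: t_def)
      have "t \<preceq> b" using t(1) b(1) by simp
      then have "\<partial> s \<sqinter>\<^sub>B t \<preceq> b \<sqinter>\<^sub>B \<partial> s"
        using b(1) sS t(2) le_trans[of "\<partial> s \<sqinter>\<^sub>B t" t b] by (simp add: le_meet_iff)
      moreover have "e \<preceq> \<partial> s \<sqinter>\<^sub>B t" using sS t(2) by (simp add: one_le meet_P)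
      ultimately have "\<partial> s \<sqinter>\<^sub>B t = e" using bs sS t(2) le_antisym by simp
      then show ?thesis by (simp add: left_weighted_def t_def)
    qed simp
    then have "normal_factors (s # xs)" using xs proper by (auto simp: normal_factors_def successively_Cons)
    then show ?thesis using b xs by (metis braid_prod_simps(2))
  qed
qed

text \<open>
  The normal form of \<open>(s\<^sub>1 \<cdots> s\<^sub>l)\<^sup>-\<^sup>1 \<Delta>\<^sup>l\<close>. It is obtained from \<open>s\<^sup>-\<^sup>1 = \<partial>s \<Delta>\<^sup>-\<^sup>1\<close> by moving all powers of
  \<open>\<Delta>\<close> to the right.
\<close>

fun coinverse :: "braid list \<Rightarrow> braid list" where
  "coinverse [] = []"
| "coinverse (s # xs) = coinverse xs @ [T (int (length xs)) (\<partial> s)]"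

lemma length_coinverse [simp]: "length (coinverse xs) = length xs"
  by (induction xs) auto

lemma coinverse_nonempty [simp]: "coinverse xs = [] \<longleftrightarrow> xs = []"
  by (induction xs) auto

lemma set_coinverse: "set xs \<subseteq> S - {e, \<Delta>} \<Longrightarrow> set (coinverse xs) \<subseteq> S - {e, \<Delta>}"
  by (induction xs) (auto simp: T_eq_e T_eq_\<Delta> comp_eq_e comp_eq_\<Delta>)

lemma hd_coinverse: "xs \<noteq> [] \<Longrightarrow> set xs \<subseteq> G \<Longrightarrow> hd (coinverse xs) = \<partial> (last xs)"
  by (induction xs) auto

text \<open>
  Adjacent factors of the new list are, up to a power of \<open>\<tau>\<close>, \<open>\<partial>t\<close> and \<open>\<tau>(\<partial>s)\<close> for adjacent factors
  \<open>s\<close>, \<open>t\<close> of the old one. As \<open>\<partial>\<partial>t = \<tau>(t)\<close>, the two conditions of being left-weighted are the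
  same up to \<open>\<tau>\<close>.
\<close>

lemma normal_factors_coinverse: "normal_factors xs \<Longrightarrow> normal_factors (coinverse xs)"
proof (induction xs)
  case (Cons s xs)
  show ?case
  proof (cases xs)
    case Nil
    then show ?thesis using Cons.prems set_coinverse[of "[s]"] by (simp add: normal_factors_def)
  next
    case (Cons t ys)
    then have xs: "normal_factors xs" "lw s t" and G: "s \<in> G" "t \<in> G"
      using Cons.prems normal_factors_G[OF Cons.prems] by (auto simp: normal_factors_def)
    have "lw (\<partial> t) (T 1 (\<partial> s))" using lw_comp G xs by blast
    then have "lw (T (int (length ys)) (\<partial> t)) (T (int (length ys)) (T 1 (\<partial> s)))" using G by (simp del: T_T)
    then have "lw (last (coinverse xs)) (T (int (length xs)) (\<partial> s))" using G Cons by simp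
    moreover have "successively lw (coinverse xs)" using Cons.IH xs by (simp add: normal_factors_def)
    ultimately show ?thesis using set_coinverse[of "s # xs"] Cons.prems
      by (simp add: normal_factors_def successively_append_iff)
  qed
qed (simp add: normal_factors_def)

lemma pr_coinverse: "set xs \<subseteq> S \<Longrightarrow> pr (coinverse xs) = iv (pr xs) \<cdot> \<Delta>pow (int (length xs))"
proof (induction xs)
  case (Cons s xs)
  have c: "set (coinverse xs) \<subseteq> S" using Cons.prems by (induction xs) auto
  have sets: "set xs \<subseteq> G" "set (coinverse xs) \<subseteq> G" using Cons.prems c S_subset_G by auto
  have G: "s \<in> G" "pr xs \<in> G" using Cons.prems sets by simp_all
  have "pr (coinverse (s # xs)) = iv (pr xs) \<cdot> (\<Delta>pow (int (length xs)) \<cdot> T (int (length xs)) (\<partial> s))"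
    using Cons sets G by (simp add: braid_prod_append braid_prod_simps m_assoc)
  also have "\<dots> = iv (pr xs) \<cdot> (\<partial> s \<cdot> \<Delta>pow (int (length xs)))"
    using G by (simp add: mult_\<Delta>pow)
  also have "\<dots> = iv (pr (s # xs)) \<cdot> \<Delta>pow (int (length (s # xs)))"
    using G \<Delta>pow_add[of 1 "int (length xs)"]
    by (simp add: complement_def braid_prod_simps inv_mult_group m_assoc)
  finally show ?case .
qed (simp add: braid_prod_simps)

lemma normal_factors_T: "normal_factors xs \<Longrightarrow> normal_factors (map (T k) xs)"
proof -
  assume xs: "normal_factors xs"
  note G = normal_factors_G[OF xs]
  have "set (map (T k) xs) \<subseteq> S - {e, \<Delta>}"
    using xs G by (auto simp: normal_factors_def T_eq_e T_eq_\<Delta> subset_iff)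
  moreover have "successively lw (map (T k) xs)"
    unfolding successively_map
    by (rule successively_mono[of lw]) (use xs G in \<open>auto simp: normal_factors_def subset_iff\<close>)
  ultimately show ?thesis by (simp add: normal_factors_def)
qed

lemma normal_form_T:
  assumes "is_left_normal_form n x p xs" shows "is_left_normal_form n (T k x) p (map (T k) xs)"
  using assms normal_factors_G[of xs] normal_factors_T[of xs k]
  by (auto simp: normal_form_iff T_mult T_pr)

lemma normal_form_inv:
  assumes "is_left_normal_form n x p xs"
  shows "is_left_normal_form n (iv x) (- p - int (length xs))
    (map (T (- p - int (length xs))) (coinverse xs))"
proof -
  let ?q = "- p - int (length xs)"
  have xs: "x = \<Delta>pow p \<cdot> pr xs" "normal_factors xs" using assms by (auto simp: normal_form_iff)
  note G = normal_factors_G[OF xs(2)] normal_factors_G[OF normal_factors_coinverse[OF xs(2)]]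
  have "\<Delta>pow ?q \<cdot> pr (map (T ?q) (coinverse xs)) = pr (coinverse xs) \<cdot> \<Delta>pow ?q"
    using G by (simp add: mult_\<Delta>pow T_pr)
  also have "\<dots> = iv (pr xs) \<cdot> \<Delta>pow (- p)"
    using G pr_coinverse[OF normal_factors_S[OF xs(2)]] \<Delta>pow_add[of "int (length xs)" ?q]
    by (simp add: m_assoc)
  also have "\<dots> = iv x" using xs G by (simp add: inv_mult_group \<Delta>pow_minus)
  finally show ?thesis using normal_factors_T[OF normal_factors_coinverse[OF xs(2)]] by (simp add: normal_form_iff)
qed

end

text \<open>
  With fewer than two strands \<open>\<Delta> = 1\<close>, the exponent in a left normal form is arbitrary and the
  invariants derived from it are meaningless.
\<close>

locale nontrivial_braids = braid_strands +
  assumes garside_nontrivial: "garside n \<noteq> \<one>\<^bsub>\<B> n\<^esub>"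
begin

abbreviation inf :: "braid \<Rightarrow> int" where "inf \<equiv> inf_braid n"
abbreviation cl :: "braid \<Rightarrow> nat" ("\<ell>") where "\<ell> \<equiv> canonical_length n"
abbreviation fac :: "braid \<Rightarrow> braid list" where "fac \<equiv> factors_braid n"
abbreviation ini :: "braid \<Rightarrow> braid" ("\<iota>") where "\<iota> \<equiv> initial_factor n"
abbreviation fin :: "braid \<Rightarrow> braid" ("\<phi>") where "\<phi> \<equiv> final_factor n"
definition sup_braid :: "braid \<Rightarrow> int" where "sup_braid x = inf x + int (\<ell> x)"

lemma normal_factors_not_\<Delta>: assumes "normal_factors xs" shows "\<not> \<Delta> \<preceq> pr xs"
proof
  assume "\<Delta> \<preceq> pr xs"
  then have eq: "pr xs \<sqinter>\<^sub>B \<Delta> = \<Delta>"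
    using meet_absorb[of \<Delta> "pr xs"] meet_comm[of \<Delta> "pr xs"] normal_factors_G[OF assms] by simp
  show False
  proof (cases "xs = []")
    case True
    then have "\<Delta> = e" using eq meet_absorb[of e \<Delta>] by (simp add: braid_prod_simps one_le)
    then show False using garside_nontrivial by simp
  next
    case False
    then show False using normal_factors_head[OF assms] eq by simp
  qed
qed

text \<open>
  The first factor is determined as the meet with \<open>\<Delta>\<close>, and it can be cancelled.
\<close>

lemma normal_factors_unique: "normal_factors xs \<Longrightarrow> normal_factors ys \<Longrightarrow> pr xs = pr ys \<Longrightarrow> xs = ys"
proof (induction xs arbitrary: ys)
  case Nil
  show ?case
  proof (rule ccontr)
    assume "[] \<noteq> ys"
    then have "pr ys \<sqinter>\<^sub>B \<Delta> \<noteq> e" using normal_factors_head[OF Nil(2)] by simp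
    then show False using meet_absorb[of e \<Delta>] by (simp add: braid_prod_simps one_le flip: Nil(3))
  qed
next
  case (Cons s xs)
  note G = normal_factors_G[OF Cons.prems(1)] normal_factors_G[OF Cons.prems(2)]
  have s: "pr (s # xs) \<sqinter>\<^sub>B \<Delta> = s" using normal_factors_head[OF Cons.prems(1)] by simp
  obtain t zs where ys: "ys = t # zs"
  proof (cases ys)
    case Nil
    then have "s = e" using s Cons.prems meet_absorb[of e \<Delta>] by (simp add: braid_prod_simps one_le)
    then show ?thesis using Cons.prems by (simp add: normal_factors_def)
  qed
  then have "t = s" using normal_factors_head[OF Cons.prems(2)] Cons.prems(3) s by simp
  moreover have "normal_factors xs" "normal_factors zs" using Cons.prems ys by (auto simp: normal_factors_def successively_Cons)
  moreover have "pr xs = pr zs" using Cons.prems(3) G ys \<open>t = s\<close> by (simp add: braid_prod_simps)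
  ultimately show ?case using Cons.IH ys by blast
qed

lemma normal_form_unique:
  assumes "is_left_normal_form n x p xs" "is_left_normal_form n x q ys"
  shows "p = q" "xs = ys"
proof -
  have le: "p \<le> q" if "\<Delta>pow p \<cdot> pr xs = \<Delta>pow q \<cdot> pr ys" "normal_factors xs" "normal_factors ys" for p q xs ys
  proof (rule ccontr)
    assume "\<not> p \<le> q"
    then have "1 \<le> p - q" by simp
    have G: "pr xs \<in> G" "pr ys \<in> G" using that normal_factors_G by auto
    have "pr ys = \<Delta>pow (- q) \<cdot> (\<Delta>pow p \<cdot> pr xs)" using that G by (simp add: \<Delta>pow_minus)
    also have "\<dots> = \<Delta>pow (p - q) \<cdot> pr xs" using G \<Delta>pow_add[of "- q" p] by (simp flip: m_assoc)
    finally have "\<Delta>pow (p - q) \<preceq> pr ys" using pr_S_in_P[OF normal_factors_S[OF that(2)]] by simp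
    moreover have "\<Delta> \<preceq> \<Delta>pow (p - q)" using \<Delta>pow_le[OF \<open>1 \<le> p - q\<close>] by simp
    ultimately have "\<Delta> \<preceq> pr ys" using le_trans[of \<Delta> "\<Delta>pow (p - q)" "pr ys"] G by simp
    then show False using normal_factors_not_\<Delta> that by blast
  qed
  have A: "\<Delta>pow p \<cdot> pr xs = \<Delta>pow q \<cdot> pr ys" "normal_factors xs" "normal_factors ys"
    using assms by (auto simp: normal_form_iff)
  then show pq: "p = q" using le[of p xs q ys] le[of q ys p xs] by simp
  then have "pr xs = pr ys" using A normal_factors_G by simp
  then show "xs = ys" using normal_factors_unique A by blast
qed

lemma normal_form_exists: assumes "x \<in> G" shows "\<exists>p xs. is_left_normal_form n x p xs"
proof -
  have dpos: "0 < deg \<Delta>" using deg_P[of \<Delta>] deg_P_0[of \<Delta>] garside_nontrivial by force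
  have *: "\<exists>p b. b \<in> P \<and> \<not> \<Delta> \<preceq> b \<and> a = \<Delta>pow p \<cdot> b" if "a \<in> P" for a using that
  proof (induction "nat (deg a)" arbitrary: a rule: less_induct)
    case less
    show ?case
    proof (cases "\<Delta> \<preceq> a")
      case False
      then show ?thesis using less.prems by (intro exI[of _ 0] exI[of _ a]) simp
    next
      case True
      then obtain a' where a': "a' \<in> P" "a = \<Delta> \<cdot> a'" using le_obtain less.prems by (metis P_in_G garside_in_G)
      then have "nat (deg a') < nat (deg a)" using dpos deg_P[of a'] by simp
      then obtain p b where b: "b \<in> P" "\<not> \<Delta> \<preceq> b" "a' = \<Delta>pow p \<cdot> b" using less.hyps a' by blast
      then have "a = \<Delta>pow (1 + p) \<cdot> b" using a' by (simp add: \<Delta>pow_add m_assoc)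
      then show ?thesis using b by blast
    qed
  qed
  obtain m :: nat where m: "(\<Delta> \<cdot> \<Delta>) [^]\<^bsub>\<B> n\<^esub> m \<cdot> x \<in> P" using garside_power_positive[OF assms] .
  have "(\<Delta> \<cdot> \<Delta>) [^]\<^bsub>\<B> n\<^esub> m = \<Delta>pow (2 * int m)"
  proof (induction m)
    case (Suc m)
    have "\<Delta>pow (2 * int (Suc m)) = \<Delta>pow (2 * int m) \<cdot> (\<Delta> \<cdot> \<Delta>)"
      using \<Delta>pow_add[of "2 * int m" 2] \<Delta>pow_add[of 1 1] by (simp add: algebra_simps)
    then show ?case using Suc by simp
  qed simp
  with * m obtain p b where b: "b \<in> P" "\<not> \<Delta> \<preceq> b" "\<Delta>pow (2 * int m) \<cdot> x = \<Delta>pow p \<cdot> b" by metis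
  obtain xs where "normal_factors xs" "b = pr xs" using P_normal_form b by blast
  moreover have "x = \<Delta>pow (- (2 * int m)) \<cdot> (\<Delta>pow p \<cdot> b)"
    using b assms by (simp add: \<Delta>pow_minus flip: b(3))
  then have "x = \<Delta>pow (- (2 * int m) + p) \<cdot> b" using b(1) unfolding \<Delta>pow_add by (simp add: m_assoc)
  ultimately show ?thesis by (auto simp: normal_form_iff)
qed

lemma left_normal_form_eq:
  assumes "is_left_normal_form n x p xs"
  shows "inf x = p" "fac x = xs" "\<ell> x = length xs"
    "\<iota> x = (if xs = [] then e else T (- p) (hd xs))" "\<phi> x = (if xs = [] then \<Delta> else last xs)"
proof -
  have "left_normal_form n x = (p, xs)" unfolding left_normal_form_def
  proof (rule the_equality)
    fix d assume "is_left_normal_form n x (fst d) (snd d)"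
    from normal_form_unique[OF assms this] show "d = (p, xs)" by (cases d) simp
  qed (use assms in simp)
  then show i: "inf x = p" and f: "fac x = xs" by (simp_all add: inf_braid_def factors_braid_def)
  then show "\<ell> x = length xs" by (simp add: canonical_length_def)
  then show "\<iota> x = (if xs = [] then e else T (- p) (hd xs))" "\<phi> x = (if xs = [] then \<Delta> else last xs)"
    using i f by (simp_all add: initial_factor_def final_factor_def)
qed

lemma normal_form: "x \<in> G \<Longrightarrow> is_left_normal_form n x (inf x) (fac x)"
  using normal_form_exists left_normal_form_eq by metis

lemma normal_form_eqs:
  assumes "x \<in> G"
  shows "x = \<Delta>pow (inf x) \<cdot> pr (fac x)" "normal_factors (fac x)" "\<ell> x = length (fac x)"
  using normal_form[OF assms] left_normal_form_eq[OF normal_form[OF assms]]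
  by (simp_all add: normal_form_iff)

lemma le_inf_iff: assumes "x \<in> G" shows "\<Delta>pow k \<preceq> x \<longleftrightarrow> k \<le> inf x"
proof -
  note x = normal_form_eqs[OF assms]
  have G: "pr (fac x) \<in> G" using x normal_factors_G by simp
  have eq: "\<Delta>pow k \<preceq> x \<longleftrightarrow> \<Delta>pow (k - inf x) \<preceq> pr (fac x)"
    using le_left_shift[of "\<Delta>pow (inf x)" "pr (fac x)" "\<Delta>pow k"] G x(1) \<Delta>pow_add[of "- inf x" k]
    by (simp add: \<Delta>pow_minus)
  show ?thesis
  proof
    assume "\<Delta>pow k \<preceq> x"
    then have *: "\<Delta>pow (k - inf x) \<preceq> pr (fac x)" using eq by simp
    show "k \<le> inf x"
    proof (rule ccontr)
      assume "\<not> k \<le> inf x"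
      then have "\<Delta> \<preceq> \<Delta>pow (k - inf x)" using \<Delta>pow_le[of 1 "k - inf x"] by simp
      then have "\<Delta> \<preceq> pr (fac x)" using * le_trans[of \<Delta> "\<Delta>pow (k - inf x)" "pr (fac x)"] G by simp
      then show False using normal_factors_not_\<Delta> x by blast
    qed
  next
    assume "k \<le> inf x"
    then have "\<Delta>pow (k - inf x) \<preceq> e" using \<Delta>pow_le[of "k - inf x" 0] by simp
    moreover have "e \<preceq> pr (fac x)" using pr_S_in_P[OF normal_factors_S[OF x(2)]] by (simp add: one_le)
    ultimately show "\<Delta>pow k \<preceq> x" using eq le_trans[of "\<Delta>pow (k - inf x)" e "pr (fac x)"] G by simp
  qed
qed

lemma inverse_invariants:
  assumes "x \<in> G"
  shows "inf (iv x) = - sup_braid x" "\<ell> (iv x) = \<ell> x" "\<iota> (iv x) = \<partial> (\<phi> x)" "sup_braid (iv x) = - inf x"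
proof -
  note nf = normal_form[OF assms] and x = normal_form_eqs[OF assms]
  note i = left_normal_form_eq[OF normal_form_inv[OF nf]]
  show 1: "inf (iv x) = - sup_braid x" "\<ell> (iv x) = \<ell> x" using i x by (simp_all add: sup_braid_def)
  then show "sup_braid (iv x) = - inf x" by (simp add: sup_braid_def)
  note G = normal_factors_G[OF x(2)]
  have "\<partial> \<Delta> = e" by (simp add: comp_eq_e)
  then show "\<iota> (iv x) = \<partial> (\<phi> x)"
    using i(4) left_normal_form_eq(5)[OF nf] hd_coinverse[OF _ G] G last_in_set[of "fac x"]
    by (cases "fac x = []") (simp_all add: hd_map subset_iff)
qed

text \<open>
  By inversion this is the statement about \<open>inf\<close> for the inverse braid.
\<close>

lemma le_sup_iff: assumes "x \<in> G" shows "x \<preceq> \<Delta>pow k \<longleftrightarrow> sup_braid x \<le> k"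
proof -
  have "x \<preceq> \<Delta>pow k \<longleftrightarrow> e \<preceq> iv x \<cdot> \<Delta>pow k" using assms by (simp add: le_iff)
  also have "\<dots> \<longleftrightarrow> \<Delta>pow (- k) \<preceq> iv x" using le_right_shift[of "iv x" e k] assms by simp
  also have "\<dots> \<longleftrightarrow> sup_braid x \<le> k" using le_inf_iff[of "iv x" "- k"] inverse_invariants(1)[OF assms] assms by auto
  finally show ?thesis .
qed

text \<open>
  A description of the initial factor without reference to the normal form; it is also
  correct for powers of \<open>\<Delta>\<close>.
\<close>

lemma initial_meet: assumes "x \<in> G" shows "\<iota> x = (x \<cdot> \<Delta>pow (- inf x)) \<sqinter>\<^sub>B \<Delta>"
proof -
  note x = normal_form_eqs[OF assms] and i = left_normal_form_eq(4)[OF normal_form[OF assms]]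
  note G = normal_factors_G[OF x(2)]
  have "x \<cdot> \<Delta>pow (- inf x) = T (- inf x) (pr (fac x))"
    using arg_cong[OF x(1), of "\<lambda>y. y \<cdot> \<Delta>pow (- inf x)"] \<Delta>pow_mult[of "pr (fac x)" "inf x"] G
    by (simp add: m_assoc \<Delta>pow_minus)
  then have eq: "(x \<cdot> \<Delta>pow (- inf x)) \<sqinter>\<^sub>B \<Delta> = T (- inf x) (pr (fac x) \<sqinter>\<^sub>B \<Delta>)"
    using G by (simp add: meet_T)
  show ?thesis
  proof (cases "fac x = []")
    case True
    then show ?thesis using i eq meet_absorb[of e \<Delta>] by (simp add: braid_prod_simps one_le)
  next
    case False
    then show ?thesis using i eq normal_factors_head[OF x(2)] by simp
  qed
qed

lemma initial_S: "x \<in> G \<Longrightarrow> \<iota> x \<in> S"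
proof -
  assume x: "x \<in> G"
  have "\<Delta>pow (inf x) \<preceq> x" using x le_inf_iff by simp
  then have "x \<cdot> \<Delta>pow (- inf x) \<in> P" using le_right_shift[of x e "- inf x"] x by (simp add: one_le)
  then show ?thesis using initial_meet[OF x] x by (simp add: S_iff meet_P del: S_in_P S_in_G S_le)
qed

end

section \<open>Rigid braids\<close>

context braid_strands
begin

abbreviation cj :: "braid \<Rightarrow> braid \<Rightarrow> braid" where "cj \<equiv> conjug n"

lemma conjug_in_G [simp]: "y \<in> G \<Longrightarrow> u \<in> G \<Longrightarrow> cj y u \<in> G" by (simp add: conjug_def)
lemma conjug_e [simp]: "y \<in> G \<Longrightarrow> cj y e = y" by (simp add: conjug_def)
lemma conjug_conjug: "y \<in> G \<Longrightarrow> u \<in> G \<Longrightarrow> v \<in> G \<Longrightarrow> cj (cj y u) v = cj y (u \<cdot> v)"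
  by (simp add: conjug_def inv_mult_group m_assoc)
lemma mult_conjug: "y \<in> G \<Longrightarrow> u \<in> G \<Longrightarrow> u \<cdot> cj y u = y \<cdot> u" by (simp add: conjug_def m_assoc)
lemma conjug_fixed_iff: "x \<in> G \<Longrightarrow> g \<in> G \<Longrightarrow> cj x g = x \<longleftrightarrow> g \<cdot> x = x \<cdot> g"
proof -
  assume G: "x \<in> G" "g \<in> G"
  have "cj x g = iv g \<cdot> (x \<cdot> g)" using G by (simp add: conjug_def m_assoc)
  then show ?thesis using mult_conjug[of x g] G by (metis inv_cancel_left)
qed

lemma conjug_inv: "y \<in> G \<Longrightarrow> u \<in> G \<Longrightarrow> iv (cj y u) = cj (iv y) u"
  by (simp add: conjug_def inv_mult_group m_assoc)
lemma conjug_\<Delta>: "y \<in> G \<Longrightarrow> cj y \<Delta> = T 1 y" by (simp add: conjug_def T_eq)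

end

context nontrivial_braids
begin

lemma rigid_iff: "x \<in> G \<Longrightarrow> rigid n x \<longleftrightarrow> 0 < \<ell> x \<and> \<iota> (iv x) \<sqinter>\<^sub>B \<iota> x = e"
  by (simp add: rigid_def left_weighted_def inverse_invariants)

lemma rigid_normal_form:
  assumes "is_left_normal_form n x p xs"
  shows "rigid n x \<longleftrightarrow> xs \<noteq> [] \<and> lw (last xs) (T (- p) (hd xs))"
  using left_normal_form_eq[OF assms] by (auto simp: rigid_def)

lemma normal_factors_append:
  "normal_factors xs \<Longrightarrow> normal_factors ys \<Longrightarrow> (xs \<noteq> [] \<Longrightarrow> ys \<noteq> [] \<Longrightarrow> lw (last xs) (hd ys)) \<Longrightarrow> normal_factors (xs @ ys)"
  by (auto simp: normal_factors_def successively_append_iff)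

text \<open>
  Rigidity makes the concatenation of normal forms of \<open>x\<close>, shifted by powers of \<open>\<tau>\<close>, left-weighted
  at every junction. The last clause of the induction hypothesis records the first factor, which
  meets the next copy.
\<close>

lemma rigid_power:
  assumes "x \<in> G" "rigid n x"
  shows "inf (x [^]\<^bsub>\<B> n\<^esub> m) = int m * inf x" "sup_braid (x [^]\<^bsub>\<B> n\<^esub> m) = int m * sup_braid x"
proof -
  define p xs where "p = inf x" and "xs = fac x"
  have x: "x = \<Delta>pow p \<cdot> pr xs" "normal_factors xs" "\<ell> x = length xs"
    using normal_form_eqs[OF assms(1)] by (simp_all add: p_def xs_def)
  have r: "xs \<noteq> []" "lw (last xs) (T (- p) (hd xs))"
    using rigid_normal_form[OF normal_form[OF assms(1)]] assms(2) by (simp_all add: p_def xs_def)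
  note G = normal_factors_G[OF x(2)]
  have hl: "hd xs \<in> G" "last xs \<in> G" using G r(1) hd_in_set last_in_set by blast+
  have "\<exists>L. normal_factors L \<and> x [^]\<^bsub>\<B> n\<^esub> m = \<Delta>pow (int m * p) \<cdot> pr L \<and> length L = m * length xs \<and>
      (L \<noteq> [] \<longrightarrow> hd L = T ((int m - 1) * p) (hd xs))"
  proof (induction m)
    case 0
    then show ?case by (intro exI[of _ "[]"]) (simp add: normal_factors_def braid_prod_simps)
  next
    case (Suc m)
    then obtain L where L: "normal_factors L" "x [^]\<^bsub>\<B> n\<^esub> m = \<Delta>pow (int m * p) \<cdot> pr L"
      "length L = m * length xs" "L \<noteq> [] \<longrightarrow> hd L = T ((int m - 1) * p) (hd xs)" by blast
    let ?k = "int m * p"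
    let ?L = "map (T ?k) xs @ L"
    have "lw (T ?k (last xs)) (T ?k (T (- p) (hd xs)))" using r hl by (simp del: T_T)
    moreover have "T ?k (T (- p) (hd xs)) = T ((int m - 1) * p) (hd xs)" using hl by (simp add: algebra_simps)
    ultimately have "normal_factors ?L"
      by (intro normal_factors_append normal_factors_T) (use x L r in \<open>auto simp: last_map\<close>)
    moreover have "x [^]\<^bsub>\<B> n\<^esub> Suc m = \<Delta>pow (int (Suc m) * p) \<cdot> pr ?L"
    proof -
      have PG: "pr xs \<in> G" "pr L \<in> G" "set (map (T ?k) xs) \<subseteq> G" using G normal_factors_G[OF L(1)] by auto
      have "x [^]\<^bsub>\<B> n\<^esub> Suc m = x \<cdot> x [^]\<^bsub>\<B> n\<^esub> m" using assms(1) by (rule nat_pow_Suc2)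
      also have "\<dots> = \<Delta>pow p \<cdot> (pr xs \<cdot> \<Delta>pow ?k) \<cdot> pr L"
        unfolding L(2) using PG by (subst x(1)) (simp add: m_assoc)
      also have "\<dots> = (\<Delta>pow p \<cdot> \<Delta>pow ?k) \<cdot> (T ?k (pr xs) \<cdot> pr L)"
        using PG by (simp add: mult_\<Delta>pow[of "pr xs"] m_assoc)
      also have "T ?k (pr xs) \<cdot> pr L = pr ?L"
        using PG normal_factors_G[OF L(1)] G by (simp add: T_pr braid_prod_append)
      finally show ?thesis by (simp add: \<Delta>pow_add[symmetric] algebra_simps)
    qed
    moreover have "hd ?L = T ((int (Suc m) - 1) * p) (hd xs)" using r by (simp add: hd_map)
    ultimately show ?case using L(3) by (intro exI[of _ ?L]) simp
  qed
  then obtain L where L: "is_left_normal_form n (x [^]\<^bsub>\<B> n\<^esub> m) (int m * p) L" "length L = m * length xs"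
    by (auto simp: normal_form_iff)
  from left_normal_form_eq(1,3)[OF L(1)] L(2) x(3)
  show "inf (x [^]\<^bsub>\<B> n\<^esub> m) = int m * inf x" "sup_braid (x [^]\<^bsub>\<B> n\<^esub> m) = int m * sup_braid x"
    by (simp_all add: sup_braid_def p_def algebra_simps)
qed

lemma \<Delta>pow_bounds: "x \<in> G \<Longrightarrow> \<Delta>pow (inf x) \<preceq> x" "x \<in> G \<Longrightarrow> x \<preceq> \<Delta>pow (sup_braid x)"
  by (simp_all add: le_inf_iff le_sup_iff)

lemma inf_mult: "x \<in> G \<Longrightarrow> y \<in> G \<Longrightarrow> inf x + inf y \<le> inf (x \<cdot> y)"
  using le_\<Delta>pow_mult(1)[OF _ _ \<Delta>pow_bounds(1) \<Delta>pow_bounds(1)] by (simp add: le_inf_iff)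

lemma sup_mult: "x \<in> G \<Longrightarrow> y \<in> G \<Longrightarrow> sup_braid (x \<cdot> y) \<le> sup_braid x + sup_braid y"
  using le_\<Delta>pow_mult(2)[OF _ _ \<Delta>pow_bounds(2) \<Delta>pow_bounds(2)] by (simp add: le_sup_iff)

lemma inf_e: "inf e = 0" and sup_e: "sup_braid e = 0"
proof -
  have "is_left_normal_form n e 0 []" by (simp add: normal_form_iff normal_factors_def braid_prod_simps)
  from left_normal_form_eq[OF this] show "inf e = 0" "sup_braid e = 0" by (simp_all add: sup_braid_def)
qed

lemma power_bounds:
  assumes "y \<in> G"
  shows "int m * inf y \<le> inf (y [^]\<^bsub>\<B> n\<^esub> m)" "sup_braid (y [^]\<^bsub>\<B> n\<^esub> m) \<le> int m * sup_braid y"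
proof (induction m)
  case 0
  { case 1 show ?case by (simp add: inf_e) next case 2 show ?case by (simp add: sup_e) }
next
  case (Suc m)
  { case 1 show ?case using Suc(1) inf_mult[of "y [^]\<^bsub>\<B> n\<^esub> m" y] assms by (simp add: algebra_simps)
  next case 2 show ?case using Suc(2) sup_mult[of "y [^]\<^bsub>\<B> n\<^esub> m" y] assms by (simp add: algebra_simps) }
qed

lemma conj_power: "x \<in> G \<Longrightarrow> g \<in> G \<Longrightarrow> x [^]\<^bsub>\<B> n\<^esub> (m::nat) = g \<cdot> (cj x g [^]\<^bsub>\<B> n\<^esub> m \<cdot> iv g)"
  by (induction m) (simp_all add: m_assoc conjug_def)

text \<open>
  Conjugation by a fixed \<open>g\<close> changes \<open>inf\<close> and \<open>sup\<close> by at most a constant, while \<open>inf\<close> and \<open>sup\<close>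
  of powers are superadditive and subadditive in general and additive for a rigid braid. Hence no
  conjugate has larger \<open>inf\<close> or smaller \<open>sup\<close> than a rigid braid.
\<close>

lemma rigid_extremal:
  assumes "x \<in> G" "rigid n x" "g \<in> G"
  shows "inf (cj x g) \<le> inf x" "sup_braid x \<le> sup_braid (cj x g)"
proof -
  let ?y = "cj x g"
  have y: "?y \<in> G" using assms by simp
  define c where "c = sup_braid g - inf g"
  have b: "int m * inf ?y - c \<le> int m * inf x" "int m * sup_braid x \<le> int m * sup_braid ?y + c" for m
  proof -
    let ?ym = "?y [^]\<^bsub>\<B> n\<^esub> m"
    have e: "x [^]\<^bsub>\<B> n\<^esub> m = g \<cdot> (?ym \<cdot> iv g)" using conj_power assms by blast
    have "inf g + (inf ?ym + inf (iv g)) \<le> inf (x [^]\<^bsub>\<B> n\<^esub> m)"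
      using inf_mult[of g "?ym \<cdot> iv g"] inf_mult[of ?ym "iv g"] assms y e by simp
    then show "int m * inf ?y - c \<le> int m * inf x"
      using power_bounds(1)[OF y, of m] rigid_power(1)[OF assms(1,2), of m] inverse_invariants(1)[OF assms(3)]
      by (simp add: c_def)
    have "sup_braid (x [^]\<^bsub>\<B> n\<^esub> m) \<le> sup_braid g + (sup_braid ?ym + sup_braid (iv g))"
      using sup_mult[of g "?ym \<cdot> iv g"] sup_mult[of ?ym "iv g"] assms y e by simp
    then show "int m * sup_braid x \<le> int m * sup_braid ?y + c"
      using power_bounds(2)[OF y, of m] rigid_power(2)[OF assms(1,2), of m] inverse_invariants(4)[OF assms(3)]
      by (simp add: c_def)
  qed
  have key: "a \<le> b" if "\<And>m::nat. int m * a \<le> int m * b + c" for a b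
  proof (rule ccontr)
    assume "\<not> a \<le> b"
    then have "b + 1 \<le> a" by simp
    \<comment> \<open>a power large enough to outweigh the constant\<close>
    let ?m = "nat (\<bar>c\<bar> + 1)"
    have "int ?m * (b + 1) \<le> int ?m * a" using \<open>b + 1 \<le> a\<close> by (intro mult_left_mono) auto
    then show False using that[of ?m] by (simp add: algebra_simps)
  qed
  show "inf ?y \<le> inf x"
  proof (rule key)
    show "int m * inf ?y \<le> int m * inf x + c" for m using b(1)[of m] by simp
  qed
  show "sup_braid x \<le> sup_braid ?y" by (rule key[OF b(2)])
qed

lemma rigid_conj_invariants:
  assumes "x \<in> G" "rigid n x" "g \<in> G" "rigid n (cj x g)"
  shows "inf (cj x g) = inf x" "sup_braid (cj x g) = sup_braid x"
proof -
  have "cj (cj x g) (iv g) = x" using assms by (simp add: conjug_conjug)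
  then show "inf (cj x g) = inf x" "sup_braid (cj x g) = sup_braid x"
    using rigid_extremal[OF assms(1-3)] rigid_extremal[of "cj x g" "iv g"] assms by auto
qed

lemma initial_meet_inverse:
  assumes "z \<in> G"
  shows "(z \<cdot> \<Delta>pow (- inf z)) \<sqinter>\<^sub>B (iv z \<cdot> \<Delta>pow (sup_braid z)) \<sqinter>\<^sub>B \<Delta> = \<iota> (iv z) \<sqinter>\<^sub>B \<iota> z"
  using initial_meet[OF assms] initial_meet[of "iv z"] inverse_invariants(1)[OF assms] assms
  by (intro le_eqI) (auto simp: le_meet_iff)

text \<open>
  Let \<open>y\<close> have positive canonical length, and let \<open>p\<close> and \<open>q\<close> be its \<open>inf\<close> and \<open>sup\<close>. By
  \<open>initial_meet_inverse\<close>, a conjugate \<open>z = y\<^sup>u\<close> with the same \<open>p\<close> and \<open>q\<close> is rigid if and only if the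
  meet of \<open>z \<Delta>\<^sup>-\<^sup>p\<close>, \<open>z\<^sup>-\<^sup>1 \<Delta>\<^sup>q\<close> and \<open>\<Delta>\<close> is trivial. The map below is \<open>u\<close> times this
  meet, rewritten with \<open>u z = y u\<close>, so that \<open>u\<close> occurs only as the middle factor of products.
\<close>

definition rigidity_map :: "braid \<Rightarrow> braid \<Rightarrow> braid" where
  "rigidity_map y u =
     (y \<cdot> u \<cdot> \<Delta>pow (- inf y)) \<sqinter>\<^sub>B (iv y \<cdot> u \<cdot> \<Delta>pow (sup_braid y)) \<sqinter>\<^sub>B (u \<cdot> \<Delta>)"

lemma rigidity_map_meet:
  assumes "y \<in> G" "u \<in> G" "v \<in> G"
  shows "rigidity_map y (u \<sqinter>\<^sub>B v) = rigidity_map y u \<sqinter>\<^sub>B rigidity_map y v"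
proof -
  have "(u \<sqinter>\<^sub>B v) \<cdot> \<Delta> = (u \<cdot> \<Delta>) \<sqinter>\<^sub>B (v \<cdot> \<Delta>)" using meet_right[of u v 1] assms by simp
  then show ?thesis unfolding rigidity_map_def
    using assms by (intro le_eqI) (auto simp: le_meet_iff meet_left meet_right)
qed

text \<open>
  If \<open>u\<close> is a fixed point, then the three factors of the meet are positive, which bounds \<open>inf\<close> and
  \<open>sup\<close> of the conjugate; by extremality of the rigid braid \<open>y\<close> both are those of \<open>y\<close>.
\<close>

lemma rigid_conj_iff:
  assumes "y \<in> G" "rigid n y" "u \<in> G"
  shows "rigid n (cj y u) \<longleftrightarrow> rigidity_map y u = u"
proof -
  define z where "z = cj y u"
  have z: "z \<in> G" "u \<cdot> z = y \<cdot> u" "u \<cdot> iv z = iv y \<cdot> u"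
    using assms mult_conjug[of "iv y" u] by (simp_all add: z_def mult_conjug conjug_inv)
  let ?M = "(z \<cdot> \<Delta>pow (- inf y)) \<sqinter>\<^sub>B (iv z \<cdot> \<Delta>pow (sup_braid y)) \<sqinter>\<^sub>B \<Delta>"
  have "rigidity_map y u = u \<cdot> ?M"
    unfolding rigidity_map_def using assms z(1) by (simp add: meet_left z(2,3)[symmetric] m_assoc)
  then have eq: "rigidity_map y u = u \<longleftrightarrow> ?M = e" using assms z by simp
  show ?thesis
  proof
    assume r: "rigid n (cj y u)"
    then have "inf z = inf y" "sup_braid z = sup_braid y" using rigid_conj_invariants[OF assms] by (simp_all add: z_def)
    then have "?M = e" using initial_meet_inverse[OF z(1)] r rigid_iff[OF z(1)] by (simp add: z_def)
    then show "rigidity_map y u = u" using eq by simp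
  next
    assume "rigidity_map y u = u"
    then have M: "?M = e" using eq by simp
    then have "e \<preceq> ?M" by simp
    then have le: "e \<preceq> z \<cdot> \<Delta>pow (- inf y)" "e \<preceq> iv z \<cdot> \<Delta>pow (sup_braid y)"
      using z(1) by (simp_all add: le_meet_iff)
    have "inf y \<le> inf z" using le(1) le_right_shift[of z e "- inf y"] z(1) le_inf_iff by simp
    moreover have "z \<preceq> \<Delta>pow (sup_braid y)" using le(2) z(1) by (simp add: le_iff)
    then have "sup_braid z \<le> sup_braid y" using z(1) le_sup_iff by simp
    ultimately have "inf z = inf y" "sup_braid z = sup_braid y" using rigid_extremal[OF assms] by (simp_all add: z_def)
    then have "\<iota> (iv z) \<sqinter>\<^sub>B \<iota> z = e" "\<ell> z = \<ell> y"
      using M initial_meet_inverse[OF z(1)] by (simp_all add: sup_braid_def)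
    then show "rigid n (cj y u)" using rigid_iff[OF z(1)] assms(2) rigid_iff[OF assms(1)] by (simp add: z_def)
  qed
qed

text \<open>
  Left multiplication by braids and right multiplication by powers of \<open>\<Delta>\<close> preserve meets, so the
  fixed points of \<open>rigidity_map y\<close> are closed under meets.
\<close>

theorem rigid_conj_meet:
  assumes "y \<in> G" "rigid n y" "u \<in> G" "v \<in> G" "rigid n (cj y u)" "rigid n (cj y v)"
  shows "rigid n (cj y (u \<sqinter>\<^sub>B v))"
  using assms rigid_conj_iff rigidity_map_meet[of y u v] by simp

lemma T_invariants:
  assumes "x \<in> G"
  shows "\<iota> (T k x) = T k (\<iota> x)" "rigid n (T k x) \<longleftrightarrow> rigid n x" "cycling n (T k x) = T k (cycling n x)"
proof -
  note nf = normal_form[OF assms] and nfT = normal_form_T[OF normal_form[OF assms], of k]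
  have G: "set (fac x) \<subseteq> G" using normal_form_eqs(2)[OF assms] normal_factors_G by blast
  then have hl: "hd (fac x) \<in> G" "last (fac x) \<in> G" if "fac x \<noteq> []"
    using that hd_in_set last_in_set by blast+
  show i: "\<iota> (T k x) = T k (\<iota> x)"
    using left_normal_form_eq(4)[OF nf] left_normal_form_eq(4)[OF nfT] hl
    by (simp add: hd_map add.commute)
  have "T (- inf x) (T k (hd (fac x))) = T k (T (- inf x) (hd (fac x)))" if "fac x \<noteq> []"
    using hl that by (simp add: add.commute)
  then show "rigid n (T k x) \<longleftrightarrow> rigid n x"
    using rigid_normal_form[OF nf] rigid_normal_form[OF nfT] hl
    by (auto simp: hd_map last_map simp del: T_T)
  show "cycling n (T k x) = T k (cycling n x)"
    using assms initial_S[OF assms] by (simp add: cycling_def i conjug_def T_mult T_inv)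
qed

lemma cycling_power_T:
  assumes "\<And>j. (cycling n ^^ j) x \<in> G"
  shows "(cycling n ^^ j) (T k x) = T k ((cycling n ^^ j) x)"
  by (induction j) (simp_all add: T_invariants(3) assms)

text \<open>
  Cycling a rigid braid rotates its normal form, twisting the moved factor by \<open>\<tau>\<close>.
\<close>

lemma rigid_cycling_normal_form:
  assumes "is_left_normal_form n x p (s # ys)" "rigid n x"
  shows "is_left_normal_form n (cycling n x) p (ys @ [T (- p) s])" "rigid n (cycling n x)"
    "\<phi> (cycling n x) = \<iota> x"
proof -
  have x: "x = \<Delta>pow p \<cdot> pr (s # ys)" "normal_factors (s # ys)" using assms(1) by (auto simp: normal_form_iff)
  have G: "s \<in> G" "set ys \<subseteq> G" using normal_factors_G[OF x(2)] by auto
  have r: "lw (last (s # ys)) (T (- p) s)" using rigid_normal_form[OF assms(1)] assms(2) by simp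
  have i: "\<iota> x = T (- p) s" using left_normal_form_eq(4)[OF assms(1)] by simp
  have "cycling n x = iv (T (- p) s) \<cdot> \<Delta>pow p \<cdot> (s \<cdot> pr ys) \<cdot> T (- p) s"
    using G unfolding cycling_def i conjug_def by (subst x(1)) (simp add: braid_prod_simps m_assoc)
  also have "iv (T (- p) s) \<cdot> \<Delta>pow p = \<Delta>pow p \<cdot> iv s"
    using G \<Delta>pow_mult[of "iv s" p] by (simp add: T_inv)
  finally have "cycling n x = \<Delta>pow p \<cdot> pr (ys @ [T (- p) s])"
    using G by (simp add: braid_prod_append braid_prod_simps m_assoc)
  moreover have "normal_factors [T (- p) s]" using x(2) G by (simp add: normal_factors_def T_eq_e T_eq_\<Delta>)
  then have "normal_factors (ys @ [T (- p) s])"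
    using x(2) r by (intro normal_factors_append) (auto simp: normal_factors_def successively_Cons)
  ultimately show nf: "is_left_normal_form n (cycling n x) p (ys @ [T (- p) s])"
    by (simp add: normal_form_iff)
  show "\<phi> (cycling n x) = \<iota> x" using left_normal_form_eq(5)[OF nf] i by simp
  have "lw s (hd (ys @ [T (- p) s]))"
    using r x(2) by (cases ys) (auto simp: normal_factors_def)
  moreover have "hd (ys @ [T (- p) s]) \<in> G" using G by (cases ys) auto
  ultimately have "lw (T (- p) s) (T (- p) (hd (ys @ [T (- p) s])))" using G by (simp del: T_T)
  then show "rigid n (cycling n x)" using rigid_normal_form[OF nf] by simp
qed

lemma rigid_cycling:
  assumes "x \<in> G" "rigid n x"
  shows "cycling n x \<in> G" "rigid n (cycling n x)" "\<phi> (cycling n x) = \<iota> x"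
proof -
  obtain s ys where "fac x = s # ys"
    using rigid_normal_form[OF normal_form[OF assms(1)]] assms(2) by (cases "fac x") auto
  then have "is_left_normal_form n x (inf x) (s # ys)" using normal_form[OF assms(1)] by simp
  from rigid_cycling_normal_form[OF this assms(2)]
  show "rigid n (cycling n x)" "\<phi> (cycling n x) = \<iota> x" by simp_all
  show "cycling n x \<in> G" using initial_S[OF assms(1)] assms by (simp add: cycling_def)
qed

lemma rigid_cycling_power:
  assumes "x \<in> G" "rigid n x"
  shows "(cycling n ^^ j) x \<in> G \<and> rigid n ((cycling n ^^ j) x)"
  by (induction j) (auto simp: assms rigid_cycling)

lemma rigid_cycling_rotate:
  assumes "is_left_normal_form n x p xs" "rigid n x" "j \<le> length xs"
  shows "is_left_normal_form n ((cycling n ^^ j) x) p (drop j xs @ map (T (- p)) (take j xs)) \<and>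
    rigid n ((cycling n ^^ j) x)"
  using assms(3)
proof (induction j)
  case 0
  then show ?case using assms by simp
next
  case (Suc j)
  then have j: "j < length xs" by simp
  have "drop j xs @ map (T (- p)) (take j xs) = xs ! j # (drop (Suc j) xs @ map (T (- p)) (take j xs))"
    using Cons_nth_drop_Suc[OF j] by (metis append_Cons)
  with Suc j rigid_cycling_normal_form(1,2)[of "(cycling n ^^ j) x" p "xs ! j" "drop (Suc j) xs @ map (T (- p)) (take j xs)"]
  show ?case by (simp add: take_Suc_conv_app_nth)
qed

text \<open>
  After as many cyclings as there are factors, every factor has been moved once and, with
  \<open>p\<close> for the \<open>inf\<close> of \<open>x\<close>, the result is
  \<open>\<tau>\<^sup>-\<^sup>p(x)\<close>; repeating this gives \<open>\<tau>\<^sup>-\<^sup>2\<^sup>p(x) = x\<close>.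
\<close>

lemma rigid_cycling_periodic:
  assumes "x \<in> G" "rigid n x"
  obtains m where "0 < m" "(cycling n ^^ m) x = x"
proof -
  let ?l = "length (fac x)"
  note x = normal_form_eqs[OF assms(1)]
  have G: "set (fac x) \<subseteq> G" using x normal_factors_G by blast
  have l: "0 < ?l" using assms x by (simp add: rigid_def)
  have orbG: "(cycling n ^^ j) x \<in> G" for j using rigid_cycling_power[OF assms] by blast
  have "is_left_normal_form n ((cycling n ^^ ?l) x) (inf x) (map (T (- inf x)) (fac x))"
    using rigid_cycling_rotate[OF normal_form[OF assms(1)] assms(2), of ?l] by simp
  moreover have "is_left_normal_form n (T (- inf x) x) (inf x) (map (T (- inf x)) (fac x))"
    by (rule normal_form_T[OF normal_form[OF assms(1)]])
  ultimately have 1: "(cycling n ^^ ?l) x = T (- inf x) x" by (simp add: normal_form_iff)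
  have "(cycling n ^^ (?l + ?l)) x = (cycling n ^^ ?l) (T (- inf x) x)" by (simp only: funpow_add o_apply 1)
  also have "\<dots> = T (- inf x) (T (- inf x) x)" using cycling_power_T[OF orbG] 1 by simp
  also have "\<dots> = T (2 * (- inf x)) x" using assms(1) by simp
  also have "\<dots> = x" using T_2[OF assms(1)] by blast
  finally show ?thesis using that[of "?l + ?l"] l by simp
qed

text \<open>
  Rigid braids have minimal canonical length among their conjugates by \<open>rigid_extremal\<close>, and they
  are periodic under cycling.
\<close>

theorem rigid_conj_in_USS:
  assumes "x \<in> G" "z \<in> conjugates n x" "rigid n z"
  shows "z \<in> USS n x"
proof -
  obtain g where g: "g \<in> G" "z = cj x g" using assms(2) by (auto simp: conjugates_def)
  have z: "z \<in> G" using g assms by simp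
  have "\<ell> z \<le> \<ell> y" if y: "y \<in> conjugates n x" for y
  proof -
    obtain h where h: "h \<in> G" "y = cj x h" using y by (auto simp: conjugates_def)
    then have "y = cj z (iv g \<cdot> h)" using g assms by (simp add: conjug_conjug)
    then show ?thesis using rigid_extremal[OF z assms(3), of "iv g \<cdot> h"] g h by (simp add: sup_braid_def)
  qed
  then have "summit_length n x = \<ell> z"
    unfolding summit_length_def using assms(2) by (intro Least_equality) auto
  then have "z \<in> SSS n x" using assms(2) by (simp add: SSS_def)
  moreover obtain m where "0 < m" "(cycling n ^^ m) z = z" using rigid_cycling_periodic[OF z assms(3)] .
  ultimately show ?thesis by (auto simp: USS_def)
qed

text \<open>
  The hypothesis on the meet says that appending \<open>t\<close> to the normal form of \<open>y\<close> gives a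
  left-weighted product, whose greatest simple prefix is therefore still the first factor of \<open>y\<close>.
  On the other hand \<open>y t = t y\<^sup>t\<close>, and \<open>y\<^sup>t\<close> is divisible by the same power of \<open>\<Delta>\<close> as \<open>y\<close>, so \<open>t\<close> is a
  simple prefix of this product once that power has been divided out.
\<close>

theorem simple_conjugator_below_initial:
  assumes "y \<in> G" "rigid n y" "t \<in> S" "inf y \<le> inf (cj y t)" "\<iota> (iv y) \<sqinter>\<^sub>B t = e"
  shows "t \<preceq> \<iota> y"
proof -
  let ?p = "inf y" and ?xs = "fac y" and ?z = "cj y t"
  note y = normal_form_eqs[OF assms(1)] and nf = normal_form[OF assms(1)]
  have ne: "?xs \<noteq> []" using rigid_normal_form[OF nf] assms(2) by simp
  have G: "set ?xs \<subseteq> G" "t \<in> G" using y normal_factors_G assms by auto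
  let ?zs = "map (T (- ?p)) ?xs @ [T (- ?p) t]"
  have "\<iota> (iv y) = \<partial> (last ?xs)" using inverse_invariants(3)[OF assms(1)] left_normal_form_eq(5)[OF nf] ne by simp
  then have "lw (last ?xs) t" using assms(5) by (simp add: left_weighted_def)
  moreover have "last ?xs \<in> G" using G ne last_in_set by blast
  ultimately have "lw (T (- ?p) (last ?xs)) (T (- ?p) t)" using G by simp
  then have "successively lw ?zs"
    using normal_factors_T[OF y(2), of "- ?p"] ne by (simp add: normal_factors_def successively_append_iff last_map)
  moreover have "set ?zs \<subseteq> S" using normal_factors_S[OF normal_factors_T[OF y(2), of "- ?p"]] assms G by simp
  ultimately have head: "pr ?zs \<sqinter>\<^sub>B \<Delta> = hd ?zs" by (intro weighted_head) simp_all
  have hd: "hd ?zs = \<iota> y" using left_normal_form_eq(4)[OF nf] ne by (simp add: hd_map)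
  have xsG: "pr ?xs \<in> G" using G by simp
  have mG: "set (map (T (- ?p)) ?xs) \<subseteq> G" using G by auto
  have "pr ?zs = T (- ?p) (pr ?xs \<cdot> t)"
    using G xsG mG by (simp add: braid_prod_append braid_prod_simps T_mult T_pr)
  also have "\<dots> = \<Delta>pow ?p \<cdot> (pr ?xs \<cdot> t) \<cdot> \<Delta>pow (- ?p)" by (simp add: T_eq \<Delta>pow_minus)
  also have "\<dots> = y \<cdot> t \<cdot> \<Delta>pow (- ?p)"
    using G xsG arg_cong[OF y(1), of "\<lambda>w. w \<cdot> t \<cdot> \<Delta>pow (- ?p)"] by (simp add: m_assoc)
  finally have zs: "pr ?zs = y \<cdot> t \<cdot> \<Delta>pow (- ?p)" .
  have "\<Delta>pow ?p \<preceq> ?z" using assms G le_inf_iff by simp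
  then have "t \<cdot> \<Delta>pow ?p \<preceq> t \<cdot> ?z" using assms G by simp
  then have "t \<cdot> \<Delta>pow ?p \<preceq> y \<cdot> t" using mult_conjug assms G by simp
  then have "t \<preceq> pr ?zs" using zs le_right_shift[of "y \<cdot> t" t "- ?p"] assms G by simp
  then have "t \<preceq> pr ?zs \<sqinter>\<^sub>B \<Delta>" using assms G zs by (simp add: le_meet_iff)
  then show ?thesis using head hd by simp
qed

end

section \<open>The centralizer of a rigid braid with minimal ultra summit set\<close>

lemma periodic_orbit:
  assumes "0 < m" "(f ^^ m) x = x"
  defines "k \<equiv> card (orbit f x)"
  shows "0 < k" "(f ^^ k) x = x" "(f ^^ i) x = (f ^^ j) x \<longleftrightarrow> i mod k = j mod k"
proof -
  define p where "p = (LEAST m. 0 < m \<and> (f ^^ m) x = x)"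
  have p: "0 < p" "(f ^^ p) x = x"
    using LeastI[of "\<lambda>m. 0 < m \<and> (f ^^ m) x = x" m] assms by (auto simp: p_def)
  have least: "p \<le> i" if "0 < i" "(f ^^ i) x = x" for i
    unfolding p_def using that by (intro Least_le) simp
  have inj: "i = j" if "i < p" "j < p" "(f ^^ i) x = (f ^^ j) x" for i j
    using that
  proof (induction i j rule: linorder_wlog)
    case (le i j)
    have "(f ^^ (i + (p - j))) x = (f ^^ (p - j)) ((f ^^ i) x)"
      by (subst add.commute) (simp add: funpow_add)
    also have "\<dots> = (f ^^ (p - j + j)) x" unfolding le(4) by (simp only: funpow_add o_apply)
    also have "\<dots> = x" using le p by simp
    finally have "p \<le> i + (p - j)" using le by (intro least) auto
    then show ?case using le by simp
  qed auto
  have mod: "(f ^^ (i mod p)) x = (f ^^ i) x" for i using funpow_mod_eq[OF p(2)] .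
  have iff: "(f ^^ i) x = (f ^^ j) x \<longleftrightarrow> i mod p = j mod p" for i j
    using inj[of "i mod p" "j mod p"] p(1) mod[of i] mod[of j] by auto
  have orb: "orbit f x = (\<lambda>i. (f ^^ i) x) ` {..<p}"
  proof
    show "orbit f x \<subseteq> (\<lambda>i. (f ^^ i) x) ` {..<p}"
    proof
      fix y assume "y \<in> orbit f x"
      then obtain i where "y = (f ^^ i) x" by (auto simp: orbit_altdef)
      then show "y \<in> (\<lambda>i. (f ^^ i) x) ` {..<p}" using mod[of i] p by (intro image_eqI[of _ _ "i mod p"]) auto
    qed
    show "(\<lambda>i. (f ^^ i) x) ` {..<p} \<subseteq> orbit f x"
    proof
      fix y assume "y \<in> (\<lambda>i. (f ^^ i) x) ` {..<p}"
      then obtain i where "y = (f ^^ i) x" by auto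
      then have "y = (f ^^ (i + p)) x" using p by (simp add: funpow_add)
      then show "y \<in> orbit f x" using p(1) by (auto simp: orbit_altdef)
    qed
  qed
  have "inj_on (\<lambda>i. (f ^^ i) x) {..<p}" using inj by (auto simp: inj_on_def)
  then have "card (orbit f x) = p" unfolding orb by (simp add: card_image)
  then have "k = p" by (simp add: k_def)
  then show "0 < k" "(f ^^ k) x = x" "(f ^^ i) x = (f ^^ j) x \<longleftrightarrow> i mod k = j mod k"
    using p iff by simp_all
qed

context nontrivial_braids
begin

abbreviation cyc :: "braid \<Rightarrow> nat \<Rightarrow> braid" where "cyc x i \<equiv> (cycling n ^^ i) x"

text \<open>
  The product \<open>A\<^sub>i\<close> of the first \<open>i\<close> cycling conjugators of \<open>x\<close>.
\<close>

definition cyc_prod :: "braid \<Rightarrow> nat \<Rightarrow> braid" where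
  "cyc_prod x i = pr (map (\<lambda>j. \<iota> (cyc x j)) [0..<i])"

context
  fixes x assumes x: "x \<in> G" "rigid n x"
begin

lemma cyc_in_G [simp]: "cyc x i \<in> G" and cyc_rigid: "rigid n (cyc x i)"
  using rigid_cycling_power[OF x] by auto

lemma initial_cyc_in_S [simp]: "\<iota> (cyc x i) \<in> S" by (rule initial_S) simp

lemma cyc_prod_0 [simp]: "cyc_prod x 0 = e" by (simp add: cyc_prod_def braid_prod_simps)

lemma initials_in_G: "set (map (\<lambda>j. \<iota> (cyc x (h j))) js) \<subseteq> G"
proof
  fix y assume "y \<in> set (map (\<lambda>j. \<iota> (cyc x (h j))) js)"
  then obtain j where "y = \<iota> (cyc x (h j))" by auto
  then show "y \<in> G" using initial_cyc_in_S by simp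
qed

lemma cyc_prod_in_G [simp]: "cyc_prod x i \<in> G"
  unfolding cyc_prod_def by (rule pr_in_G[OF initials_in_G[where h = "\<lambda>j. j"]])

lemma cyc_prod_add:
  "cyc_prod x (i + j) = cyc_prod x i \<cdot> pr (map (\<lambda>l. \<iota> (cyc x (i + l))) [0..<j])"
proof -
  have "[0..<i + j] = [0..<i] @ map (\<lambda>l. i + l) [0..<j]"
    using upt_add_eq_append[of 0 i j] map_add_upt[of i j] by (simp add: add.commute)
  then have "cyc_prod x (i + j) =
      pr (map (\<lambda>l. \<iota> (cyc x l)) [0..<i] @ map (\<lambda>l. \<iota> (cyc x (i + l))) [0..<j])"
    by (simp add: cyc_prod_def o_def)
  then show ?thesis
    using braid_prod_append[OF initials_in_G[where h = "\<lambda>j. j"] initials_in_G[where h = "\<lambda>j. i + j"]]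
    unfolding cyc_prod_def by metis
qed

lemma cyc_prod_Suc: "cyc_prod x (Suc i) = cyc_prod x i \<cdot> \<iota> (cyc x i)"
  using cyc_prod_add[of i 1] by (simp add: braid_prod_simps)

lemma conjug_cyc_prod: "cj x (cyc_prod x i) = cyc x i"
proof (induction i)
  case 0 then show ?case using x by simp
next
  case (Suc i)
  have "cj x (cyc_prod x (Suc i)) = cj (cyc x i) (\<iota> (cyc x i))"
    using conjug_conjug[of x "cyc_prod x i" "\<iota> (cyc x i)"] Suc x by (simp add: cyc_prod_Suc)
  then show ?case by (simp add: cycling_def[of n "cyc x i"])
qed

lemma cyc_prod_period: "cyc x k = x \<Longrightarrow> cyc_prod x (k + i) = cyc_prod x k \<cdot> cyc_prod x i"
proof -
  assume k: "cyc x k = x"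
  have "cyc x (k + l) = cyc x l" for l by (subst add.commute) (simp add: funpow_add k)
  then show ?thesis by (simp add: cyc_prod_add) (simp add: cyc_prod_def)
qed

lemma cyc_prod_T: "cyc x m = T 1 x \<Longrightarrow> cyc_prod x (m + i) = cyc_prod x m \<cdot> T 1 (cyc_prod x i)"
proof -
  assume m: "cyc x m = T 1 x"
  have "cyc x (m + l) = T 1 (cyc x l)" for l
    by (subst add.commute) (simp add: funpow_add m cycling_power_T)
  then have "cyc_prod x (m + i) = cyc_prod x m \<cdot> pr (map (\<lambda>l. T 1 (\<iota> (cyc x l))) [0..<i])"
    using cyc_prod_add[of m i] by (simp add: T_invariants)
  moreover have "T 1 (cyc_prod x i) = pr (map (\<lambda>l. T 1 (\<iota> (cyc x l))) [0..<i])"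
    unfolding cyc_prod_def using T_pr[OF initials_in_G[where h = "\<lambda>j. j"], of 1 "[0..<i]"]
    by (simp add: o_def)
  ultimately show ?thesis by simp
qed

lemma conj_cyc_initial: "cj (cyc x i) (\<iota> (cyc x i)) = cyc x (Suc i)"
  by (simp add: cycling_def[of n "cyc x i"])

text \<open>
  For a rigid \<open>w\<close> the final factor of \<open>\<^bold>c(w)\<close> is \<open>\<iota>(w)\<close>, so conjugating \<open>\<^bold>c(w)\<close> by
  \<open>\<iota>(\<^bold>c(w)\<^sup>-\<^sup>1) = \<iota>(w)\<^sup>-\<^sup>1\<Delta>\<close> undoes the cycling and applies \<open>\<tau>\<close>.
\<close>

lemma conj_cyc_initial_inverse:
  "\<iota> (iv (cyc x (Suc i))) = iv (\<iota> (cyc x i)) \<cdot> \<Delta>"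
  "cj (cyc x (Suc i)) (\<iota> (iv (cyc x (Suc i)))) = T 1 (cyc x i)"
proof -
  show eq: "\<iota> (iv (cyc x (Suc i))) = iv (\<iota> (cyc x i)) \<cdot> \<Delta>"
    using inverse_invariants(3)[of "cyc x (Suc i)"] rigid_cycling(3)[OF cyc_in_G cyc_rigid, of i] cyc_in_G[of "Suc i"]
    by (simp add: complement_def)
  have "cj (cj (cyc x i) (\<iota> (cyc x i))) (iv (\<iota> (cyc x i)) \<cdot> \<Delta>) =
      cj (cyc x i) (\<iota> (cyc x i) \<cdot> (iv (\<iota> (cyc x i)) \<cdot> \<Delta>))"
    by (rule conjug_conjug) simp_all
  then show "cj (cyc x (Suc i)) (\<iota> (iv (cyc x (Suc i)))) = T 1 (cyc x i)"
    unfolding eq conj_cyc_initial by (simp add: conjug_\<Delta>)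
qed

context
  fixes orb k
  assumes minimal: "minimal_USS n x"
    and one_orbit: "cycling_orbits n x = {orb}"
    and k: "card orb = k"
begin

lemma USS_iff: "y \<in> USS n x \<longleftrightarrow> (\<exists>i. y = cyc x i)"
proof
  have conj: "cyc x i \<in> conjugates n x" for i
    unfolding conjugates_def conjug_cyc_prod[symmetric] by simp
  have USS: "cyc x i \<in> USS n x" for i using rigid_conj_in_USS[OF x(1) conj cyc_rigid] .
  then show "\<exists>i. y = cyc x i \<Longrightarrow> y \<in> USS n x" by blast
  assume y: "y \<in> USS n x"
  then obtain m where "0 < m" "cyc y m = y" by (auto simp: USS_def)
  then have *: "y \<in> orbit (cycling n) y" by (force simp: orbit_altdef)
  have "orbit (cycling n) z \<in> cycling_orbits n x" if "z \<in> USS n x" for z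
    using that by (simp add: cycling_orbits_def)
  from this[OF y] this[OF USS[of 0]] have "orbit (cycling n) y = orbit (cycling n) x"
    by (simp add: one_orbit)
  with * have "y \<in> orbit (cycling n) x" by simp
  then show "\<exists>i. y = cyc x i" by (auto simp: orbit_altdef)
qed

lemma USS_iff_rigid: "u \<in> G \<Longrightarrow> cj (cyc x i) u \<in> USS n x \<longleftrightarrow> rigid n (cj (cyc x i) u)"
proof
  assume u: "u \<in> G"
  show "rigid n (cj (cyc x i) u)" if "cj (cyc x i) u \<in> USS n x" using that USS_iff cyc_rigid by metis
  have "cj (cyc x i) u = cj x (cyc_prod x i \<cdot> u)" using u x by (simp add: conjug_conjug flip: conjug_cyc_prod)
  then have "cj (cyc x i) u \<in> conjugates n x" using u by (auto simp: conjugates_def)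
  then show "cj (cyc x i) u \<in> USS n x" if "rigid n (cj (cyc x i) u)"
    using that rigid_conj_in_USS[OF x(1)] by blast
qed

text \<open>
  If \<open>t\<close> meets \<open>\<iota>(y\<^sup>-\<^sup>1)\<close> nontrivially, then the meet also leads to a rigid conjugate, so it is all of
  \<open>t\<close> and the arrow is grey. Otherwise the arrow is black by \<open>simple_conjugator_below_initial\<close>. The
  minimality of the ultra summit set leaves one label of each colour.
\<close>

lemma minimal_simple_cases:
  assumes t: "minimal_simple n x (cyc x i) t"
  shows "t = \<iota> (cyc x i) \<or> t = \<iota> (iv (cyc x i))"
proof -
  let ?y = "cyc x i"
  have yU: "?y \<in> USS n x" using USS_iff by blast
  have tS: "t \<in> S" "t \<noteq> e" "rigid n (cj ?y t)"
    and tmin: "\<And>v. v \<in> S \<Longrightarrow> v \<noteq> e \<Longrightarrow> v \<preceq> t \<Longrightarrow> v \<noteq> t \<Longrightarrow> \<not> rigid n (cj ?y v)"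
    using t USS_iff_rigid by (auto simp: minimal_simple_def)
  have arrow: "(?y, t, cj ?y t) \<in> arrows n x" using yU t by (auto simp: arrows_def)
  have black: "t = \<iota> ?y" if "t \<preceq> \<iota> ?y"
  proof -
    obtain z where "black_arrows_from n x ?y = {(?y, \<iota> ?y, z)}" using minimal yU unfolding minimal_USS_def by blast
    moreover have "(?y, t, cj ?y t) \<in> black_arrows_from n x ?y" using arrow that by (simp add: black_arrows_from_def)
    ultimately show ?thesis by simp
  qed
  have grey: "t = \<iota> (iv ?y)" if "t \<preceq> \<iota> (iv ?y)"
  proof -
    obtain z where "grey_arrows_from n x ?y = {(?y, \<iota> (iv ?y), z)}" using minimal yU unfolding minimal_USS_def by blast
    moreover have "(?y, t, cj ?y t) \<in> grey_arrows_from n x ?y" using arrow that by (simp add: grey_arrows_from_def)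
    ultimately show ?thesis by simp
  qed
  have meet: "t \<preceq> u" if u: "u \<in> S" "rigid n (cj ?y u)" "u \<sqinter>\<^sub>B t \<noteq> e" for u
  proof -
    have "rigid n (cj ?y (u \<sqinter>\<^sub>B t))"
      using rigid_conj_meet[OF cyc_in_G cyc_rigid] u tS by simp
    then have "u \<sqinter>\<^sub>B t = t" using tmin[of "u \<sqinter>\<^sub>B t"] u tS meet_S[of u t] by auto
    then show ?thesis using meet_le(1)[of u t] u tS by simp
  qed
  show ?thesis
  proof (cases "\<iota> (iv ?y) \<sqinter>\<^sub>B t = e")
    case True
    have "inf (cj ?y t) = inf ?y" using rigid_conj_invariants[OF cyc_in_G cyc_rigid] tS by simp
    then have "t \<preceq> \<iota> ?y" using simple_conjugator_below_initial[OF cyc_in_G cyc_rigid tS(1)] True by simp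
    then show ?thesis using black by blast
  next
    case False
    obtain p where p: "0 < p" "cyc x p = x" using rigid_cycling_periodic[OF x] .
    then obtain q where q: "p = Suc q" by (cases p) auto
    \<comment> \<open>by periodicity \<open>y\<close> is itself obtained by cycling from a rigid braid\<close>
    have y: "cyc x (Suc (q + i)) = ?y" using p q by (simp add: funpow_add flip: funpow.simps) (metis add.commute add_Suc funpow_add o_apply)
    have "rigid n (cj ?y (\<iota> (iv ?y)))"
      using conj_cyc_initial_inverse(2)[of "q + i"] cyc_rigid T_invariants(2)[of "cyc x (q + i)" 1] unfolding y by simp
    moreover have "\<iota> (iv ?y) \<in> S" by (rule initial_S) simp
    ultimately show ?thesis using meet False grey by blast
  qed
qed

text \<open>
  Both \<open>g\<close> and \<open>\<Delta>\<close> lead to rigid conjugates, hence so does their meet, a nontrivial simple prefix of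
  \<open>g\<close>. A shortest prefix of this kind is a minimal simple element.
\<close>

lemma conjugator_first_arrow:
  assumes "g \<in> P" "g \<noteq> e" "cj (cyc x i) g = cyc x j"
  obtains t h where "g = t \<cdot> h" "t \<in> S" "h \<in> P" "t \<noteq> e" "t = \<iota> (cyc x i) \<or> t = \<iota> (iv (cyc x i))"
proof -
  let ?y = "cyc x i"
  let ?Q = "\<lambda>v. v \<in> S \<and> v \<noteq> e \<and> v \<preceq> g \<and> rigid n (cj ?y v)"
  have "rigid n (cj ?y (g \<sqinter>\<^sub>B \<Delta>))"
    using rigid_conj_meet[OF cyc_in_G cyc_rigid, of g \<Delta>] assms cyc_rigid T_invariants(2)[of ?y 1]
    by (simp add: conjug_\<Delta>)
  moreover have "\<Delta> \<in> S" by (simp add: S_iff del: S_in_P S_in_G S_le)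
  ultimately have Q: "?Q (g \<sqinter>\<^sub>B \<Delta>)"
    using meet_S[of g \<Delta>] P_simple_factor[of g] assms by simp
  from ex_has_least_nat[of ?Q "g \<sqinter>\<^sub>B \<Delta>" "\<lambda>v. nat (deg v)", OF Q]
  obtain t where t: "?Q t" "\<And>v. ?Q v \<Longrightarrow> nat (deg t) \<le> nat (deg v)" by metis
  have "minimal_simple n x ?y t"
    unfolding minimal_simple_def
  proof (intro conjI ballI impI)
    show "t \<in> S" "t \<noteq> e" using t by auto
    then show "cj ?y t \<in> USS n x" using t(1) USS_iff_rigid by simp
    fix v assume v: "v \<in> S" "v \<noteq> e \<and> v \<preceq> t \<and> v \<noteq> t"
    show "cj ?y v \<notin> USS n x"
    proof
      assume "cj ?y v \<in> USS n x"
      then have "?Q v" using v USS_iff_rigid t(1) assms(1) le_trans[of v t g] by simp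
      then have "nat (deg t) \<le> nat (deg v)" by (rule t(2))
      then have "deg t \<le> deg v" using deg_P[of v] v by simp
      then show False using le_deg_eq[of v t] v t(1) by simp
    qed
  qed
  then have c: "t = \<iota> ?y \<or> t = \<iota> (iv ?y)" by (rule minimal_simple_cases)
  obtain h where "h \<in> P" "g = t \<cdot> h" using le_obtain[of t g] t(1) assms(1) by auto
  then show ?thesis using that t(1) c by blast
qed

text \<open>
  Induction along the walk that \<open>g\<close> describes. The index \<open>i\<close> counts cyclings without reduction modulo
  the period; \<open>A\<^sub>p \<in> H\<close> pays for shifting it by multiples of the period \<open>p\<close>.
\<close>

lemma conjugator_in_subgroup:
  assumes H: "subgroup H (\<B> n)"
    and p: "0 < p" "\<And>i j. cyc x i = cyc x j \<longleftrightarrow> i mod p = j mod p"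
    and pH: "cyc_prod x p \<in> H"
    and m: "cyc x m = T 1 x" and mH: "cyc_prod x m \<cdot> iv \<Delta> \<in> H"
    and g: "g \<in> P" "cj (cyc x i) g = cyc x j"
  shows "cyc_prod x i \<cdot> g \<cdot> iv (cyc_prod x j) \<in> H"
  using g
proof (induction "nat (deg g)" arbitrary: g i rule: less_induct)
  case less
  interpret H: subgroup H "\<B> n" by (rule H)
  let ?A = "cyc_prod x"
  have per: "cyc x p = x" using p(2)[of p 0] by simp
  have shift: "?A (q * p + r) \<cdot> iv (?A r) \<in> H" for q r
  proof (induction q)
    case 0 then show ?case by simp
  next
    case (Suc q)
    have "?A (Suc q * p + r) = ?A p \<cdot> ?A (q * p + r)"
      using cyc_prod_period[OF per, of "q * p + r"] by (simp add: add.assoc)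
    then have "?A (Suc q * p + r) \<cdot> iv (?A r) = ?A p \<cdot> (?A (q * p + r) \<cdot> iv (?A r))" by (simp add: m_assoc)
    then show ?case using H.m_closed[OF pH Suc] by simp
  qed
  show ?case
  proof (cases "g = e")
    case True
    then have "i mod p = j mod p" using less.prems p(2) by simp
    then have ij: "i = (i div p) * p + j mod p" "j = (j div p) * p + j mod p" by (metis div_mult_mod_eq)+
    have "?A i \<cdot> iv (?A (j mod p)) \<in> H" "?A j \<cdot> iv (?A (j mod p)) \<in> H"
      using shift[of "i div p" "j mod p"] shift[of "j div p" "j mod p"] ij by simp_all
    then have "(?A i \<cdot> iv (?A (j mod p))) \<cdot> iv (?A j \<cdot> iv (?A (j mod p))) \<in> H" by simp
    then show ?thesis using True by (simp add: inv_mult_group m_assoc)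
  next
    case False
    obtain t h where t: "g = t \<cdot> h" "t \<in> S" "h \<in> P" "t \<noteq> e" "t = \<iota> (cyc x i) \<or> t = \<iota> (iv (cyc x i))"
      using conjugator_first_arrow[OF less.prems(1) False less.prems(2)] .
    have "0 < deg t" using deg_P[of t] deg_P_0[of t] t by force
    then have dh: "nat (deg h) < nat (deg g)" using t deg_P[of h] by simp
    have cjh: "cj (cj (cyc x i) t) h = cyc x j" using less.prems t by (simp add: conjug_conjug)
    from t(5) show ?thesis
    proof
      assume ti: "t = \<iota> (cyc x i)"
      then have "cj (cyc x (Suc i)) h = cyc x j" using cjh conj_cyc_initial by simp
      from less.hyps[OF dh t(3) this] show ?thesis
        using t ti by (simp add: cyc_prod_Suc m_assoc)
    next
      assume ti: "t = \<iota> (iv (cyc x i))"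
      obtain q where q: "p + i = Suc q" using p(1) by (cases "p + i") auto
      have yq: "cyc x (Suc q) = cyc x i" using p(2)[of "Suc q" i] q[symmetric] by simp
      have tq: "t = iv (\<iota> (cyc x q)) \<cdot> \<Delta>" using conj_cyc_initial_inverse(1)[of q] ti yq by simp
      \<comment> \<open>the step goes back to position \<open>q = p + i - 1\<close> and then forward by \<open>m\<close> because of \<open>\<tau>\<close>;
        the period \<open>p\<close> is added so that the index stays natural for \<open>i = 0\<close>\<close>
      have "cj (cyc x i) t = T 1 (cyc x q)" using conj_cyc_initial_inverse(2)[of q] ti yq by simp
      also have "\<dots> = cyc x (m + q)"
        by (subst add.commute) (simp add: funpow_add m cycling_power_T)
      finally have "cj (cyc x (m + q)) h = cyc x j" using cjh by simp
      from less.hyps[OF dh t(3) this] have IH: "?A (m + q) \<cdot> h \<cdot> iv (?A j) \<in> H" .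
      have "?A (m + q) = (?A m \<cdot> iv \<Delta>) \<cdot> (?A q \<cdot> \<Delta>)"
        using cyc_prod_T[OF m, of q] by (simp add: T_eq m_assoc)
      then have 1: "iv (?A m \<cdot> iv \<Delta>) \<cdot> (?A (m + q) \<cdot> h \<cdot> iv (?A j)) = ?A q \<cdot> \<Delta> \<cdot> h \<cdot> iv (?A j)"
        using t(3) by (simp add: m_assoc inv_mult_group)
      have "?A (Suc q) \<cdot> t = ?A q \<cdot> \<Delta>" unfolding cyc_prod_Suc tq by (simp add: m_assoc)
      moreover have "?A (Suc q) = ?A p \<cdot> ?A i" using cyc_prod_period[OF per, of i] q by simp
      ultimately have E: "iv (?A p) \<cdot> (?A q \<cdot> \<Delta>) = ?A i \<cdot> t"
        using t(2) by (simp add: m_assoc flip: \<open>?A (Suc q) \<cdot> t = _\<close>)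
      have "iv (?A p) \<cdot> (?A q \<cdot> \<Delta> \<cdot> h \<cdot> iv (?A j)) = (iv (?A p) \<cdot> (?A q \<cdot> \<Delta>)) \<cdot> (h \<cdot> iv (?A j))"
        using t(3) by (simp add: m_assoc)
      also have "\<dots> = ?A i \<cdot> g \<cdot> iv (?A j)" unfolding E using t(1-3) by (simp add: m_assoc)
      finally have 2: "iv (?A p) \<cdot> (?A q \<cdot> \<Delta> \<cdot> h \<cdot> iv (?A j)) = ?A i \<cdot> g \<cdot> iv (?A j)" .
      show ?thesis unfolding 2[symmetric] 1[symmetric] using pH mH IH by simp
    qed
  qed
qed

text \<open>
  The three membership hypotheses on the generating set are what the walk uses: the period,
  the step back, and the power of \<open>\<Delta>\<^sup>2\<close> that makes an element of the centralizer positive.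
\<close>

lemma centralizer_eq_generate:
  assumes p: "0 < p" "\<And>i j. cyc x i = cyc x j \<longleftrightarrow> i mod p = j mod p"
    and gens: "X \<subseteq> braid_centralizer n x"
    and H: "cyc_prod x p \<in> generate (\<B> n) X" "\<Delta>pow 2 \<in> generate (\<B> n) X"
      "cyc_prod x m \<cdot> iv \<Delta> \<in> generate (\<B> n) X"
    and m: "cyc x m = T 1 x"
  shows "braid_centralizer n x = generate (\<B> n) X"
proof
  have XG: "X \<subseteq> G" using gens by (auto simp: braid_centralizer_def)
  have sub: "subgroup (generate (\<B> n) X) (\<B> n)" by (rule generate_is_subgroup[OF XG])
  interpret H: subgroup "generate (\<B> n) X" "\<B> n" by (rule sub)
  have Z: "subgroup (braid_centralizer n x) (\<B> n)"
  proof (rule subgroupI)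
    show "braid_centralizer n x \<subseteq> G" by (auto simp: braid_centralizer_def)
    have "e \<in> braid_centralizer n x" using x by (simp add: braid_centralizer_def)
    then show "braid_centralizer n x \<noteq> {}" by blast
    fix a b assume a: "a \<in> braid_centralizer n x"
    then have aG: "a \<in> G" "a \<cdot> x = x \<cdot> a" by (auto simp: braid_centralizer_def)
    have "iv a \<cdot> (a \<cdot> x) \<cdot> iv a = iv a \<cdot> (x \<cdot> a) \<cdot> iv a" using aG by simp
    then have "x \<cdot> iv a = iv a \<cdot> x" using aG(1) x by (simp add: m_assoc)
    then show "iv a \<in> braid_centralizer n x" using aG by (simp add: braid_centralizer_def)
    assume "b \<in> braid_centralizer n x"
    then have bG: "b \<in> G" "b \<cdot> x = x \<cdot> b" by (auto simp: braid_centralizer_def)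
    have "a \<cdot> b \<cdot> x = a \<cdot> (x \<cdot> b)" using aG(1) bG x by (simp add: m_assoc)
    also have "\<dots> = x \<cdot> (a \<cdot> b)" using aG bG(1) x by (simp flip: m_assoc)
    finally show "a \<cdot> b \<in> braid_centralizer n x" using aG bG by (simp add: braid_centralizer_def)
  qed
  show "generate (\<B> n) X \<subseteq> braid_centralizer n x" by (rule generate_subgroup_incl[OF gens Z])
  show "braid_centralizer n x \<subseteq> generate (\<B> n) X"
  proof
    fix g assume "g \<in> braid_centralizer n x"
    then have g: "g \<in> G" "g \<cdot> x = x \<cdot> g" by (auto simp: braid_centralizer_def)
    obtain q :: nat where q: "(\<Delta> \<cdot> \<Delta>) [^]\<^bsub>\<B> n\<^esub> q \<cdot> g \<in> P" using garside_power_positive[OF g(1)] .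
    let ?D = "(\<Delta> \<cdot> \<Delta>) [^]\<^bsub>\<B> n\<^esub> q"
    have "?D \<cdot> x = x \<cdot> ?D" by (rule group_commutes_pow) (use x garside_square_central in auto)
    then have "?D \<cdot> g \<cdot> x = x \<cdot> (?D \<cdot> g)" using g x by (metis garside_in_G m_assoc m_closed nat_pow_closed)
    then have "cj x (?D \<cdot> g) = x" using g x by (simp add: conjug_fixed_iff)
    then have "cj (cyc x 0) (?D \<cdot> g) = cyc x 0" by simp
    from conjugator_in_subgroup[OF sub p H(1) m H(3) q this]
    have "?D \<cdot> g \<in> generate (\<B> n) X" using g by simp
    moreover have "\<Delta> \<cdot> \<Delta> = \<Delta>pow 2" using \<Delta>pow_add[of 1 1] by simp
    then have "?D \<in> generate (\<B> n) X" using H(2) by (induction q) simp_all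
    ultimately have "iv ?D \<cdot> (?D \<cdot> g) \<in> generate (\<B> n) X" by simp
    then show "g \<in> generate (\<B> n) X" using g by simp
  qed
qed

lemma centralizer_of_minimal_rigid:
  shows "(cj x \<Delta> \<noteq> x \<longrightarrow> even k \<and>
      braid_centralizer n x = generate (\<B> n) {cyc_prod x (k div 2) \<cdot> iv \<Delta>, \<Delta> [^]\<^bsub>\<B> n\<^esub> (2::nat)}) \<and>
    (cj x \<Delta> = x \<longrightarrow> braid_centralizer n x = generate (\<B> n) {preferred_cycling_conjugator n x, \<Delta>})"
proof -
  obtain p0 where p0: "0 < p0" "cyc x p0 = x" using rigid_cycling_periodic[OF x] .
  have "x \<in> USS n x" using USS_iff[of x] by (metis funpow_0)
  then have "orbit (cycling n) x = orb" using one_orbit by (auto simp: cycling_orbits_def)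
  then have p: "0 < k" "cyc x k = x" "\<And>i j. cyc x i = cyc x j \<longleftrightarrow> i mod k = j mod k"
    using periodic_orbit[OF p0] k by simp_all
  have per: "cj x (cyc_prod x k) = x" using conjug_cyc_prod p by simp
  have Z: "g \<in> braid_centralizer n x" if "g \<in> G" "cj x g = x" for g
    using that x by (simp add: braid_centralizer_def conjug_fixed_iff)
  have D2: "\<Delta> [^]\<^bsub>\<B> n\<^esub> (2::nat) = \<Delta>pow 2" using int_pow_int[of "\<B> n" \<Delta> 2] by simp
  have cD: "cj x \<Delta> = T 1 x" using x by (simp add: conjug_\<Delta>)
  have PC: "preferred_cycling_conjugator n x = cyc_prod x k"
  proof -
    have "(LEAST t. 0 < t \<and> (\<exists>i<t. cyc x t = cyc x i)) = k"
    proof (rule Least_equality)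
      show "0 < k \<and> (\<exists>i<k. cyc x k = cyc x i)" using p by (intro conjI exI[of _ 0]) auto
      fix t assume t: "0 < t \<and> (\<exists>i<t. cyc x t = cyc x i)"
      then obtain i where "i < t" "t mod k = i mod k" using p(3) by auto
      then show "k \<le> t" by (metis linorder_not_less mod_less order_less_trans nat_neq_iff)
    qed
    then show ?thesis by (simp add: preferred_cycling_conjugator_def cyc_prod_def)
  qed
  have "rigid n (cj (cyc x 0) \<Delta>)" using x T_invariants(2)[of x 1] by (simp add: conjug_\<Delta>)
  then have "cj (cyc x 0) \<Delta> \<in> USS n x" using USS_iff_rigid[of \<Delta> 0] by simp
  then have "T 1 x \<in> USS n x" by (simp add: cD)
  then obtain m where "T 1 x = cyc x m" unfolding USS_iff ..
  then have "cyc x (m mod k) = T 1 x" using p(3)[of "m mod k" m] by simp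
  then obtain m where mk: "m < k" and m: "cyc x m = T 1 x" using p(1) mod_less_divisor by blast
  show ?thesis
  proof (intro conjI impI)
    assume ne: "cj x \<Delta> \<noteq> x"
    have "m \<noteq> 0" using ne m cD by (intro notI) simp
    have "cyc x (m + m) = cyc (cyc x m) m" by (simp only: funpow_add o_apply)
    also have "\<dots> = cyc (T 1 x) m" by (simp only: m)
    also have "\<dots> = T 1 (cyc x m)" by (rule cycling_power_T) simp
    also have "\<dots> = x" using m x T_2[of x 1] by simp
    finally have "(m + m) mod k = 0" using p(3)[of "m + m" 0] by simp
    then obtain q where q: "m + m = k * q" by (auto simp: mod_eq_0_iff_dvd elim: dvdE)
    have "q = 1"
    proof -
      have "q \<noteq> 0" using q \<open>m \<noteq> 0\<close> by (intro notI) simp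
      moreover have "\<not> 2 \<le> q" using mult_le_mono2[of 2 q k] q mk by linarith
      ultimately show ?thesis by simp
    qed
    \<comment> \<open>\<open>\<tau>\<^sup>2\<close> is the identity, so \<open>2m\<close> is a multiple of the period, and \<open>0 < m < k\<close>\<close>
    then have "m + m = k" using q by simp
    then show "even k" by auto
    have half: "k div 2 = m" using \<open>m + m = k\<close> by simp
    let ?h = "cyc_prod x m \<cdot> iv \<Delta>"
    let ?X = "{?h, \<Delta>pow 2}"
    have hG: "?h \<in> G" by simp
    have "cj x ?h = cj (cj x (cyc_prod x m)) (iv \<Delta>)" using x by (simp add: conjug_conjug)
    also have "\<dots> = cj (cj x \<Delta>) (iv \<Delta>)" by (simp only: conjug_cyc_prod m cD)
    also have "\<dots> = x" using x by (simp add: conjug_conjug)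
    finally have hZ: "?h \<in> braid_centralizer n x" using Z hG by blast
    have "cj x (\<Delta>pow 2) = x" using T_2[of x 1] x by (simp add: tau_pow_def)
    then have DZ: "\<Delta>pow 2 \<in> braid_centralizer n x" using Z by simp
    have XG: "?X \<subseteq> G" by simp
    interpret H: subgroup "generate (\<B> n) ?X" "\<B> n" by (rule generate_is_subgroup[OF XG])
    have X: "?h \<in> generate (\<B> n) ?X" "\<Delta>pow 2 \<in> generate (\<B> n) ?X" by (simp_all add: generate.incl)
    have "cyc_prod x k = cyc_prod x m \<cdot> T 1 (cyc_prod x m)"
      using cyc_prod_T[OF m, of m] \<open>m + m = k\<close> by simp
    also have "\<dots> = ?h \<cdot> ?h \<cdot> \<Delta>pow 2"
      using \<Delta>pow_add[of 1 1] by (simp add: T_eq m_assoc)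
    also have "\<dots> \<in> generate (\<B> n) ?X" using X by simp
    finally have "braid_centralizer n x = generate (\<B> n) ?X"
      using hZ DZ X by (intro centralizer_eq_generate[of k _ m]) (use p m in auto)
    then show "braid_centralizer n x = generate (\<B> n) {cyc_prod x (k div 2) \<cdot> iv \<Delta>, \<Delta> [^]\<^bsub>\<B> n\<^esub> (2::nat)}"
      unfolding half D2 .
  next
    assume eq: "cj x \<Delta> = x"
    let ?X = "{cyc_prod x k, \<Delta>}"
    have XZ: "?X \<subseteq> braid_centralizer n x" using Z per eq by simp
    have XG: "?X \<subseteq> G" by simp
    interpret H: subgroup "generate (\<B> n) ?X" "\<B> n" by (rule generate_is_subgroup[OF XG])
    have X: "cyc_prod x k \<in> generate (\<B> n) ?X" "\<Delta> \<in> generate (\<B> n) ?X" by (simp_all add: generate.incl)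
    have "\<Delta>pow 2 = \<Delta> \<cdot> \<Delta>" using \<Delta>pow_add[of 1 1] by simp
    then have D: "\<Delta>pow 2 \<in> generate (\<B> n) ?X" using X by simp
    have "cyc_prod x 0 \<cdot> iv \<Delta> \<in> generate (\<B> n) ?X" using X by simp
    then show "braid_centralizer n x = generate (\<B> n) {preferred_cycling_conjugator n x, \<Delta>}"
      unfolding PC using XZ X D p eq cD by (intro centralizer_eq_generate[of k _ 0]) auto
  qed
qed

end
end
end

theorem theorem5p5:
  fixes n k :: nat and x :: braid and a :: "nat \<Rightarrow> braid"
  assumes "x \<in> carrier (\<B> n)"
    and "rigid n x"
    and "minimal_USS n x"
    and "cycling_orbits n x = {orb}"
    and "card orb = k"
    and "\<And>j. j \<in> {1..k} \<Longrightarrow> a j = initial_factor n ((cycling n ^^ (j - 1)) x)"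
  shows "(conjug n x (garside n) \<noteq> x \<longrightarrow>
           even k \<and>
           braid_centralizer n x =
             generate (\<B> n)
               {braid_prod n (map a [1..<Suc (k div 2)]) \<otimes>\<^bsub>\<B> n\<^esub> inv\<^bsub>\<B> n\<^esub> (garside n),
                garside n [^]\<^bsub>\<B> n\<^esub> (2::nat)}) \<and>
         (conjug n x (garside n) = x \<longrightarrow>
           braid_centralizer n x =
             generate (\<B> n) {preferred_cycling_conjugator n x, garside n})"
proof -
  interpret braid_strands n .
  \<comment> \<open>an arrow carries a nontrivial simple label, so \<open>\<Delta> \<noteq> 1\<close> and normal forms are unique\<close>
  have "USS n x \<noteq> {}" using assms(4) by (auto simp: cycling_orbits_def)
  then obtain y z where "black_arrows_from n x y = {(y, initial_factor n y, z)}"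
    using assms(3) unfolding minimal_USS_def by blast
  then have "(y, initial_factor n y, z) \<in> black_arrows_from n x y" by simp
  then obtain s where s: "s \<in> S" "s \<noteq> e"
    by (auto simp: black_arrows_from_def arrows_def minimal_simple_def)
  have "garside n \<noteq> e"
  proof
    assume "garside n = e"
    then have "s \<preceq> e" using S_le[OF s(1)] by simp
    then show False using le_antisym[of s e] s by (simp add: one_le)
  qed
  then interpret nontrivial_braids n by unfold_locales
  have "map a [1..<Suc (k div 2)] = map (\<lambda>j. initial_factor n ((cycling n ^^ j) x)) [0..<k div 2]"
  proof -
    have "[1..<Suc (k div 2)] = map Suc [0..<k div 2]" by (simp add: map_Suc_upt del: upt_Suc)
    moreover have "a (Suc j) = initial_factor n ((cycling n ^^ j) x)" if "j < k div 2" for j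
      using assms(6)[of "Suc j"] that by auto
    ultimately show ?thesis by simp
  qed
  then have "cyc_prod x (k div 2) = braid_prod n (map a [1..<Suc (k div 2)])"
    by (simp only: cyc_prod_def)
  then show ?thesis using centralizer_of_minimal_rigid[OF assms(1-5)] by simp
qed

end
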